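(* Let $T>0$ and let $u_1,u_2:[0,T]\times\mathbb{T}^d\to[0,1]$ be two weak solutions (in the sense of the context) of $\partial_tu=\nabla\cdot D(u)\nabla u$ with the same initial data. Suppose that $D$ satisfies: there is a finite $C$ such that $|D(x)-D(y)|^2\le C(x(1-x))^{-1}|x-y|$ for all $x,y\in[0,1]$. Then $u_1=u_2$.
   Context: $D:[0,1]\to\mathbb{R}^{d\times d}$ is a measurable function with values in symmetric matrices satisfying $c^{-1}I\le D(m)\le cI$ for all $m$, for some $c<\infty$. $\mathbb{T}^d$ is the $d$-dimensional torus. A weak solution with initial data $u^0$ is a function $u:[0,T]\times\mathbb{T}^d\to[0,1]$ such that $\int_0^T\!\int_{\mathbb{T}^d}\frac{|\nabla u|^2}{u(1-u)}d\theta dt=\sup_\phi\int_0^T\!\int_{\mathbb{T}^d}[u\nabla\cdot\phi-|\phi|^2u(1-u)]d\theta dt<\infty$ (supremum over smooth vector fields $\phi$), and for every smooth test function $\phi$ on $[0,T]\times\mathbb{T}^d$: $\int_{\mathbb{T}^d}\phi u\,d\theta\big|_{t=0}^{t=T}=\int_0^T\!\int\partial_t\phi\,u\,d\theta dt-\int_0^T\!\int\nabla\phi\cdot D(u)\nabla u\,d\theta dt$, with $u(0,\cdot)=u^0$. *)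

theory Defs
  imports "HOL-Analysis.Analysis"
begin

text \<open>Points of space-time are pairs (t, x) with t real and x in R^d (type real^'d).
  The torus T^d is represented by Z^d-periodic functions on R^d, integrated over the
  unit cube [0,1]^d.\<close>

coinductive smooth_fun :: "('a::euclidean_space \<Rightarrow> real) \<Rightarrow> bool" where
  "f differentiable_on UNIV \<Longrightarrow>
   (\<forall>b\<in>Basis. smooth_fun (\<lambda>x. frechet_derivative f (at x) b)) \<Longrightarrow> smooth_fun f"

definition smooth_vf :: "('a::euclidean_space \<Rightarrow> real^'d) \<Rightarrow> bool" where
  "smooth_vf \<phi> \<longleftrightarrow> (\<forall>i. smooth_fun (\<lambda>p. \<phi> p $ i))"

definition space_periodic :: "(real \<times> (real^'d) \<Rightarrow> 'b) \<Rightarrow> bool" where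
  "space_periodic f \<longleftrightarrow> (\<forall>t x b. b \<in> (Basis :: (real^'d) set) \<longrightarrow> f (t, x + b) = f (t, x))"

definition cube :: "(real^'d) set" where
  "cube = cbox 0 One"

definition Omega :: "real \<Rightarrow> (real \<times> (real^'d)) set" where
  "Omega T = {0..T} \<times> cube"

definition pd :: "('a::euclidean_space \<Rightarrow> real) \<Rightarrow> 'a \<Rightarrow> 'a \<Rightarrow> real" where
  "pd f v p = frechet_derivative f (at p) v"

definition dt :: "(real \<times> (real^'d) \<Rightarrow> real) \<Rightarrow> real \<times> (real^'d) \<Rightarrow> real" where
  "dt f p = pd f (1, 0) p"

definition grad_x :: "(real \<times> (real^'d) \<Rightarrow> real) \<Rightarrow> real \<times> (real^'d) \<Rightarrow> real^'d" where
  "grad_x f p = (\<chi> i. pd f (0, axis i 1) p)"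

definition div_x :: "(real \<times> (real^'d) \<Rightarrow> real^'d) \<Rightarrow> real \<times> (real^'d) \<Rightarrow> real" where
  "div_x \<phi> p = (\<Sum>i\<in>UNIV. pd (\<lambda>q. \<phi> q $ i) (0, axis i 1) p)"

definition admissible_D :: "(real \<Rightarrow> real^'d^'d) \<Rightarrow> bool" where
  "admissible_D D \<longleftrightarrow> D \<in> borel_measurable borel \<and>
     (\<forall>m. transpose (D m) = D m) \<and>
     (\<exists>c::real. c > 0 \<and> (\<forall>m\<in>{0..1}. \<forall>\<xi>::real^'d.
         inverse c * norm \<xi> ^ 2 \<le> \<xi> \<bullet> (D m *v \<xi>) \<and> \<xi> \<bullet> (D m *v \<xi>) \<le> c * norm \<xi> ^ 2))"

text \<open>Weak solution of d_t u = div (D(u) grad u) on [0,T] x T^d with initial data u0.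
  g plays the role of the (distributional) spatial gradient of u.\<close>
definition weak_solution ::
  "(real \<Rightarrow> real^'d^'d) \<Rightarrow> real \<Rightarrow> (real^'d \<Rightarrow> real) \<Rightarrow> (real \<times> (real^'d) \<Rightarrow> real) \<Rightarrow> bool" where
  "weak_solution D T u0 u \<longleftrightarrow>
     u \<in> borel_measurable lborel \<and> space_periodic u \<and>
     (\<forall>p\<in>{0..T} \<times> UNIV. u p \<in> {0..1}) \<and>
     bdd_above {(LINT p:Omega T|lborel. u p * div_x \<phi> p - (norm (\<phi> p))\<^sup>2 * (u p * (1 - u p)))
                 | \<phi>. smooth_vf \<phi> \<and> space_periodic \<phi>} \<and>
     (\<exists>g :: real \<times> (real^'d) \<Rightarrow> real^'d.
        g \<in> borel_measurable lborel \<and>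
        set_integrable lborel (Omega T) (\<lambda>p. (norm (g p))\<^sup>2 / (u p * (1 - u p))) \<and>
        (\<forall>\<phi>. smooth_vf \<phi> \<and> space_periodic \<phi> \<longrightarrow>
           (LINT p:Omega T|lborel. u p * div_x \<phi> p) = - (LINT p:Omega T|lborel. g p \<bullet> \<phi> p)) \<and>
        (\<forall>\<phi>. smooth_fun \<phi> \<and> space_periodic \<phi> \<longrightarrow>
           (LINT x:cube|lborel. \<phi> (T, x) * u (T, x)) - (LINT x:cube|lborel. \<phi> (0, x) * u (0, x))
           = (LINT p:Omega T|lborel. dt \<phi> p * u p)
             - (LINT p:Omega T|lborel. grad_x \<phi> p \<bullet> (D (u p) *v g p)))) \<and>
     (\<forall>x. u (0, x) = u0 x)"

end

theory Submission
  imports Defs "HOL-Probability.Probability_Measure"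
begin

text \<open>Write \<open>w = u1 - u2\<close>, \<open>g = g1 - g2\<close> and \<open>F = D(u1) g1 - D(u2) g2\<close>. Testing \<open>dt w = div F\<close> with
  \<open>(T - t) f'(w)\<close> for \<open>f(r) = sqrt(r^2 + e^2) - e\<close> gives \<open>int f(w) \<le> - int (T - t) f''(w) g . F\<close>.
  Ellipticity of \<open>D(u2)\<close> absorbs \<open>g\<close> and leaves \<open>(c/4) T int f''(w) |D(u1) - D(u2)|^2 |g1|^2\<close>, which
  by the hypothesis on D is at most a constant times \<open>int f''(w) |w| |g1|^2 / (u1 (1 - u1))\<close>.
  As e tends to 0, \<open>f''(w) |w| \<le> 1\<close> tends to 0 pointwise, so that \<open>int |w| = 0\<close>.

  The test is justified by mollifying in space only, with the normalized powers of the trigonometric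
  polynomial \<open>prod (1 + cos 2 pi x_i) / 2\<close>: the functions \<open>t^n K(x - y)\<close> are admissible, and since
  polynomials are dense they show that the mollified w is, for each x, a primitive in t.

  Where u is 0 or 1, the weight \<open>1 / (u (1 - u))\<close> is \<open>1 / 0 = 0\<close> and says nothing about g.
  If g is integrable, it vanishes there by Stampacchia's theorem. Otherwise the integral of
  \<open>g . \<phi>\<close> has the junk value 0 for enough \<open>\<phi>\<close> to force u to be constant in space, and then
  conservation of mass makes both solutions equal to the same constant 0 or 1.\<close>

text \<open>Subtracting the two equations leaves the term (D(u1) - D(u2)) g1, over which ellipticity
  has no hold. Two features of the hypothesis make it affordable: the weight 1 / (x (1 - x)) is, at
  x = u1, the one in the dissipation integral of u1, and the factor |x - y| tempers f'', which alone
  is bounded only by 1 / e. Solutions carry no regularity in time, so values at single times mean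
  little. Integrating the chain inequality over t, instead of evaluating it at one time, is the
  source of the weight T - t. At a fixed point x the function w has no usable time derivative, while
  its mollification is a primitive of an integrable function. Convexity of f gives the chain rule as
  an inequality, which is the half required. Only w, g and F are mollified, after the nonlinear
  expressions have been formed, so no commutator with D arises. A kernel has to satisfy the
  coinductive predicate \<open>smooth_fun\<close>. Trigonometric polynomials form an algebra closed
  under differentiation and are periodic on their own, unlike a bump function, which would have to
  be periodized.\<close>

section \<open>Smooth test functions\<close>

text \<open>The flag B admits linear functions; without them all members are bounded.\<close>
inductive elem_fun :: "bool \<Rightarrow> ('a::euclidean_space \<Rightarrow> real) \<Rightarrow> bool" for B where
  elem_const: "elem_fun B (\<lambda>_. c)"
| elem_lin: "B \<Longrightarrow> elem_fun B (\<lambda>x. x \<bullet> a)"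
| elem_cos: "elem_fun B (\<lambda>x. cos (x \<bullet> a + c))"
| elem_add: "elem_fun B f \<Longrightarrow> elem_fun B g \<Longrightarrow> elem_fun B (\<lambda>x. f x + g x)"
| elem_mult: "elem_fun B f \<Longrightarrow> elem_fun B g \<Longrightarrow> elem_fun B (\<lambda>x. f x * g x)"

lemma elem_fun_has_derivative:
  assumes "elem_fun B f"
  shows "\<exists>f'. (\<forall>x. (f has_derivative f' x) (at x)) \<and> (\<forall>b. elem_fun B (\<lambda>x. f' x b))"
  using assms
proof induction
  case (elem_const c)
  show ?case by (rule exI[of _ "\<lambda>_ _. 0"]) (auto intro: elem_fun.elem_const)
next
  case (elem_lin a)
  show ?case
    by (rule exI[of _ "\<lambda>_ v. v \<bullet> a"])
      (auto intro: elem_fun.elem_const intro!: derivative_eq_intros)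
next
  case (elem_cos a c)
  \<comment> \<open>Differentiating a cosine shifts its phase by a quarter period, which keeps the
    derivative inside the class without a sine generator.\<close>
  have "elem_fun B (\<lambda>x. cos (x \<bullet> a + (c + pi/2)) * (b \<bullet> a))" for b
    by (intro elem_fun.intros)
  then have "elem_fun B (\<lambda>x. - sin (x \<bullet> a + c) * (b \<bullet> a))" for b
    by (simp add: cos_add sin_add add.assoc[symmetric])
  then show ?case
    by (intro exI[of _ "\<lambda>x v. - sin (x \<bullet> a + c) * (v \<bullet> a)"])
      (auto intro!: derivative_eq_intros simp: mult.commute)
next
  case (elem_add f g)
  then obtain f' g' where "\<forall>x. (f has_derivative f' x) (at x)" "\<forall>b. elem_fun B (\<lambda>x. f' x b)"
    "\<forall>x. (g has_derivative g' x) (at x)" "\<forall>b. elem_fun B (\<lambda>x. g' x b)" by blast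
  then show ?case
    by (intro exI[of _ "\<lambda>x v. f' x v + g' x v"])
      (auto intro: elem_fun.elem_add has_derivative_add)
next
  case (elem_mult f g)
  then obtain f' g' where *: "\<forall>x. (f has_derivative f' x) (at x)" "\<forall>b. elem_fun B (\<lambda>x. f' x b)"
    "\<forall>x. (g has_derivative g' x) (at x)" "\<forall>b. elem_fun B (\<lambda>x. g' x b)" by blast
  have "((\<lambda>x. f x * g x) has_derivative (\<lambda>v. f x * g' x v + f' x v * g x)) (at x)" for x
    using has_derivative_mult[of f "f' x" x UNIV g "g' x"] * by simp
  moreover have "elem_fun B (\<lambda>x. f x * g' x b + f' x b * g x)" for b
    by (intro elem_fun.elem_add elem_fun.elem_mult elem_mult.hyps *[rule_format])
  ultimately show ?case
    by (intro exI[of _ "\<lambda>x v. f x * g' x v + f' x v * g x"]) blast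
qed

lemma elem_fun_frechet:
  assumes "elem_fun B f"
  shows "(f has_derivative frechet_derivative f (at x)) (at x)"
    and "elem_fun B (\<lambda>x. frechet_derivative f (at x) b)"
proof -
  obtain f' where f': "\<forall>x. (f has_derivative f' x) (at x)" "\<forall>b. elem_fun B (\<lambda>x. f' x b)"
    using elem_fun_has_derivative[OF assms] by blast
  then have "frechet_derivative f (at x) = f' x" for x
    by (metis frechet_derivative_at)
  with f' show "(f has_derivative frechet_derivative f (at x)) (at x)"
    "elem_fun B (\<lambda>x. frechet_derivative f (at x) b)"
    by auto
qed

text \<open>Membership in the class is itself the coinduction invariant, because the class is closed
  under directional derivatives.\<close>

lemma elem_fun_smooth: "elem_fun B f \<Longrightarrow> smooth_fun f"
proof (coinduction arbitrary: f)
  case smooth_fun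
  then show ?case
    using elem_fun_frechet[OF smooth_fun]
    by (auto simp: differentiable_on_def differentiable_def)
qed

lemma elem_fun_continuous: "elem_fun B f \<Longrightarrow> continuous_on S f"
  by (meson elem_fun_frechet(1) has_derivative_continuous continuous_at_imp_continuous_on)

lemma elem_fun_borel [measurable_dest]: "elem_fun B f \<Longrightarrow> f \<in> borel_measurable borel"
  by (intro borel_measurable_continuous_onI elem_fun_continuous)

lemma elem_fun_mono: "elem_fun False f \<Longrightarrow> elem_fun B f"
  by (induction rule: elem_fun.induct) (auto intro: elem_fun.intros)

lemma elem_fun_bounded:
  assumes "elem_fun False f" obtains L where "L > 0" "\<And>x. \<bar>f x\<bar> \<le> L"
proof -
  have "\<exists>L. \<forall>x. \<bar>f x\<bar> \<le> L" using assms
  proof induction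
    case (elem_cos a c) show ?case by (intro exI[of _ 1]) (auto simp: abs_cos_le_one)
  next
    case (elem_add f g) then obtain L M where "\<forall>x. \<bar>f x\<bar> \<le> L" "\<forall>x. \<bar>g x\<bar> \<le> M" by blast
    then show ?case
      by (intro exI[of _ "L + M"]) (meson abs_triangle_ineq add_mono order_trans)
  next
    case (elem_mult f g) then obtain L M where "\<forall>x. \<bar>f x\<bar> \<le> L" "\<forall>x. \<bar>g x\<bar> \<le> M" by blast
    then have "\<bar>f x * g x\<bar> \<le> L * M" for x
      unfolding abs_mult using order_trans[OF abs_ge_zero] by (intro mult_mono) blast+
    then show ?case by blast
  qed auto
  then obtain L where "\<forall>x. \<bar>f x\<bar> \<le> L" by blast
  then show ?thesis by (intro that[of "\<bar>L\<bar> + 1"]) (auto intro: order_trans)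
qed

lemma elem_fun_affine:
  fixes L :: "'a::euclidean_space \<Rightarrow> 'b::euclidean_space"
  assumes "elem_fun B f" "linear L"
  shows "elem_fun B (\<lambda>x. f (L x + b))"
  using assms(1)
proof induction
  case (elem_lin a)
  have "(\<lambda>x. (L x + b) \<bullet> a) = (\<lambda>x. x \<bullet> adjoint L a + b \<bullet> a)"
    by (simp add: inner_add_left adjoint_works[OF assms(2)])
  with elem_lin show ?case by (auto intro: elem_fun.intros)
next
  case (elem_cos a c)
  have "(\<lambda>x. cos ((L x + b) \<bullet> a + c)) = (\<lambda>x. cos (x \<bullet> adjoint L a + (b \<bullet> a + c)))"
    by (simp add: inner_add_left adjoint_works[OF assms(2)] add.assoc)
  then show ?case by (auto intro: elem_fun.elem_cos)
qed (auto intro: elem_fun.intros)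

lemma elem_fun_prod:
  "finite A \<Longrightarrow> (\<And>i. i \<in> A \<Longrightarrow> elem_fun B (f i)) \<Longrightarrow> elem_fun B (\<lambda>x. \<Prod>i\<in>A. f i x)"
  by (induction rule: finite_induct) (auto intro: elem_fun.intros)

lemma elem_fun_power: "elem_fun B f \<Longrightarrow> elem_fun B (\<lambda>x. f x ^ n)"
  by (induction n) (auto intro: elem_fun.intros)

section \<open>Trigonometric polynomials on the torus and the test functions built from them\<close>

definition periodic :: "(real^'d \<Rightarrow> 'b) \<Rightarrow> bool" where
  "periodic f \<longleftrightarrow> (\<forall>x i. f (x + axis i 1) = f x)"

definition pdx :: "(real^'d \<Rightarrow> real) \<Rightarrow> 'd \<Rightarrow> real^'d \<Rightarrow> real" where
  "pdx K i z = frechet_derivative K (at z) (axis i 1)"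

text \<open>The frequencies in \<open>elem_fun\<close> are arbitrary, so periodicity is a separate
  condition. The flag \<open>False\<close> excludes linear functions, which makes kernels and all
  their partial derivatives bounded.\<close>

definition torus_fun :: "(real^'d \<Rightarrow> real) \<Rightarrow> bool" where
  "torus_fun K \<longleftrightarrow> elem_fun False K \<and> periodic K"

lemma torus_funD: "torus_fun K \<Longrightarrow> elem_fun B K" "torus_fun K \<Longrightarrow> K (x + axis i 1) = K x"
  by (auto simp: torus_fun_def periodic_def elem_fun_mono)

lemma torus_fun_borel [measurable]: "torus_fun K \<Longrightarrow> K \<in> borel_measurable borel"
  using torus_funD(1) elem_fun_borel by blast

lemma pdx_has_derivative:
  assumes "torus_fun K"
  shows "((\<lambda>s. K (x + s *\<^sub>R axis i 1)) has_real_derivative pdx K i (x + s *\<^sub>R axis i 1)) (at s)"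
proof -
  have K: "(K has_derivative frechet_derivative K (at y)) (at y)" for y
    using elem_fun_frechet(1) torus_funD(1)[OF assms] by blast
  have "((\<lambda>s. x + s *\<^sub>R axis i 1) has_derivative (\<lambda>h. h *\<^sub>R (axis i 1 :: real^'a))) (at s)"
    by (auto intro!: derivative_eq_intros)
  from has_derivative_compose[OF this K]
  have "((\<lambda>s. K (x + s *\<^sub>R axis i 1)) has_derivative
     (\<lambda>h. frechet_derivative K (at (x + s *\<^sub>R axis i 1)) (h *\<^sub>R axis i 1))) (at s)" .
  moreover have "linear (frechet_derivative K (at y))" for y
    using K has_derivative_linear by blast
  ultimately show ?thesis
    unfolding has_field_derivative_def pdx_def
    by (simp add: linear_cmul[where ?'b=real] mult_commute_abs)
qed

lemma torus_fun_pdx: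
  assumes "torus_fun K" shows "torus_fun (pdx K i)"
proof -
  have "pdx K i (x + axis j 1) = pdx K i x" for x j
  proof -
    have "((\<lambda>s. K (x + axis j 1 + s *\<^sub>R axis i 1)) has_real_derivative pdx K i (x + axis j 1)) (at 0)"
      using pdx_has_derivative[OF assms, of "x + axis j 1" i 0] by simp
    moreover have "K (x + axis j 1 + s *\<^sub>R axis i 1) = K (x + s *\<^sub>R axis i 1)" for s
      using torus_funD(2)[OF assms, of "x + s *\<^sub>R axis i 1" j] by (simp add: algebra_simps)
    ultimately have "((\<lambda>s. K (x + s *\<^sub>R axis i 1)) has_real_derivative pdx K i (x + axis j 1)) (at 0)"
      by simp
    with pdx_has_derivative[OF assms, of x i 0] show ?thesis
      by (auto dest: DERIV_unique)
  qed
  then show ?thesis using elem_fun_frechet(2) torus_funD(1)[OF assms]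
    unfolding torus_fun_def periodic_def pdx_def by blast
qed

text \<open>The point \<open>x\<close> is a parameter: integrating against this function evaluates
  the convolution with \<open>K\<close> at \<open>x\<close>, weighted by the \<open>n\<close>-th
  power of time.\<close>

definition test_fun :: "nat \<Rightarrow> (real^'d \<Rightarrow> real) \<Rightarrow> real^'d \<Rightarrow> real \<times> (real^'d) \<Rightarrow> real" where
  "test_fun n K x p = fst p ^ n * K (x - snd p)"

lemma test_fun_elem: "torus_fun K \<Longrightarrow> elem_fun True (test_fun n K x)"
proof -
  assume K: "torus_fun K"
  have 1: "elem_fun True (\<lambda>p::real \<times> (real^'a). fst p ^ n)"
    using elem_fun_power[OF elem_lin[of True "(1,0)::real \<times> (real^'a)"]] by (simp add: inner_prod_def)
  have "linear (\<lambda>p::real \<times> (real^'a). - snd p)"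
    by (intro linear_compose_neg linear_snd)
  from elem_fun_affine[OF torus_funD(1)[OF K, of True] this, of x]
  have "elem_fun True (\<lambda>p::real \<times> (real^'a). K (x - snd p))" by simp
  with 1 show ?thesis unfolding test_fun_def[abs_def] by (rule elem_mult)
qed

lemma test_fun_smooth: "torus_fun K \<Longrightarrow> smooth_fun (test_fun n K x)"
  by (rule elem_fun_smooth[OF test_fun_elem])

lemma test_fun_periodic: assumes "torus_fun K" shows "space_periodic (test_fun n K x)"
proof -
  have "K (x - (y + axis i 1)) = K (x - y)" for y i
    using torus_funD(2)[OF assms, of "x - (y + axis i 1)" i] by simp
  then show ?thesis
    unfolding space_periodic_def test_fun_def by (auto simp: Basis_vec_def)
qed

lemma test_fun_has_derivative:
  assumes "torus_fun K"
  shows "(test_fun n K x has_derivative (\<lambda>v. of_nat n * fst p ^ (n - 1) * fst v * K (x - snd p)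
     - fst p ^ n * frechet_derivative K (at (x - snd p)) (snd v))) (at p)"
proof -
  have K: "(K has_derivative frechet_derivative K (at y)) (at y)" for y
    using elem_fun_frechet(1) torus_funD(1)[OF assms] by blast
  have lin: "frechet_derivative K (at y) (- v) = - frechet_derivative K (at y) v" for y v
    using has_derivative_linear[OF K] by (simp add: linear_neg)
  have "((\<lambda>p. x - snd p) has_derivative (\<lambda>v. - snd v)) (at p)"
    by (auto intro!: derivative_eq_intros)
  from has_derivative_compose[OF this K]
  have 1: "((\<lambda>p. K (x - snd p)) has_derivative (\<lambda>v. - frechet_derivative K (at (x - snd p)) (snd v))) (at p)"
    by (simp add: lin)
  show ?thesis unfolding test_fun_def[abs_def]
    by (rule has_derivative_eq_rhs, rule has_derivative_mult[OF _ 1])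
      (auto intro!: derivative_eq_intros simp: algebra_simps)
qed

lemma test_fun_derivs:
  assumes "torus_fun K"
  shows "dt (test_fun n K x) p = of_nat n * fst p ^ (n - 1) * K (x - snd p)"
    and "pd (test_fun n K x) (0, axis i 1) p = - (fst p ^ n * pdx K i (x - snd p))"
    and "grad_x (test_fun n K x) p = (\<chi> i. - (fst p ^ n * pdx K i (x - snd p)))"
proof -
  have *: "frechet_derivative (test_fun n K x) (at p) = (\<lambda>v. of_nat n * fst p ^ (n - 1) * fst v * K (x - snd p)
     - fst p ^ n * frechet_derivative K (at (x - snd p)) (snd v))"
    by (rule frechet_derivative_at[symmetric, OF test_fun_has_derivative[OF assms]])
  have "linear (frechet_derivative K (at y))" for y
    using elem_fun_frechet(1) torus_funD(1)[OF assms] has_derivative_linear by blast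
  then show "dt (test_fun n K x) p = of_nat n * fst p ^ (n - 1) * K (x - snd p)"
    unfolding dt_def pd_def * by (simp add: linear_0)
  show "pd (test_fun n K x) (0, axis i 1) p = - (fst p ^ n * pdx K i (x - snd p))" for i
    unfolding pd_def * pdx_def by simp
  then show "grad_x (test_fun n K x) p = (\<chi> i. - (fst p ^ n * pdx K i (x - snd p)))"
    unfolding grad_x_def by simp
qed

section \<open>Periodic integrals over the cube\<close>

text \<open>The torus integral as a probability measure on the whole space: bounded measurable
  functions are integrable, and products with the time measure fall under Fubini.\<close>

definition cubeM :: "(real^'d) measure" where
  "cubeM = density lborel (indicator cube)"

lemma sets_cubeM [measurable_cong, simp]: "sets cubeM = sets borel"
  by (simp add: cubeM_def)

lemma space_cubeM [simp]: "space cubeM = UNIV"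
  by (simp add: cubeM_def)

lemma cube_borel [measurable]: "cube \<in> sets borel"
  by (simp add: cube_def)

lemma One_vec_nth [simp]: "(One :: real^'d) $ i = 1"
proof -
  have "(One :: real^'d) \<bullet> axis i 1 = 1"
    by (simp add: inner_sum_left_Basis)
  then show ?thesis by (simp add: inner_axis)
qed

interpretation cubeM: prob_space "cubeM :: (real^'d) measure"
proof
  have "emeasure (cubeM :: (real^'d) measure) (space cubeM) = emeasure lborel (cube :: (real^'d) set)"
    by (simp add: cubeM_def emeasure_density)
  also have "\<dots> = 1"
    by (simp add: cube_def emeasure_lborel_cbox_eq inner_sum_left_Basis)
  finally show "emeasure (cubeM :: (real^'d) measure) (space cubeM) = 1" .
qed

lemma AE_cubeM: "(AE x in cubeM. P x) \<longleftrightarrow> (AE x in lborel. x \<in> cube \<longrightarrow> P x)"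
  unfolding cubeM_def by (subst AE_density) (auto simp: indicator_def split: if_splits)

lemma integral_cubeM: 
  fixes f :: "real^'d \<Rightarrow> 'b::{banach, second_countable_topology}"
  assumes [measurable]: "f \<in> borel_measurable borel"
  shows "integral\<^sup>L cubeM f = (LINT x:cube|lborel. f x)"
  unfolding cubeM_def set_lebesgue_integral_def
  by (subst integral_density[of f lborel "indicator cube", symmetric])
     (auto simp: ennreal_indicator)

lemma AE_cubeM_box: "AE x in cubeM. x \<in> box 0 One"
proof -
  have "negligible (cbox 0 One - box (0::real^'d) One)"
    by (rule negligible_frontier_interval)
  then have "cbox 0 One - box (0::real^'d) One \<in> null_sets lborel"
    by (simp add: negligible_iff_null_sets null_sets_completion_iff)
  then have "AE x in lborel. x \<notin> cbox 0 One - box (0::real^'d) One"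
    by (rule AE_not_in)
  then show ?thesis unfolding AE_cubeM cube_def by (rule AE_mp) auto
qed

lemma continuous_bounded_integrable_cubeM:
  fixes f :: "real^'d \<Rightarrow> real"
  assumes "f \<in> borel_measurable borel" "\<And>x. \<bar>f x\<bar> \<le> B"
  shows "integrable cubeM f"
  using assms by (intro cubeM.integrable_const_bound[of _ B]) auto

text \<open>Half-open, hence an exact fundamental domain: translates by distinct lattice vectors are
  disjoint, so cutting and moving pieces involves no overlaps. It differs from \<open>cube\<close>
  by a null set.\<close>

definition hcube :: "(real^'d) set" where
  "hcube = {x. \<forall>j. 0 \<le> x $ j \<and> x $ j < 1}"

lemma hcube_borel [measurable]: "hcube \<in> sets borel"
  unfolding hcube_def by measurable

lemma AE_hcube: "AE x in lborel. (x \<in> cube \<longleftrightarrow> x \<in> hcube)"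
proof -
  have "AE x in lborel. x \<in> cube \<longrightarrow> x \<in> box 0 (One::real^'d)"
    using AE_cubeM_box unfolding AE_cubeM .
  moreover have "box 0 One \<subseteq> (hcube :: (real^'d) set)" "hcube \<subseteq> (cube :: (real^'d) set)"
    by (simp_all add: subset_iff hcube_def mem_box_cart cube_def less_imp_le del: sum_component)
  ultimately show ?thesis by (auto elim!: eventually_mono)
qed

lemma integral_cubeM_hcube: 
  fixes f :: "real^'d \<Rightarrow> real"
  assumes [measurable]: "f \<in> borel_measurable borel"
  shows "integral\<^sup>L cubeM f = (\<integral>x. indicator hcube x * f x \<partial>lborel)"
proof -
  have "integral\<^sup>L cubeM f = (\<integral>x. indicator cube x * f x \<partial>lborel)"
    by (simp add: integral_cubeM set_lebesgue_integral_def)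
  also have "\<dots> = (\<integral>x. indicator hcube x * f x \<partial>lborel)"
    by (rule integral_cong_AE) (use AE_hcube in \<open>auto elim!: eventually_mono simp: indicator_def\<close>)
  finally show ?thesis .
qed

lemma integral_lborel_translate:
  fixes f :: "real^'d \<Rightarrow> real"
  assumes "f \<in> borel_measurable borel"
  shows "(\<integral>x. f (x + c) \<partial>lborel) = (\<integral>x. f x \<partial>lborel)"
proof -
  have "(\<integral>x. f x \<partial>lborel) = (\<integral>x. f x \<partial>distr lborel borel ((+) c))"
    by (simp only: lborel_distr_plus)
  also have "\<dots> = (\<integral>x. f (c + x) \<partial>lborel)"
    using assms by (subst integral_distr) auto
  finally show ?thesis by (simp add: add.commute)
qed

lemma integrable_lborel_hcube_sub:
  fixes f :: "real^'d \<Rightarrow> real"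
  assumes [measurable]: "f \<in> borel_measurable borel" "A \<in> sets borel"
    and "\<And>x. \<bar>f x\<bar> \<le> B" and "bounded A"
  shows "integrable lborel (\<lambda>x. indicator A x * f x)"
proof (rule Bochner_Integration.integrable_bound)
  show "integrable lborel (\<lambda>x. indicator A x * B)"
    using emeasure_bounded_finite[OF assms(4)] by simp
  show "AE x in lborel. norm (indicator A x * f x) \<le> norm (indicator A x * B)"
    using assms(3) by (auto simp: indicator_def abs_mult intro: order_trans[OF _ abs_ge_self])
qed auto

text \<open>Split the translated cube along the hyperplane where the shifted coordinate leaves [0,1)
  and move the protruding slab back by one period.\<close>
lemma integral_cubeM_shift_unit:
  fixes H :: "real^'d \<Rightarrow> real"
  assumes H [measurable]: "H \<in> borel_measurable borel" and bd: "\<And>x. \<bar>H x\<bar> \<le> B" and per: "periodic H"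
    and s: "0 \<le> s" "s < 1"
  shows "(\<integral>x. H (x + s *\<^sub>R axis i 1) \<partial>cubeM) = (\<integral>x. H x \<partial>cubeM)"
proof -
  define e where "e = (axis i 1 :: real^'d)"
  have e [simp]: "e $ j = (if j = i then 1 else 0)" for j by (simp add: e_def axis_def)
  define A where "A = {x::real^'d. x \<in> hcube \<and> s \<le> x $ i}"
  define A' where "A' = {x::real^'d. x \<in> hcube \<and> x $ i < s}"
  have [measurable]: "A \<in> sets borel" "A' \<in> sets borel"
    unfolding A_def A'_def by measurable
  have bh: "bounded (hcube :: (real^'d) set)"
    by (rule bounded_subset[OF bounded_cbox[of 0 One]])
      (simp add: subset_iff hcube_def mem_box_cart less_imp_le del: sum_component)
  have bA: "bounded A" "bounded A'"
    by (auto intro: bounded_subset[OF bh] simp: A_def A'_def)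
  have bB: "bounded ((\<lambda>x. x + e) ` A')"
    using bA(2) bounded_translation[of A' e] by (simp add: add.commute)
  have ind: "indicator hcube (x - s *\<^sub>R e) = (indicator A x + indicator A' (x - e) :: real)" for x :: "real^'d"
  proof -
    have sub: "(x - s *\<^sub>R e) \<in> hcube \<longleftrightarrow> (\<forall>j. j \<noteq> i \<longrightarrow> 0 \<le> x $ j \<and> x $ j < 1) \<and> s \<le> x $ i \<and> x $ i < 1 + s"
      by (auto simp: hcube_def split: if_splits)
    have a: "x \<in> A \<longleftrightarrow> (\<forall>j. j \<noteq> i \<longrightarrow> 0 \<le> x $ j \<and> x $ j < 1) \<and> s \<le> x $ i \<and> x $ i < 1"
      using s by (auto simp: hcube_def A_def intro: order_trans)
    have b: "x - e \<in> A' \<longleftrightarrow> (\<forall>j. j \<noteq> i \<longrightarrow> 0 \<le> x $ j \<and> x $ j < 1) \<and> 1 \<le> x $ i \<and> x $ i < 1 + s"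
      using s by (auto simp: hcube_def A'_def) 
    show ?thesis using s by (auto simp: indicator_def sub a b)
  qed
  have "(\<integral>x. H (x + s *\<^sub>R e) \<partial>cubeM) = (\<integral>x. indicator hcube x * H (x + s *\<^sub>R e) \<partial>lborel)"
    by (rule integral_cubeM_hcube) measurable
  also have "\<dots> = (\<integral>x. indicator hcube (x - s *\<^sub>R e) * H x \<partial>lborel)"
    using integral_lborel_translate[of "\<lambda>x. indicator hcube (x - s *\<^sub>R e) * H x" "s *\<^sub>R e"] by simp
  also have "\<dots> = (\<integral>x. indicator A x * H x + indicator A' (x - e) * H x \<partial>lborel)"
    by (simp add: ind distrib_right)
  also have "\<dots> = (\<integral>x. indicator A x * H x \<partial>lborel) + (\<integral>x. indicator A' (x - e) * H x \<partial>lborel)"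
  proof (rule Bochner_Integration.integral_add)
    show "integrable lborel (\<lambda>x. indicator A x * H x)"
      by (rule integrable_lborel_hcube_sub[OF _ _ bd bA(1)]) auto
    have "(\<lambda>x. x - e) -` A' \<in> sets borel"
      using measurable_sets[of "\<lambda>x. x - e" borel borel A'] by simp
    moreover have eq: "(\<lambda>x. x + e) ` A' = (\<lambda>x. x - e) -` A'"
      by (auto simp: image_iff) (metis diff_add_cancel)
    ultimately have "integrable lborel (\<lambda>x. indicator ((\<lambda>x. x - e) -` A') x * H x)"
      using bB by (intro integrable_lborel_hcube_sub[OF _ _ bd]) auto
    then show "integrable lborel (\<lambda>x. indicator A' (x - e) * H x)"
      by (simp add: indicator_vimage)
  qed
  also have "(\<integral>x. indicator A' (x - e) * H x \<partial>lborel) = (\<integral>x. indicator A' x * H x \<partial>lborel)"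
    using integral_lborel_translate[of "\<lambda>x. indicator A' (x - e) * H x" e] per
    by (simp add: periodic_def e_def)
  also have "(\<integral>x. indicator A x * H x \<partial>lborel) + \<dots> = (\<integral>x. indicator A x * H x + indicator A' x * H x \<partial>lborel)"
    by (rule Bochner_Integration.integral_add[symmetric])
      (rule integrable_lborel_hcube_sub[OF _ _ bd]; use bA in auto)+
  also have "\<dots> = (\<integral>x. indicator hcube x * H x \<partial>lborel)"
    by (rule Bochner_Integration.integral_cong) (auto simp: A_def A'_def indicator_def)
  also have "\<dots> = (\<integral>x. H x \<partial>cubeM)"
    by (rule integral_cubeM_hcube[symmetric]) measurable
  finally show ?thesis by (simp add: e_def)
qed

lemma periodic_int:
  assumes "periodic H" shows "H (x + of_int k *\<^sub>R axis i 1) = H x"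
proof -
  have nat: "H (y + of_nat n *\<^sub>R axis i 1) = H y" for n y
  proof (induction n)
    case (Suc n)
    have "H (y + of_nat (Suc n) *\<^sub>R axis i 1) = H ((y + of_nat n *\<^sub>R axis i 1) + axis i 1)"
      by (simp add: algebra_simps)
    also have "\<dots> = H (y + of_nat n *\<^sub>R axis i 1)" using assms unfolding periodic_def by blast
    finally show ?case using Suc by simp
  qed simp
  show ?thesis
  proof (cases "k \<ge> 0")
    case True
    then show ?thesis using nat[of x "nat k"] by simp
  next
    case False
    then show ?thesis using nat[of "x + of_int k *\<^sub>R axis i 1" "nat (-k)"] 
      by (simp add: algebra_simps flip: scaleR_left_distrib)
  qed
qed

lemma integral_cubeM_shift_axis:
  fixes H :: "real^'d \<Rightarrow> real"
  assumes "H \<in> borel_measurable borel" and "\<And>x. \<bar>H x\<bar> \<le> B" and "periodic H"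
  shows "(\<integral>x. H (x + s *\<^sub>R axis i 1) \<partial>cubeM) = (\<integral>x. H x \<partial>cubeM)"
proof -
  have "H (x + s *\<^sub>R axis i 1) = H (x + frac s *\<^sub>R axis i 1)" for x
    using periodic_int[OF assms(3), of "x + frac s *\<^sub>R axis i 1" "\<lfloor>s\<rfloor>" i]
    by (simp add: frac_def algebra_simps)
  then show ?thesis
    using integral_cubeM_shift_unit[OF assms, of "frac s" i] by (simp add: frac_lt_1)
qed

lemma integral_cubeM_shift:
  fixes H :: "real^'d \<Rightarrow> real"
  assumes "H \<in> borel_measurable borel" and "\<And>x. \<bar>H x\<bar> \<le> B" and "periodic H"
  shows "(\<integral>x. H (x + v) \<partial>cubeM) = (\<integral>x. H x \<partial>cubeM)"
proof -
  have "(\<integral>x. H (x + (\<Sum>i\<in>A. v $ i *\<^sub>R axis i 1)) \<partial>cubeM) = (\<integral>x. H x \<partial>cubeM)" if "finite A" for A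
    using that
  proof induction
    case (insert i A)
    let ?w = "\<Sum>i\<in>A. v $ i *\<^sub>R axis i 1 :: real^'d"
    have "(\<integral>x. H (x + (\<Sum>i\<in>insert i A. v $ i *\<^sub>R axis i 1)) \<partial>cubeM)
      = (\<integral>x. (\<lambda>y. H (y + ?w)) (x + v $ i *\<^sub>R axis i 1) \<partial>cubeM)"
      using insert by (simp add: add.assoc)
    also have "\<dots> = (\<integral>x. H (x + ?w) \<partial>cubeM)"
    proof (rule integral_cubeM_shift_axis[where B=B])
      have "H (x + axis j 1 + ?w) = H (x + ?w)" for x j
      proof -
        have "H (x + axis j 1 + ?w) = H ((x + ?w) + axis j 1)" by (simp add: algebra_simps)
        also have "\<dots> = H (x + ?w)" using assms(3) unfolding periodic_def by blast
        finally show ?thesis .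
      qed
      then show "periodic (\<lambda>y. H (y + ?w))" by (simp add: periodic_def)
    qed (use assms in auto)
    finally show ?case using insert by simp
  qed simp
  from this[of UNIV] show ?thesis
    by (simp add: basis_expansion[of v, unfolded scalar_mult_eq_scaleR])
qed

text \<open>Translation invariance makes the integral of every difference quotient vanish. The mean
  value theorem bounds the quotients by \<open>M\<close>, so dominated convergence carries this over
  to the derivative.\<close>

lemma integral_cubeM_deriv_0:
  fixes H :: "real^'d \<Rightarrow> real"
  assumes [measurable]: "H \<in> borel_measurable borel" "H' \<in> borel_measurable borel"
    and bd: "\<And>x. \<bar>H x\<bar> \<le> B" "\<And>x. \<bar>H' x\<bar> \<le> M" and per: "periodic H"
    and der: "\<And>x s. ((\<lambda>s. H (x + s *\<^sub>R axis i 1)) has_real_derivative H' (x + s *\<^sub>R axis i 1)) (at s)"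
  shows "(\<integral>x. H' x \<partial>cubeM) = 0"
proof -
  define q where "q n x = (H (x + (1 / Suc n) *\<^sub>R axis i 1) - H x) * Suc n" for n :: nat and x
  have q0: "(\<integral>x. q n x \<partial>cubeM) = 0" for n
  proof -
    have "integrable cubeM (\<lambda>x. H (x + (1 / Suc n) *\<^sub>R axis i 1))" "integrable cubeM H"
      using bd by (auto intro!: continuous_bounded_integrable_cubeM[where B=B])
    then show ?thesis
      unfolding q_def using integral_cubeM_shift_axis[OF assms(1) bd(1) per] by simp
  qed
  have "(\<lambda>n. \<integral>x. q n x \<partial>cubeM) \<longlonglongrightarrow> (\<integral>x. H' x \<partial>cubeM)"
  proof (rule integral_dominated_convergence[where w="\<lambda>_. M"])
    show "AE x in cubeM. (\<lambda>n. q n x) \<longlonglongrightarrow> H' x"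
    proof (rule AE_I2)
      fix x :: "real^'d"
      have "((\<lambda>s. (H (x + s *\<^sub>R axis i 1) - H x) / s) \<longlongrightarrow> H' x) (at 0)"
        using der[of x 0] by (simp add: DERIV_def)
      moreover have "filterlim (\<lambda>n. 1 / real (Suc n)) (at 0) sequentially"
        using LIMSEQ_inverse_real_of_nat by (auto simp: filterlim_at divide_inverse)
      ultimately have "(\<lambda>n. (H (x + (1 / real (Suc n)) *\<^sub>R axis i 1) - H x) / (1 / real (Suc n))) \<longlonglongrightarrow> H' x"
        by (rule filterlim_compose)
      then show "(\<lambda>n. q n x) \<longlonglongrightarrow> H' x" by (simp add: q_def)
    qed
    show "AE x in cubeM. norm (q n x) \<le> M" for n
    proof (rule AE_I2)
      fix x :: "real^'d"
      obtain z where "H (x + (1 / Suc n) *\<^sub>R axis i 1) - H (x + 0 *\<^sub>R axis i 1)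
         = (1 / Suc n - 0) * H' (x + z *\<^sub>R axis i 1)"
        using MVT2[of 0 "1 / Suc n" "\<lambda>s. H (x + s *\<^sub>R axis i 1)" "\<lambda>s. H' (x + s *\<^sub>R axis i 1)"] der by auto
      then show "norm (q n x) \<le> M" using bd(2) by (simp add: q_def)
    qed
  qed (auto simp: q_def)
  then show ?thesis using q0 LIMSEQ_unique[of "\<lambda>_. 0::real"] by simp
qed

section \<open>Mollification\<close>

lemma measure_cubeM_UNIV [simp]: "measure cubeM UNIV = 1"
  using cubeM.prob_space by simp

lemma torus_fun_const: "torus_fun (\<lambda>_. c)"
  by (auto simp: torus_fun_def periodic_def intro: elem_const)

lemma torus_fun_mult: "torus_fun f \<Longrightarrow> torus_fun g \<Longrightarrow> torus_fun (\<lambda>x. f x * g x)"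
  by (auto simp: torus_fun_def periodic_def intro: elem_mult)

lemma torus_fun_bounded:
  assumes "torus_fun K" obtains L where "L > 0" "\<And>x. \<bar>K x\<bar> \<le> L"
  using elem_fun_bounded[of K] torus_funD(1)[OF assms] by blast

section \<open>An approximate identity of trigonometric polynomials\<close>

definition cos_prod :: "real^'d \<Rightarrow> real" where
  "cos_prod z = (\<Prod>i\<in>UNIV. (1 + cos (2 * pi * z $ i)) / 2)"

lemma cos_prod_torus: "torus_fun (\<lambda>z::real^'d. cos_prod z ^ N)"
proof -
  have "elem_fun False (\<lambda>z::real^'d. (1 + cos (z \<bullet> axis i (2*pi) + 0)) * (1/2))" for i
    by (intro elem_fun.intros)
  then have "elem_fun False (\<lambda>z::real^'d. cos_prod z)"
    unfolding cos_prod_def[abs_def] 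
    by (intro elem_fun_prod) (auto simp: inner_axis mult.commute)
  moreover have "periodic (\<lambda>z::real^'d. cos_prod z)"
    unfolding periodic_def cos_prod_def 
    by (auto simp: axis_def distrib_left intro!: prod.cong)
  ultimately show ?thesis
    unfolding torus_fun_def periodic_def by (auto intro: elem_fun_power)
qed

lemma cos_prod_cont: "continuous_on S cos_prod"
  unfolding cos_prod_def[abs_def] by (intro continuous_intros) auto

lemma cos_prod_borel [measurable]: "cos_prod \<in> borel_measurable borel"
  by (intro borel_measurable_continuous_onI cos_prod_cont)

lemma cos_prod_factor: "0 \<le> (1 + cos t) / (2::real)" "(1 + cos t) / (2::real) \<le> 1"
  using cos_ge_minus_one[of t] cos_le_one[of t] by (simp_all, linarith)

lemma cos_prod_nonneg: "0 \<le> cos_prod z"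
  unfolding cos_prod_def by (intro prod_nonneg) (simp only: cos_prod_factor)

lemma cos_prod_le_1: "cos_prod z \<le> 1"
  unfolding cos_prod_def by (intro prod_le_1) (simp only: cos_prod_factor)

lemma cos_prod_0: "cos_prod 0 = 1"
  by (simp add: cos_prod_def)

lemma cos_prod_minus: "cos_prod (- z) = cos_prod z"
  by (simp add: cos_prod_def)

text \<open>\<open>cos_prod\<close> equals 1 exactly at lattice points. With \<open>x\<close> in the
  open cube and \<open>y\<close> in the closed one, each coordinate of \<open>x - y\<close> lies
  strictly between -1 and 1, so 0 is the only lattice point available.\<close>

lemma cos_prod_less_1:
  fixes x :: "real^'d"
  assumes "x \<in> box 0 One" "y \<in> cube" "y \<noteq> x"
  shows "cos_prod (x - y) < 1"
proof -
  obtain i where i: "y $ i \<noteq> x $ i" using assms(3) by (auto simp: vec_eq_iff)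
  have xy: "0 < x $ i" "x $ i < 1" "0 \<le> y $ i" "y $ i \<le> 1"
    using assms(1,2) by (simp_all add: mem_box_cart cube_def del: sum_component)
  have c: "cos (2 * pi * (x $ i - y $ i)) < 1"
  proof (rule ccontr)
    assume "\<not> ?thesis"
    then have "cos (2 * pi * (x $ i - y $ i)) = 1" using cos_le_one by (simp add: order_antisym)
    then obtain n :: int where "2 * pi * (x $ i - y $ i) = of_int n * 2 * pi"
      using cos_one_2pi_int by blast
    then have "x $ i - y $ i = of_int n" by simp
    moreover from this have "n = 0" using xy by linarith
    ultimately show False using i by simp
  qed
  have "cos_prod (x - y) = (1 + cos (2 * pi * (x $ i - y $ i))) / 2 *
      (\<Prod>j\<in>UNIV - {i}. (1 + cos (2 * pi * (x - y) $ j)) / 2)"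
    unfolding cos_prod_def by (subst prod.remove[of UNIV i]) auto
  also have "\<dots> \<le> (1 + cos (2 * pi * (x $ i - y $ i))) / 2 * 1"
    by (intro mult_left_mono prod_le_1) (simp_all only: cos_prod_factor)
  also have "\<dots> < 1" using c by simp
  finally show ?thesis .
qed

text \<open>As \<open>(1 + cos t) / 2\<close> is the squared cosine of the half angle, this is a
  tensor product of one-dimensional de la Vallee Poussin kernels.\<close>

definition cos_kernel :: "nat \<Rightarrow> real^'d \<Rightarrow> real" where
  "cos_kernel N z = cos_prod z ^ N / (\<integral>y. cos_prod y ^ N \<partial>(cubeM :: (real^'d) measure))"

lemma cos_kernel_torus: "torus_fun (cos_kernel N)"
  using torus_fun_mult[OF cos_prod_torus torus_fun_const, of N "1 / (\<integral>y. cos_prod y ^ N \<partial>(cubeM :: (real^'d) measure))"]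
  by (simp add: cos_kernel_def[abs_def])

lemma torus_fun_shift_integral:
  fixes K :: "real^'d \<Rightarrow> real"
  assumes "torus_fun K"
  shows "(\<integral>y. K (y - x) \<partial>cubeM) = (\<integral>y. K y \<partial>cubeM)"
proof -
  obtain L where "\<And>x. \<bar>K x\<bar> \<le> L" using torus_fun_bounded[OF assms] by blast
  then show ?thesis
    using integral_cubeM_shift[of K L "- x"] assms by (simp add: torus_fun_def elem_fun_borel)
qed

lemma cos_prod_integral_shift: "(\<integral>y. cos_prod ((x :: real^'d) - y) ^ N \<partial>cubeM) = (\<integral>y. cos_prod y ^ N \<partial>(cubeM :: (real^'d) measure))"
  using torus_fun_shift_integral[OF cos_prod_torus, of x N] cos_prod_minus[of "x - y" for y] by simp

lemma cos_prod_power_integrable: "integrable cubeM (\<lambda>y. cos_prod (x - y) ^ N)"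
  by (rule continuous_bounded_integrable_cubeM[where B=1])
    (auto simp: power_le_one cos_prod_nonneg cos_prod_le_1)

lemma cubeM_ball_pos:
  fixes x :: "real^'d"
  assumes "x \<in> box 0 One" "e > 0" shows "measure cubeM (ball x e) > 0"
proof -
  define U where "U = ball x e \<inter> box 0 (One :: real^'d)"
  have "open U" "x \<in> U" using assms by (auto simp: U_def)
  then obtain d where d: "d > 0" "ball x d \<subseteq> U" by (meson open_contains_ball)
  have "0 < measure lborel (ball x d)"
    using content_ball_pos[OF d(1), of x] by (simp add: measure_completion)
  also have "measure lborel (ball x d) = measure lborel (cube \<inter> ball x d)"
    using d(2) box_subset_cbox[of 0 "One::real^'d"] by (auto simp: U_def cube_def intro!: arg_cong[where f="measure lborel"])
  also have "\<dots> = measure cubeM (ball x d)"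
  proof -
    have "emeasure cubeM (ball x d) = emeasure lborel (cube \<inter> ball x d)"
      unfolding cubeM_def by (subst emeasure_density) (auto simp: indicator_inter_arith[symmetric] nn_integral_indicator)
    then show ?thesis by (simp add: measure_def)
  qed
  also have "\<dots> \<le> measure cubeM (ball x e)"
    using d(2) by (intro cubeM.finite_measure_mono) (auto simp: U_def)
  finally show ?thesis .
qed

text \<open>Off the ball, compactness keeps \<open>cos_prod\<close> below some \<open>q < 1\<close>,
  while on a suitable ball around \<open>x\<close> it stays above some \<open>p > q\<close>. The
  normalizing integral is thus at least \<open>p ^ N\<close> times the measure of the latter ball,
  so the kernel off the given ball decays like \<open>(q / p) ^ N\<close>.\<close>

lemma cos_kernel_concentrate_aux:
  fixes x :: "real^'d"
  assumes x: "x \<in> box 0 One" and "e > 0"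
  obtains c r :: real where "0 < c" "0 \<le> r" "r < 1"
     "\<And>N. 0 < (\<integral>y. cos_prod y ^ N \<partial>(cubeM :: (real^'d) measure))"
     "\<And>N y. y \<in> cube \<Longrightarrow> y \<notin> ball x e \<Longrightarrow> cos_kernel N (x - y) \<le> c * r ^ N"
proof -
  define S where "S = cube - ball x e"
  have "compact S" unfolding S_def cube_def by (intro compact_diff) auto
  have c: "continuous_on S (\<lambda>y. cos_prod (x - y))" for S
    by (rule continuous_on_compose2[OF cos_prod_cont[of UNIV]]) (auto intro: continuous_intros)
  obtain q where q: "0 \<le> q" "q < 1" "\<And>y. y \<in> S \<Longrightarrow> cos_prod (x - y) \<le> q"
  proof (cases "S = {}")
    case True then show ?thesis using that[of 0] by auto
  next
    case False
    then obtain y0 where "y0 \<in> S" "\<And>y. y \<in> S \<Longrightarrow> cos_prod (x - y) \<le> cos_prod (x - y0)"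
      using continuous_attains_sup[OF \<open>compact S\<close> False c] by blast
    moreover have "y0 \<noteq> x" using \<open>y0 \<in> S\<close> \<open>e > 0\<close> by (auto simp: S_def)
    ultimately show ?thesis using that[of "cos_prod (x - y0)"] cos_prod_less_1[of x y0] cos_prod_nonneg x
      by (auto simp: S_def)
  qed
  \<comment> \<open>A level strictly between \<open>q\<close> and the maximum 1 attained at the
    centre.\<close>
  define p where "p = (1 + q) / 2"
  have p: "q < p" "p < 1" "0 < p" using q by (auto simp: p_def)
  have "isCont (\<lambda>y. cos_prod (x - y)) x" using c[of UNIV] by (simp add: continuous_on_eq_continuous_at)
  then obtain d where d: "d > 0" "\<And>y. dist y x < d \<Longrightarrow> dist (cos_prod (x - y)) (cos_prod (x - x)) < 1 - p"
    using p unfolding continuous_at_eps_delta by (metis diff_gt_0_iff_gt)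
  have lb: "p \<le> cos_prod (x - y)" if "y \<in> ball x d" for y
    using d(2)[of y] that by (simp add: dist_real_def dist_commute cos_prod_0 abs_diff_less_iff)
  define m where "m = measure cubeM (ball x d)"
  have m: "m > 0" unfolding m_def by (rule cubeM_ball_pos[OF x d(1)])
  have Z: "p ^ N * m \<le> (\<integral>y. cos_prod y ^ N \<partial>(cubeM :: (real^'d) measure))" for N
  proof -
    have "p ^ N * m = (\<integral>y. p ^ N * indicator (ball x d) y \<partial>cubeM)"
      by (simp add: m_def)
    also have "\<dots> \<le> (\<integral>y. cos_prod (x - y) ^ N \<partial>cubeM)"
    proof (rule integral_mono[OF _ cos_prod_power_integrable])
      show "integrable cubeM (\<lambda>y. p ^ N * indicator (ball x d) y)"
        by (rule continuous_bounded_integrable_cubeM[where B="p^N"]) (use p in \<open>auto simp: indicator_def\<close>)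
      show "p ^ N * indicator (ball x d) y \<le> cos_prod (x - y) ^ N" for y
        using lb[of y] p by (auto simp: indicator_def cos_prod_nonneg intro!: power_mono)
    qed
    finally show ?thesis by (simp add: cos_prod_integral_shift)
  qed
  show ?thesis
  proof (rule that[of "1 / m" "q / p"])
    show Zp: "0 < (\<integral>y. cos_prod y ^ N \<partial>(cubeM :: (real^'d) measure))" for N
      using Z[of N] m p by (meson less_le_trans mult_pos_pos zero_less_power)
    fix N y assume "y \<in> cube" "y \<notin> ball x e"
    then have "cos_prod (x - y) ^ N \<le> q ^ N" using q cos_prod_nonneg by (intro power_mono) (auto simp: S_def)
    then have "cos_kernel N (x - y) \<le> q ^ N / (p ^ N * m)"
      unfolding cos_kernel_def using Z[of N] m p q by (intro frac_le) auto
    then show "cos_kernel N (x - y) \<le> 1 / m * (q / p) ^ N" by (simp add: power_divide mult.commute)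
  qed (use m p q in auto)
qed

lemma box_One_nonempty: "(\<chi> i. (1/2::real)) \<in> box 0 (One :: real^'d)"
  by (simp add: mem_box_cart del: sum_component)

lemma cos_prod_integral_pos: "0 < (\<integral>y. cos_prod y ^ N \<partial>(cubeM :: (real^'d) measure))"
  using cos_kernel_concentrate_aux[OF box_One_nonempty zero_less_one] by metis

lemma cos_kernel_nonneg: "0 \<le> cos_kernel N z"
  by (simp add: cos_kernel_def cos_prod_nonneg less_imp_le[OF cos_prod_integral_pos])

lemma cos_kernel_borel [measurable]: "cos_kernel N \<in> borel_measurable borel"
  unfolding cos_kernel_def[abs_def] by measurable

lemma cos_kernel_integral:
  fixes x y :: "real^'a"
  shows "(\<integral>y. cos_kernel N (x - y) \<partial>cubeM) = 1" "(\<integral>x. cos_kernel N (x - y) \<partial>cubeM) = 1"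
proof -
  show "(\<integral>y. cos_kernel N (x - y) \<partial>cubeM) = 1"
    using cos_prod_integral_pos[of N, where ?'d='a] by (simp add: cos_kernel_def cos_prod_integral_shift)
  have "(\<integral>x. cos_kernel N (x - y) \<partial>cubeM) = (\<integral>x. cos_kernel N (x :: real^'a) \<partial>cubeM)"
    by (rule torus_fun_shift_integral[OF cos_kernel_torus])
  also have "\<dots> = 1"
    using cos_prod_integral_pos[of N, where ?'d='a] by (simp add: cos_kernel_def)
  finally show "(\<integral>x. cos_kernel N (x - y) \<partial>cubeM) = 1" .
qed

section \<open>Convolution on the torus\<close>

definition conv :: "(real^'d \<Rightarrow> real) \<Rightarrow> (real^'d \<Rightarrow> real) \<Rightarrow> real^'d \<Rightarrow> real" where
  "conv K v x = (\<integral>y. K (x - y) * v y \<partial>cubeM)"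

lemma conv_borel [measurable]:
  assumes [measurable]: "K \<in> borel_measurable borel" "v \<in> borel_measurable borel"
  shows "conv K v \<in> borel_measurable borel"
  unfolding conv_def[abs_def] by measurable

lemma kernel_integrable:
  assumes "torus_fun K" "integrable cubeM v"
  shows "integrable cubeM (\<lambda>y. K (x - y) * v y)"
proof -
  obtain L where L: "L > 0" "\<And>x. \<bar>K x\<bar> \<le> L" using torus_fun_bounded[OF assms(1)] by blast
  have [measurable]: "K \<in> borel_measurable borel" "v \<in> borel_measurable borel"
    using assms by (auto simp: torus_fun_borel)
  show ?thesis
  proof (rule Bochner_Integration.integrable_bound)
    show "integrable cubeM (\<lambda>y. L * v y)" using assms by simp
    show "AE y in cubeM. norm (K (x - y) * v y) \<le> norm (L * v y)"
      using L by (auto simp: abs_mult intro!: mult_right_mono order_trans[OF L(2)])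
  qed measurable
qed

lemma conv_bound:
  assumes "torus_fun K" "\<And>x. \<bar>K x\<bar> \<le> L" "integrable cubeM v"
  shows "\<bar>conv K v x\<bar> \<le> L * (\<integral>y. \<bar>v y\<bar> \<partial>cubeM)"
proof -
  have "\<bar>conv K v x\<bar> \<le> (\<integral>y. \<bar>K (x - y) * v y\<bar> \<partial>cubeM)"
    unfolding conv_def by (rule integral_abs_bound)
  also have "\<dots> \<le> (\<integral>y. L * \<bar>v y\<bar> \<partial>cubeM)"
    using assms integrable_abs[OF kernel_integrable[OF assms(1,3), of x]]
    by (intro integral_mono) (auto simp: abs_mult intro!: mult_right_mono)
  finally show ?thesis by simp
qed

text \<open>The function \<open>h\<close> is not assumed periodic, so the limit is taken at interior
  points: at a boundary point the kernel would also see the opposite faces.\<close>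

lemma conv_cont_lim:
  fixes h :: "real^'d \<Rightarrow> real"
  assumes x: "x \<in> box 0 One" and h: "continuous_on UNIV h" "\<And>y. \<bar>h y\<bar> \<le> B"
  shows "(\<lambda>N. conv (cos_kernel N) h x) \<longlonglongrightarrow> h x"
proof (rule LIMSEQ_I)
  fix r :: real assume "r > 0"
  have [measurable]: "h \<in> borel_measurable borel" using h(1) by (rule borel_measurable_continuous_onI)
  have "isCont h x" using h(1) by (simp add: continuous_on_eq_continuous_at)
  then obtain d where d: "d > 0" "\<And>y. dist y x < d \<Longrightarrow> \<bar>h y - h x\<bar> < r / 2"
    using \<open>r > 0\<close> unfolding continuous_at_eps_delta dist_real_def by (metis half_gt_zero)
  obtain c q where cq: "0 < c" "0 \<le> q" "q < 1"
     "\<And>N y. y \<in> cube \<Longrightarrow> y \<notin> ball x d \<Longrightarrow> cos_kernel N (x - y) \<le> c * q ^ N"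
    using cos_kernel_concentrate_aux[OF x d(1)] by metis
  have B0: "0 \<le> B" using h(2)[of x] by linarith
  have hint: "integrable cubeM h" by (rule continuous_bounded_integrable_cubeM[OF _ h(2)]) simp
  have KI: "integrable cubeM (\<lambda>y. cos_kernel N (x - y))" for N
    using kernel_integrable[OF cos_kernel_torus, of "\<lambda>_. 1" N x] by simp
  have est: "\<bar>conv (cos_kernel N) h x - h x\<bar> \<le> r / 2 + 2 * B * (c * q ^ N)" for N
  proof -
    have "conv (cos_kernel N) h x - h x = (\<integral>y. cos_kernel N (x - y) * h y \<partial>cubeM) - (\<integral>y. cos_kernel N (x - y) * h x \<partial>cubeM)"
      by (simp add: conv_def cos_kernel_integral)
    also have "\<dots> = (\<integral>y. cos_kernel N (x - y) * h y - cos_kernel N (x - y) * h x \<partial>cubeM)"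
      by (rule Bochner_Integration.integral_diff[symmetric])
        (use KI kernel_integrable[OF cos_kernel_torus hint] in auto)
    finally have "\<bar>conv (cos_kernel N) h x - h x\<bar> \<le> (\<integral>y. \<bar>cos_kernel N (x - y) * h y - cos_kernel N (x - y) * h x\<bar> \<partial>cubeM)"
      using integral_abs_bound by metis
    also have "\<dots> \<le> (\<integral>y. cos_kernel N (x - y) * (r / 2) + 2 * B * (c * q ^ N) \<partial>cubeM)"
    proof (rule integral_mono_AE)
      show "integrable cubeM (\<lambda>y. \<bar>cos_kernel N (x - y) * h y - cos_kernel N (x - y) * h x\<bar>)"
        using KI kernel_integrable[OF cos_kernel_torus hint] by auto
      show "integrable cubeM (\<lambda>y. cos_kernel N (x - y) * (r / 2) + 2 * B * (c * q ^ N))"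
        using KI by auto
      have "AE y in cubeM. y \<in> cube" unfolding AE_cubeM by simp
      then show "AE y in cubeM. \<bar>cos_kernel N (x - y) * h y - cos_kernel N (x - y) * h x\<bar>
          \<le> cos_kernel N (x - y) * (r / 2) + 2 * B * (c * q ^ N)"
      proof eventually_elim
        case (elim y)
        have eq: "\<bar>cos_kernel N (x - y) * h y - cos_kernel N (x - y) * h x\<bar> = cos_kernel N (x - y) * \<bar>h y - h x\<bar>"
          by (simp add: cos_kernel_nonneg abs_mult flip: right_diff_distrib)
        show ?case
        proof (cases "y \<in> ball x d")
          case True
          then have "cos_kernel N (x - y) * \<bar>h y - h x\<bar> \<le> cos_kernel N (x - y) * (r / 2)"
            using d(2)[of y] by (intro mult_left_mono cos_kernel_nonneg) (auto simp: dist_commute)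
          moreover have "0 \<le> 2 * B * (c * q ^ N)" using B0 cq by simp
          ultimately show ?thesis unfolding eq by linarith
        next
          case False
          have "\<bar>h y - h x\<bar> \<le> 2 * B" using h(2)[of x] h(2)[of y] by linarith
          then have "cos_kernel N (x - y) * \<bar>h y - h x\<bar> \<le> (c * q ^ N) * (2 * B)"
            using cq(4)[OF elim False] B0 cq(1,2) by (intro mult_mono) auto
          moreover have "0 \<le> cos_kernel N (x - y) * (r / 2)" using \<open>r > 0\<close> by (intro mult_nonneg_nonneg cos_kernel_nonneg) auto
          ultimately show ?thesis unfolding eq by (simp add: mult.commute)
        qed
      qed
    qed
    also have "\<dots> = r / 2 + 2 * B * (c * q ^ N)"
      using KI by (subst Bochner_Integration.integral_add) (auto simp: cos_kernel_integral)
    finally show ?thesis .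
  qed
  have "(\<lambda>N. 2 * B * (c * q ^ N)) \<longlonglongrightarrow> 2 * B * (c * 0)"
    using cq by (intro tendsto_intros LIMSEQ_power_zero) auto
  then have "eventually (\<lambda>N. 2 * B * (c * q ^ N) < r / 2) sequentially"
    using \<open>r > 0\<close> by (auto dest: order_tendstoD(2)[of _ _ _ "r/2"])
  then obtain no where "\<forall>N\<ge>no. 2 * B * (c * q ^ N) < r / 2"
    unfolding eventually_sequentially by blast
  then show "\<exists>no. \<forall>N\<ge>no. norm (conv (cos_kernel N) h x - h x) < r"
    using est by (intro exI[of _ no]) (force intro: le_less_trans)
qed

text \<open>The derivative falls on the smooth kernel. A bound on \<open>pdx K i\<close> dominates
  the difference quotients, so \<open>v\<close> enters only through its integrability.\<close>

lemma conv_DERIV: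
  assumes "torus_fun K" "integrable cubeM v"
  shows "((\<lambda>s. conv K v (x + s *\<^sub>R axis i 1)) has_real_derivative conv (pdx K i) v (x + s *\<^sub>R axis i 1)) (at s)"
proof -
  have [measurable]: "K \<in> borel_measurable borel" "pdx K i \<in> borel_measurable borel" "v \<in> borel_measurable borel"
    using assms by (auto intro: torus_fun_borel torus_fun_pdx)
  obtain L where L: "L > 0" "\<And>x. \<bar>pdx K i x\<bar> \<le> L"
    using torus_fun_bounded[OF torus_fun_pdx[OF assms(1), of i]] by blast
  define e where "e = (axis i 1 :: real^'a)"
  define k where "k r y = K (x + r *\<^sub>R e - y)" for r y
  have k: "((\<lambda>r. k r y) has_real_derivative pdx K i (x + r *\<^sub>R e - y)) (at r)" for r y
    using pdx_has_derivative[OF assms(1), of "x - y" i r] by (simp add: k_def e_def algebra_simps)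
  have [measurable]: "k r \<in> borel_measurable borel" for r unfolding k_def[abs_def] by measurable
  have kint: "integrable cubeM (\<lambda>y. k r y * v y)" for r
    using kernel_integrable[OF assms] by (simp add: k_def)
  have "((\<lambda>h. (conv K v (x + (s + h) *\<^sub>R e) - conv K v (x + s *\<^sub>R e)) / h) \<longlongrightarrow> conv (pdx K i) v (x + s *\<^sub>R e)) (at 0)"
    unfolding tendsto_at_iff_sequentially comp_def
  proof (intro allI impI)
    fix X :: "nat \<Rightarrow> real" assume X0: "\<forall>i. X i \<in> UNIV - {0}" and X: "X \<longlonglongrightarrow> 0"
    have eq: "(conv K v (x + (s + X n) *\<^sub>R e) - conv K v (x + s *\<^sub>R e)) / X n
      = (\<integral>y. (k (s + X n) y - k s y) / X n * v y \<partial>cubeM)" for n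
    proof -
      have "conv K v (x + (s + X n) *\<^sub>R e) - conv K v (x + s *\<^sub>R e) = (\<integral>y. k (s + X n) y * v y - k s y * v y \<partial>cubeM)"
        unfolding conv_def k_def[symmetric] by (rule Bochner_Integration.integral_diff[symmetric]) (rule kint)+
      then have "(conv K v (x + (s + X n) *\<^sub>R e) - conv K v (x + s *\<^sub>R e)) / X n
        = (\<integral>y. (k (s + X n) y * v y - k s y * v y) / X n \<partial>cubeM)" by simp
      also have "\<dots> = (\<integral>y. (k (s + X n) y - k s y) / X n * v y \<partial>cubeM)"
        by (rule Bochner_Integration.integral_cong) (auto simp: field_simps)
      finally show ?thesis .
    qed
    show "(\<lambda>n. (conv K v (x + (s + X n) *\<^sub>R e) - conv K v (x + s *\<^sub>R e)) / X n) \<longlonglongrightarrow> conv (pdx K i) v (x + s *\<^sub>R e)"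
      unfolding eq unfolding conv_def
    proof (rule integral_dominated_convergence[where w="\<lambda>y. L * \<bar>v y\<bar>"])
      show "integrable cubeM (\<lambda>y. L * \<bar>v y\<bar>)" using assms by simp
      show "AE y in cubeM. (\<lambda>n. (k (s + X n) y - k s y) / X n * v y) \<longlonglongrightarrow> pdx K i (x + s *\<^sub>R e - y) * v y"
      proof (rule AE_I2)
        fix y
        have "((\<lambda>h. (k (s + h) y - k s y) / h) \<longlongrightarrow> pdx K i (x + s *\<^sub>R e - y)) (at 0)"
          using k[where r=s and y=y] by (simp add: DERIV_def)
        then have "(\<lambda>n. (k (s + X n) y - k s y) / X n) \<longlonglongrightarrow> pdx K i (x + s *\<^sub>R e - y)"
          using X X0 unfolding tendsto_at_iff_sequentially comp_def by blast
        then show "(\<lambda>n. (k (s + X n) y - k s y) / X n * v y) \<longlonglongrightarrow> pdx K i (x + s *\<^sub>R e - y) * v y"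
          by (intro tendsto_intros)
      qed
      show "AE y in cubeM. norm ((k (s + X n) y - k s y) / X n * v y) \<le> L * \<bar>v y\<bar>" for n
      proof (rule AE_I2)
        fix y
        have "norm (k (s + X n) y - k s y) \<le> L * norm (s + X n - s)"
          by (rule field_differentiable_bound[where S=UNIV and f'="\<lambda>r. pdx K i (x + r *\<^sub>R e - y)"])
            (use k L in \<open>auto simp: has_field_derivative_at_within\<close>)
        then have "\<bar>(k (s + X n) y - k s y) / X n\<bar> \<le> L"
          using X0 by (auto simp: field_simps)
        then show "norm ((k (s + X n) y - k s y) / X n * v y) \<le> L * \<bar>v y\<bar>"
          unfolding real_norm_def abs_mult by (intro mult_right_mono) auto
      qed
    qed measurable
  qed
  then show ?thesis by (simp add: DERIV_def e_def)
qed

lemma conv_continuous: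
  assumes "torus_fun K" "integrable cubeM v"
  shows "continuous_on S (conv K v)"
proof -
  have [measurable]: "K \<in> borel_measurable borel" "v \<in> borel_measurable borel"
    using assms by (auto intro: torus_fun_borel)
  obtain L where L: "L > 0" "\<And>x. \<bar>K x\<bar> \<le> L"
    using torus_fun_bounded[OF assms(1)] by blast
  have K: "continuous_on UNIV K" using assms(1) elem_fun_continuous torus_funD(1) by blast
  have "isCont (conv K v) x" for x
    unfolding continuous_at_sequentially comp_def
  proof (intro allI impI)
    fix X :: "nat \<Rightarrow> real^'a" assume X: "X \<longlonglongrightarrow> x"
    show "(\<lambda>n. conv K v (X n)) \<longlonglongrightarrow> conv K v x"
      unfolding conv_def
    proof (rule integral_dominated_convergence[where w="\<lambda>y. L * \<bar>v y\<bar>"])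
      show "AE y in cubeM. (\<lambda>n. K (X n - y) * v y) \<longlonglongrightarrow> K (x - y) * v y"
        using X by (intro AE_I2 tendsto_mult continuous_on_tendsto_compose[OF K] tendsto_intros) auto
      show "AE y in cubeM. norm (K (X n - y) * v y) \<le> L * \<bar>v y\<bar>" for n
        using L(2) by (intro AE_I2) (auto simp: abs_mult intro: mult_right_mono)
    qed (use assms in \<open>auto intro: integrable_mult_right integrable_abs\<close>)
  qed
  then show ?thesis by (simp add: continuous_at_imp_continuous_on)
qed

text \<open>Inherited from \<open>K\<close>: only the values of \<open>v\<close> on the unit cube
  enter the convolution.\<close>

lemma conv_periodic:
  assumes "torus_fun K" shows "conv K v (x + axis i 1) = conv K v x"
proof -
  have "K (x + axis i 1 - y) = K (x - y)" for y
    using torus_funD(2)[OF assms, of "x - y" i] by (simp add: algebra_simps)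
  then show ?thesis by (simp add: conv_def)
qed

section \<open>Limits of integrals of products\<close>

lemma integrable_bounded_mult:
  fixes \<phi> \<psi> :: "'a \<Rightarrow> real"
  assumes "integrable M \<psi>" "\<phi> \<in> borel_measurable M" "AE x in M. \<bar>\<phi> x\<bar> \<le> B"
  shows "integrable M (\<lambda>x. \<phi> x * \<psi> x)"
proof (rule Bochner_Integration.integrable_bound[where f="\<lambda>x. B * \<psi> x"])
  show "AE x in M. norm (\<phi> x * \<psi> x) \<le> norm (B * \<psi> x)"
    using assms(3) by eventually_elim (auto simp: abs_mult intro!: mult_right_mono)
qed (use assms in auto)

text \<open>Split the product into \<open>\<phi> n * (\<psi> n - \<psi>')\<close> and
  \<open>\<phi> n * \<psi>'\<close>. The first integral is at most \<open>B\<close> times an L1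
  distance, the second converges by dominated convergence.\<close>

lemma tendsto_integral_bounded_mult:
  fixes \<phi> :: "nat \<Rightarrow> 'a \<Rightarrow> real" and \<psi> :: "nat \<Rightarrow> 'a \<Rightarrow> real"
  assumes \<phi>: "AE x in M. (\<lambda>n. \<phi> n x) \<longlonglongrightarrow> \<phi>' x" "\<And>n. AE x in M. \<bar>\<phi> n x\<bar> \<le> B"
    and m: "\<And>n. \<phi> n \<in> borel_measurable M" "\<phi>' \<in> borel_measurable M"
    and \<psi>: "(\<lambda>n. \<integral>x. \<bar>\<psi> n x - \<psi>' x\<bar> \<partial>M) \<longlonglongrightarrow> 0" "\<And>n. integrable M (\<psi> n)" "integrable M \<psi>'"
  shows "(\<lambda>n. \<integral>x. \<phi> n x * \<psi> n x \<partial>M) \<longlonglongrightarrow> (\<integral>x. \<phi>' x * \<psi>' x \<partial>M)"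
proof -
  have d: "integrable M (\<lambda>x. \<psi> n x - \<psi>' x)" for n using \<psi> by simp
  have 1: "(\<lambda>n. \<integral>x. \<phi> n x * \<psi>' x \<partial>M) \<longlonglongrightarrow> (\<integral>x. \<phi>' x * \<psi>' x \<partial>M)"
  proof (rule integral_dominated_convergence[where w="\<lambda>x. B * \<bar>\<psi>' x\<bar>"])
    show "AE x in M. (\<lambda>n. \<phi> n x * \<psi>' x) \<longlonglongrightarrow> \<phi>' x * \<psi>' x"
      using \<phi>(1) by eventually_elim (intro tendsto_intros)
    show "AE x in M. norm (\<phi> n x * \<psi>' x) \<le> B * \<bar>\<psi>' x\<bar>" for n
      using \<phi>(2)[of n] by eventually_elim (auto simp: abs_mult intro!: mult_right_mono)
  qed (use m \<psi> in auto)
  have 2: "(\<lambda>n. \<integral>x. \<phi> n x * (\<psi> n x - \<psi>' x) \<partial>M) \<longlonglongrightarrow> 0"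
  proof (rule Lim_null_comparison)
    show "(\<lambda>n. B * (\<integral>x. \<bar>\<psi> n x - \<psi>' x\<bar> \<partial>M)) \<longlonglongrightarrow> 0" using tendsto_mult_left[OF \<psi>(1), of B] by simp
    show "\<forall>\<^sub>F n in sequentially. norm (\<integral>x. \<phi> n x * (\<psi> n x - \<psi>' x) \<partial>M) \<le> B * (\<integral>x. \<bar>\<psi> n x - \<psi>' x\<bar> \<partial>M)"
    proof (rule always_eventually, rule allI)
      fix n
      have "norm (\<integral>x. \<phi> n x * (\<psi> n x - \<psi>' x) \<partial>M) \<le> (\<integral>x. \<bar>\<phi> n x * (\<psi> n x - \<psi>' x)\<bar> \<partial>M)"
        unfolding real_norm_def by (rule integral_abs_bound)
      also have "\<dots> \<le> (\<integral>x. B * \<bar>\<psi> n x - \<psi>' x\<bar> \<partial>M)"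
      proof (rule integral_mono_AE)
        show "integrable M (\<lambda>x. \<bar>\<phi> n x * (\<psi> n x - \<psi>' x)\<bar>)"
          using integrable_bounded_mult[OF d m(1) \<phi>(2)] by (rule integrable_abs)
        show "AE x in M. \<bar>\<phi> n x * (\<psi> n x - \<psi>' x)\<bar> \<le> B * \<bar>\<psi> n x - \<psi>' x\<bar>"
          using \<phi>(2)[of n] by eventually_elim (auto simp: abs_mult intro!: mult_right_mono)
      qed (use d in auto)
      finally show "norm (\<integral>x. \<phi> n x * (\<psi> n x - \<psi>' x) \<partial>M) \<le> B * (\<integral>x. \<bar>\<psi> n x - \<psi>' x\<bar> \<partial>M)" by simp
    qed
  qed
  have eq: "(\<integral>x. \<phi> n x * (\<psi> n x - \<psi>' x) \<partial>M) + (\<integral>x. \<phi> n x * \<psi>' x \<partial>M) = (\<integral>x. \<phi> n x * \<psi> n x \<partial>M)" for n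
    using integrable_bounded_mult[OF \<psi>(2) m(1) \<phi>(2), of n n] integrable_bounded_mult[OF \<psi>(3) m(1) \<phi>(2), of n]
    by (simp add: right_diff_distrib)
  show ?thesis using tendsto_add[OF 2 1] by (simp add: eq)
qed

text \<open>By definition \<open>measurable_on\<close> provides continuous approximants outside a
  negligible set; the rest translates between Borel and Lebesgue measurability.\<close>

lemma continuous_AE_approx:
  fixes v :: "'a::euclidean_space \<Rightarrow> real"
  assumes [measurable]: "v \<in> borel_measurable borel"
  obtains h where "\<And>n::nat. continuous_on UNIV (h n)" "AE x in lborel. (\<lambda>n. h n x) \<longlonglongrightarrow> v x"
proof -
  have "v \<in> borel_measurable lebesgue" using assms by (intro measurable_completion) simp
  then have "v measurable_on UNIV"
    by (intro lebesgue_measurable_imp_measurable_on) auto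
  then obtain N h where N: "negligible N" "\<forall>n. continuous_on UNIV (h n)"
     "\<forall>x. x \<notin> N \<longrightarrow> (\<lambda>n::nat. h n x) \<longlonglongrightarrow> v x"
    unfolding measurable_on_def by auto
  have "AE x in lebesgue. x \<notin> N" using N(1) by (intro AE_not_in) (simp add: negligible_iff_null_sets)
  then have "AE x in lborel. x \<notin> N" by (simp add: AE_completion_iff)
  then have "AE x in lborel. (\<lambda>n. h n x) \<longlonglongrightarrow> v x" by eventually_elim (use N in blast)
  with N(2) show ?thesis using that by blast
qed

section \<open>Density of bounded continuous functions with respect to a gauge\<close>

definition clip :: "real \<Rightarrow> real \<Rightarrow> real" where "clip M r = max (- M) (min M r)"

lemma clip_cont: "continuous_on S (clip M)"
  unfolding clip_def[abs_def] by (intro continuous_intros)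

lemma clip_borel [measurable]: "clip M \<in> borel_measurable borel"
  by (intro borel_measurable_continuous_onI clip_cont)

lemma clip_bound: "0 \<le> M \<Longrightarrow> \<bar>clip M r\<bar> \<le> M" and clip_diff: "0 \<le> M \<Longrightarrow> \<bar>r - clip M r\<bar> \<le> \<bar>r\<bar>"
  and clip_id: "\<bar>r\<bar> \<le> M \<Longrightarrow> clip M r = r"
  by (auto simp: clip_def)

lemma clip_tendsto: "f \<longlonglongrightarrow> l \<Longrightarrow> (\<lambda>n. clip M (f n)) \<longlonglongrightarrow> clip M l"
  by (rule continuous_on_tendsto_compose[OF clip_cont[of UNIV]]) auto

text \<open>Covers \<open>|r|\<close> and \<open>r^2\<close>, so that convergence in L1 and in L2 is proved at once.\<close>
definition gauge_fun :: "(real \<Rightarrow> real) \<Rightarrow> bool" where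
  "gauge_fun \<Psi> \<longleftrightarrow> convex_on UNIV \<Psi> \<and> continuous_on UNIV \<Psi> \<and> (\<forall>a b. \<bar>a\<bar> \<le> \<bar>b\<bar> \<longrightarrow> \<Psi> a \<le> \<Psi> b) \<and>
    (\<forall>a b. \<Psi> (a + b) \<le> 2 * (\<Psi> a + \<Psi> b)) \<and> \<Psi> 0 = 0 \<and> (\<forall>a. \<bar>a\<bar> \<le> 1 + \<Psi> a)"

lemma gauge_abs: "gauge_fun abs"
proof -
  have "convex_on UNIV (\<lambda>r::real. \<bar>r\<bar>)"
  proof (rule convex_onI)
    fix t x y :: real assume "0 < t" "t < 1"
    then show "\<bar>(1 - t) *\<^sub>R x + t *\<^sub>R y\<bar> \<le> (1 - t) * \<bar>x\<bar> + t * \<bar>y\<bar>"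
      using abs_triangle_ineq[of "(1 - t) * x" "t * y"] by (simp add: abs_mult)
  qed simp
  moreover have "continuous_on UNIV (abs :: real \<Rightarrow> real)"
    using continuous_on_rabs[OF continuous_on_id[of UNIV]] by simp
  moreover have "\<bar>a + b\<bar> \<le> 2 * (\<bar>a\<bar> + \<bar>b\<bar>)" for a b :: real
    using abs_triangle_ineq[of a b] abs_ge_zero[of a] abs_ge_zero[of b] by argo
  ultimately show ?thesis unfolding gauge_fun_def by simp
qed

lemma gauge_square: "gauge_fun (\<lambda>r. r\<^sup>2)"
proof -
  have "convex_on UNIV (\<lambda>r::real. r\<^sup>2)" by (rule convex_power2)
  moreover have "(a + b)\<^sup>2 \<le> 2 * (a\<^sup>2 + b\<^sup>2)" for a b :: real
    using zero_le_power2[of "a - b"] by (simp add: power2_eq_square algebra_simps)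
  moreover have "\<bar>a\<bar> \<le> 1 + a\<^sup>2" for a :: real
    using zero_le_power2[of "\<bar>a\<bar> - 1"] zero_le_power2[of a] by (simp add: power2_eq_square algebra_simps)
  ultimately show ?thesis unfolding gauge_fun_def by (auto simp: abs_le_square_iff intro!: continuous_intros)
qed

lemma gauge_funD:
  assumes "gauge_fun \<Psi>"
  shows "convex_on UNIV \<Psi>" "continuous_on UNIV \<Psi>" "\<bar>a\<bar> \<le> \<bar>b\<bar> \<Longrightarrow> \<Psi> a \<le> \<Psi> b"
    "\<Psi> (a + b) \<le> 2 * (\<Psi> a + \<Psi> b)" "\<Psi> 0 = 0" "\<bar>a\<bar> \<le> 1 + \<Psi> a" "0 \<le> \<Psi> a" "\<Psi> (- a) = \<Psi> a"
    "\<Psi> \<in> borel_measurable borel"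
proof -
  have mono: "\<bar>a\<bar> \<le> \<bar>b\<bar> \<Longrightarrow> \<Psi> a \<le> \<Psi> b" for a b using assms by (simp add: gauge_fun_def)
  show "\<Psi> \<in> borel_measurable borel"
    using assms by (intro borel_measurable_continuous_onI) (simp add: gauge_fun_def)
  show "0 \<le> \<Psi> a" using mono[of 0 a] assms by (simp add: gauge_fun_def)
  show "\<Psi> (- a) = \<Psi> a" using mono[of a "-a"] mono[of "-a" a] by simp
qed (use assms in \<open>auto simp: gauge_fun_def\<close>)

lemma (in finite_measure) gauge_integrable:
  assumes "gauge_fun \<Psi>" "v \<in> borel_measurable M" "integrable M (\<lambda>x. \<Psi> (v x))"
  shows "integrable M v"
proof (rule Bochner_Integration.integrable_bound)
  show "integrable M (\<lambda>x. 1 + \<Psi> (v x))" using assms by auto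
  have "0 \<le> \<Psi> (v x)" for x by (rule gauge_funD(7)[OF assms(1)])
  then show "AE x in M. norm (v x) \<le> norm (1 + \<Psi> (v x))"
    using gauge_funD(6)[OF assms(1)] by (intro AE_I2) (auto simp: abs_of_nonneg)
qed (use assms in auto)

text \<open>Truncate \<open>v\<close>, then approximate the truncation by continuous functions
  clipped at the same level; dominated convergence applies both times. The assumption
  \<open>ac\<close> transfers almost everywhere convergence from \<open>lborel\<close> to
  \<open>M\<close>.\<close>

lemma gauge_dense:
  fixes v :: "'a::euclidean_space \<Rightarrow> real"
  assumes fin: "finite_measure M" and sets: "sets M = sets borel"
    and ac: "\<And>P. (AE x in lborel. P x) \<Longrightarrow> (AE x in M. P x)"
    and g: "gauge_fun \<Psi>" and v [measurable]: "v \<in> borel_measurable borel"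
    and int: "integrable M (\<lambda>x. \<Psi> (v x))" and e: "0 < e"
  obtains h B where "continuous_on UNIV h" "\<And>x. \<bar>h x\<bar> \<le> B"
    "integrable M (\<lambda>x. \<Psi> (v x - h x))" "(\<integral>x. \<Psi> (v x - h x) \<partial>M) < e"
proof -
  interpret finite_measure M by fact
  have [measurable_cong]: "sets M = sets borel" by fact
  note G = gauge_funD[OF g]
  have [measurable]: "\<Psi> \<in> borel_measurable borel" by (rule G)
  have "(\<lambda>m. \<integral>x. \<Psi> (v x - clip (real m) (v x)) \<partial>M) \<longlonglongrightarrow> (\<integral>x. 0 \<partial>M)"
  proof (rule integral_dominated_convergence[where w="\<lambda>x. \<Psi> (v x)"])
    show "AE x in M. (\<lambda>m. \<Psi> (v x - clip (real m) (v x))) \<longlonglongrightarrow> 0"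
    proof (rule AE_I2)
      fix x
      obtain m0 :: nat where "\<bar>v x\<bar> \<le> m0" using real_arch_simple by blast
      then have "\<Psi> (v x - clip (real m) (v x)) = 0" if "m \<ge> m0" for m
        using that by (subst clip_id) (auto simp: G(5) intro: order_trans)
      then show "(\<lambda>m. \<Psi> (v x - clip (real m) (v x))) \<longlonglongrightarrow> 0"
        by (intro tendsto_eventually) (auto simp: eventually_sequentially)
    qed
    show "AE x in M. norm (\<Psi> (v x - clip (real m) (v x))) \<le> \<Psi> (v x)" for m
      using G(3)[OF clip_diff] by (intro AE_I2) (simp add: G(7) abs_of_nonneg)
  qed (use int in auto)
  \<comment> \<open>The quasi-triangle inequality in \<open>gauge_fun\<close> doubles the sum of
    truncation error and approximation error, so each of them gets \<open>e / 4\<close>.\<close>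
  then have "eventually (\<lambda>m. (\<integral>x. \<Psi> (v x - clip (real m) (v x)) \<partial>M) < e / 4) sequentially"
    using e by (intro order_tendstoD(2)) auto
  then obtain m :: nat where m: "(\<integral>x. \<Psi> (v x - clip (real m) (v x)) \<partial>M) < e / 4"
    by (auto simp: eventually_sequentially)
  obtain h where h: "\<And>n::nat. continuous_on UNIV (h n)" "AE x in lborel. (\<lambda>n. h n x) \<longlonglongrightarrow> v x"
    using continuous_AE_approx[OF v] by metis
  have [measurable]: "h n \<in> borel_measurable borel" for n
    using h(1) by (rule borel_measurable_continuous_onI)
  have bd: "\<Psi> (clip (real m) a - clip (real m) b) \<le> \<Psi> (2 * real m)" for a b
    using clip_bound[of "real m" a] clip_bound[of "real m" b] by (intro G(3)) auto
  have "(\<lambda>n. \<integral>x. \<Psi> (clip (real m) (v x) - clip (real m) (h n x)) \<partial>M) \<longlonglongrightarrow> (\<integral>x. 0 \<partial>M)"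
  proof (rule integral_dominated_convergence[where w="\<lambda>x. \<Psi> (2 * real m)"])
    show "AE x in M. (\<lambda>n. \<Psi> (clip (real m) (v x) - clip (real m) (h n x))) \<longlonglongrightarrow> 0"
      using ac[OF h(2)]
    proof eventually_elim
      case (elim x)
      have "(\<lambda>n. clip (real m) (v x) - clip (real m) (h n x)) \<longlonglongrightarrow> clip (real m) (v x) - clip (real m) (v x)"
        by (intro tendsto_intros clip_tendsto elim)
      from continuous_on_tendsto_compose[OF G(2) this] show ?case by (simp add: G(5))
    qed
    show "AE x in M. norm (\<Psi> (clip (real m) (v x) - clip (real m) (h n x))) \<le> \<Psi> (2 * real m)" for n
      using bd by (intro AE_I2) (simp add: G(7) abs_of_nonneg)
  qed auto
  then have "eventually (\<lambda>n. (\<integral>x. \<Psi> (clip (real m) (v x) - clip (real m) (h n x)) \<partial>M) < e / 4) sequentially"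
    using e by (intro order_tendstoD(2)) auto
  then obtain n where n: "(\<integral>x. \<Psi> (clip (real m) (v x) - clip (real m) (h n x)) \<partial>M) < e / 4"
    by (auto simp: eventually_sequentially)
  let ?h = "\<lambda>x. clip (real m) (h n x)"
  have i1: "integrable M (\<lambda>x. \<Psi> (v x - clip (real m) (v x)))"
    by (rule Bochner_Integration.integrable_bound[OF int])
      (use G(3)[OF clip_diff] in \<open>auto simp: G(7) abs_of_nonneg\<close>)
  have i2: "integrable M (\<lambda>x. \<Psi> (clip (real m) (v x) - ?h x))"
    by (rule integrable_const_bound[where B="\<Psi> (2 * real m)"]) (use bd in \<open>auto simp: G(7) abs_of_nonneg\<close>)
  have le: "\<Psi> (v x - ?h x) \<le> 2 * (\<Psi> (v x - clip (real m) (v x)) + \<Psi> (clip (real m) (v x) - ?h x))" for x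
    using G(4)[of "v x - clip (real m) (v x)" "clip (real m) (v x) - ?h x"] by simp
  have i3: "integrable M (\<lambda>x. \<Psi> (v x - ?h x))"
    by (rule Bochner_Integration.integrable_bound[where f="\<lambda>x. 2 * (\<Psi> (v x - clip (real m) (v x)) + \<Psi> (clip (real m) (v x) - ?h x))"])
      (use i1 i2 le in \<open>auto simp: G(7) abs_of_nonneg intro: order_trans[OF _ abs_ge_self]\<close>)
  have "(\<integral>x. \<Psi> (v x - ?h x) \<partial>M) \<le> (\<integral>x. 2 * (\<Psi> (v x - clip (real m) (v x)) + \<Psi> (clip (real m) (v x) - ?h x)) \<partial>M)"
    by (rule integral_mono) (use i1 i2 i3 le in auto)
  also have "\<dots> = 2 * ((\<integral>x. \<Psi> (v x - clip (real m) (v x)) \<partial>M) + (\<integral>x. \<Psi> (clip (real m) (v x) - ?h x) \<partial>M))"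
    using i1 i2 by simp
  also have "\<dots> < e" using m n by simp
  finally have "(\<integral>x. \<Psi> (v x - ?h x) \<partial>M) < e" .
  moreover have "continuous_on UNIV ?h"
    by (rule continuous_on_compose2[OF clip_cont h(1)]) auto
  ultimately show ?thesis using that[of ?h "real m"] i3 clip_bound by auto
qed

section \<open>Convergence of the mollifications in the mean\<close>

lemma cubeM_ac: "(AE x in lborel. P x) \<Longrightarrow> (AE x in cubeM. P x)"
  unfolding AE_cubeM by (auto elim!: eventually_mono)

interpretation cube2: pair_prob_space "cubeM :: (real^'d) measure" "cubeM :: (real^'d) measure" ..

lemma conv_diff:
  assumes "torus_fun K" "integrable cubeM f" "integrable cubeM g"
  shows "conv K (\<lambda>x. f x - g x) x = conv K f x - conv K g x"
  using kernel_integrable[OF assms(1,2)] kernel_integrable[OF assms(1,3)]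
  by (simp add: conv_def right_diff_distrib)

lemma kernel_pair_integrable:
  fixes v :: "real^'d \<Rightarrow> real"
  assumes K: "torus_fun K" and v: "integrable cubeM v"
  shows "integrable (cubeM \<Otimes>\<^sub>M cubeM) (\<lambda>(y, x). K (x - y) * v y)"
proof -
  obtain L where L: "L > 0" "\<And>x. \<bar>K x\<bar> \<le> L" using torus_fun_bounded[OF K] by blast
  have [measurable]: "v \<in> borel_measurable borel" "K \<in> borel_measurable borel"
    using v torus_fun_borel[OF K] by auto
  show ?thesis
  proof (rule Bochner_Integration.integrable_bound[where f="\<lambda>(y::real^'d, x::real^'d). L * v y"])
    show "integrable (cubeM \<Otimes>\<^sub>M cubeM) (\<lambda>(y::real^'d, x::real^'d). L * v y)"
      using v by (intro cube2.Fubini_integrable) auto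
    show "AE p in cubeM \<Otimes>\<^sub>M cubeM. norm (case p of (y, x) \<Rightarrow> K (x - y) * v y) \<le> norm (case p of (y, x::real^'d) \<Rightarrow> L * v y)"
      using L by (intro AE_I2) (auto simp: abs_mult intro!: mult_right_mono)
  qed measurable
qed

lemma conv_integrable:
  assumes "torus_fun K" "integrable cubeM v" shows "integrable cubeM (conv K v)"
  using cube2.integrable_snd[OF kernel_pair_integrable[OF assms]] by (simp add: conv_def[abs_def])

lemma conv_integral:
  assumes v: "integrable cubeM v" shows "(\<integral>x. conv (cos_kernel N) v x \<partial>cubeM) = (\<integral>x. v x \<partial>cubeM)"
proof -
  have "(\<integral>x. conv (cos_kernel N) v x \<partial>cubeM) = (\<integral>y. (\<integral>x. cos_kernel N (x - y) * v y \<partial>cubeM) \<partial>cubeM)"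
    unfolding conv_def by (rule cube2.Fubini_integral[OF kernel_pair_integrable[OF cos_kernel_torus v]])
  also have "\<dots> = (\<integral>x. v x \<partial>cubeM)" by (simp add: cos_kernel_integral)
  finally show ?thesis .
qed

text \<open>Jensen's inequality for the probability density y \<mapsto> cos_kernel N (x - y), then Fubini.\<close>
lemma conv_gauge:
  fixes v :: "real^'d \<Rightarrow> real"
  assumes g: "gauge_fun \<Psi>" and v [measurable]: "v \<in> borel_measurable borel"
    and int: "integrable cubeM (\<lambda>x. \<Psi> (v x))"
  shows "integrable cubeM (\<lambda>x. \<Psi> (conv (cos_kernel N) v x))"
    and "(\<integral>x. \<Psi> (conv (cos_kernel N) v x) \<partial>cubeM) \<le> (\<integral>x. \<Psi> (v x) \<partial>cubeM)"
proof -
  note G = gauge_funD[OF g]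
  have [measurable]: "\<Psi> \<in> borel_measurable borel" by (rule G)
  have iv: "integrable cubeM v" by (rule cubeM.gauge_integrable[OF g _ int]) simp
  have jens: "\<Psi> (conv (cos_kernel N) v x) \<le> conv (cos_kernel N) (\<lambda>y. \<Psi> (v y)) x" for x
  proof -
    define Mx where "Mx = density (cubeM :: (real^'d) measure) (\<lambda>y. ennreal (cos_kernel N (x - y)))"
    have KI: "integrable cubeM (\<lambda>y. cos_kernel N (x - y))"
      using kernel_integrable[OF cos_kernel_torus, of "\<lambda>_. 1" N x] by simp
    interpret Mx: prob_space Mx
    proof
      have "emeasure Mx (space Mx) = (\<integral>\<^sup>+y. ennreal (cos_kernel N (x - y)) \<partial>cubeM)"
        by (simp add: Mx_def emeasure_density)
      also have "\<dots> = ennreal (\<integral>y. cos_kernel N (x - y) \<partial>cubeM)"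
        by (rule nn_integral_eq_integral[OF KI]) (simp add: cos_kernel_nonneg)
      also have "\<dots> = 1" by (simp add: cos_kernel_integral)
      finally show "emeasure Mx (space Mx) = 1" .
    qed
    have I: "integrable Mx f" if "integrable cubeM f" for f :: "real^'d \<Rightarrow> real"
    proof -
      have [measurable]: "f \<in> borel_measurable borel" using that by auto
      show ?thesis unfolding Mx_def
        by (subst integrable_density) (use kernel_integrable[OF cos_kernel_torus that] in \<open>auto simp: cos_kernel_nonneg\<close>)
    qed
    have E: "(\<integral>y. f y \<partial>Mx) = conv (cos_kernel N) f x" if [measurable]: "f \<in> borel_measurable borel" for f :: "real^'d \<Rightarrow> real"
      unfolding Mx_def conv_def by (subst integral_density) (auto simp: cos_kernel_nonneg)
    have "\<Psi> (Mx.expectation v) \<le> Mx.expectation (\<lambda>y. \<Psi> (v y))"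
      by (rule Mx.jensens_inequality[where I=UNIV]) (use I iv int G(1) in auto)
    then show ?thesis by (simp add: E)
  qed
  have ic: "integrable cubeM (conv (cos_kernel N) (\<lambda>y. \<Psi> (v y)))"
    by (rule conv_integrable[OF cos_kernel_torus int])
  show i1: "integrable cubeM (\<lambda>x. \<Psi> (conv (cos_kernel N) v x))"
    by (rule Bochner_Integration.integrable_bound[OF ic])
      (use jens in \<open>auto simp: G(7) abs_of_nonneg intro: order_trans[OF _ abs_ge_self]\<close>)
  have "(\<integral>x. \<Psi> (conv (cos_kernel N) v x) \<partial>cubeM) \<le> (\<integral>x. conv (cos_kernel N) (\<lambda>y. \<Psi> (v y)) x \<partial>cubeM)"
    by (rule integral_mono[OF i1 ic jens])
  also have "\<dots> = (\<integral>x. \<Psi> (v x) \<partial>cubeM)" by (rule conv_integral[OF int])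
  finally show "(\<integral>x. \<Psi> (conv (cos_kernel N) v x) \<partial>cubeM) \<le> (\<integral>x. \<Psi> (v x) \<partial>cubeM)" .
qed

text \<open>Convergence holds for bounded continuous functions and extends by density, thanks to the
  uniform bound. Its factor 4 is the 2 of the quasi-triangle inequality times two terms, the one
  with the convolution being no larger than the other by \<open>conv_gauge\<close>.\<close>

lemma conv_tendsto:
  fixes v :: "real^'d \<Rightarrow> real"
  assumes g: "gauge_fun \<Psi>" and v [measurable]: "v \<in> borel_measurable borel"
    and int: "integrable cubeM (\<lambda>x. \<Psi> (v x))"
  shows "(\<lambda>N. \<integral>x. \<Psi> (conv (cos_kernel N) v x - v x) \<partial>cubeM) \<longlonglongrightarrow> 0"
    and "integrable cubeM (\<lambda>x. \<Psi> (conv (cos_kernel N) v x - v x))"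
    and "(\<integral>x. \<Psi> (conv (cos_kernel N) v x - v x) \<partial>cubeM) \<le> 4 * (\<integral>x. \<Psi> (v x) \<partial>cubeM)"
proof -
  note G = gauge_funD[OF g]
  have [measurable]: "\<Psi> \<in> borel_measurable borel" by (rule G)
  have iv: "integrable cubeM v" by (rule cubeM.gauge_integrable[OF g _ int]) simp
  have main: "integrable cubeM (\<lambda>x. \<Psi> (conv (cos_kernel N) f x - f x)) \<and>
     (\<integral>x. \<Psi> (conv (cos_kernel N) f x - f x) \<partial>cubeM) \<le> 4 * (\<integral>x. \<Psi> (f x) \<partial>cubeM)"
    if [measurable]: "f \<in> borel_measurable borel" and f: "integrable cubeM (\<lambda>x. \<Psi> (f x))" for f :: "real^'d \<Rightarrow> real" and N
  proof -
    note c = conv_gauge[OF g that(1) f, of N]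
    have le: "\<Psi> (conv (cos_kernel N) f x - f x) \<le> 2 * (\<Psi> (conv (cos_kernel N) f x) + \<Psi> (f x))" for x
      using G(4)[of "conv (cos_kernel N) f x" "- f x"] by (simp add: G(8))
    have i: "integrable cubeM (\<lambda>x. \<Psi> (conv (cos_kernel N) f x - f x))"
      by (rule Bochner_Integration.integrable_bound[where f="\<lambda>x. 2 * (\<Psi> (conv (cos_kernel N) f x) + \<Psi> (f x))"])
        (use c f le in \<open>auto simp: G(7) abs_of_nonneg intro: order_trans[OF _ abs_ge_self]\<close>)
    have "(\<integral>x. \<Psi> (conv (cos_kernel N) f x - f x) \<partial>cubeM) \<le> (\<integral>x. 2 * (\<Psi> (conv (cos_kernel N) f x) + \<Psi> (f x)) \<partial>cubeM)"
      by (rule integral_mono[OF i _ le]) (use c f in auto)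
    also have "\<dots> \<le> 4 * (\<integral>x. \<Psi> (f x) \<partial>cubeM)" using c f by simp
    finally show ?thesis using i by blast
  qed
  show "integrable cubeM (\<lambda>x. \<Psi> (conv (cos_kernel N) v x - v x))"
    "(\<integral>x. \<Psi> (conv (cos_kernel N) v x - v x) \<partial>cubeM) \<le> 4 * (\<integral>x. \<Psi> (v x) \<partial>cubeM)" for N
    using main[OF v int] by auto
  show "(\<lambda>N. \<integral>x. \<Psi> (conv (cos_kernel N) v x - v x) \<partial>cubeM) \<longlonglongrightarrow> 0"
  proof (rule LIMSEQ_I)
    fix r :: real assume "r > 0"
    \<comment> \<open>The budget is \<open>2 * (4 * (r / 16) + r / 4) = r\<close>.\<close>
    obtain h B where h: "continuous_on UNIV h" "\<And>x. \<bar>h x\<bar> \<le> B"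
      "integrable cubeM (\<lambda>x. \<Psi> (v x - h x))" "(\<integral>x. \<Psi> (v x - h x) \<partial>cubeM) < r / 16"
      using gauge_dense[OF cubeM.finite_measure_axioms sets_cubeM cubeM_ac g v int, of "r/16"] \<open>r > 0\<close> by auto
    have [measurable]: "h \<in> borel_measurable borel" using h(1) by (rule borel_measurable_continuous_onI)
    have hint: "integrable cubeM h" by (rule continuous_bounded_integrable_cubeM[OF _ h(2)]) simp
    have ch: "\<bar>conv (cos_kernel N) h x\<bar> \<le> B" for N x
    proof -
      have "\<bar>conv (cos_kernel N) h x\<bar> \<le> (\<integral>y. \<bar>cos_kernel N (x - y) * h y\<bar> \<partial>cubeM)"
        unfolding conv_def by (rule integral_abs_bound)
      also have "\<dots> \<le> (\<integral>y. cos_kernel N (x - y) * B \<partial>cubeM)"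
        using kernel_integrable[OF cos_kernel_torus, of "\<lambda>_. B" N x] integrable_abs[OF kernel_integrable[OF cos_kernel_torus hint, of N x]] h(2)
        by (intro integral_mono) (auto simp: abs_mult cos_kernel_nonneg intro!: mult_left_mono)
      also have "\<dots> = B" by (simp add: cos_kernel_integral)
      finally show ?thesis .
    qed
    have hb: "\<Psi> (conv (cos_kernel N) h x - h x) \<le> \<Psi> (2 * B)" for N x
      using ch[of N x] h(2)[of x] by (intro G(3)) auto
    have "(\<lambda>N. \<integral>x. \<Psi> (conv (cos_kernel N) h x - h x) \<partial>cubeM) \<longlonglongrightarrow> (\<integral>x. 0 \<partial>(cubeM :: (real^'d) measure))"
    proof (rule integral_dominated_convergence[where w="\<lambda>x. \<Psi> (2 * B)"])
      show "AE x in cubeM. (\<lambda>N. \<Psi> (conv (cos_kernel N) h x - h x)) \<longlonglongrightarrow> 0"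
        using AE_cubeM_box
      proof eventually_elim
        case (elim x)
        have "(\<lambda>N. conv (cos_kernel N) h x - h x) \<longlonglongrightarrow> h x - h x"
          by (intro tendsto_intros conv_cont_lim[OF elim h(1,2)])
        from continuous_on_tendsto_compose[OF G(2) this] show ?case by (simp add: G(5))
      qed
      show "AE x in cubeM. norm (\<Psi> (conv (cos_kernel N) h x - h x)) \<le> \<Psi> (2 * B)" for N
        using hb by (intro AE_I2) (simp add: G(7) abs_of_nonneg)
    qed auto
    then have "eventually (\<lambda>N. (\<integral>x. \<Psi> (conv (cos_kernel N) h x - h x) \<partial>cubeM) < r / 4) sequentially"
      using \<open>r > 0\<close> by (intro order_tendstoD(2)) auto
    then obtain N0 where N0: "\<And>N. N \<ge> N0 \<Longrightarrow> (\<integral>x. \<Psi> (conv (cos_kernel N) h x - h x) \<partial>cubeM) < r / 4"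
      by (auto simp: eventually_sequentially)
    have "norm ((\<integral>x. \<Psi> (conv (cos_kernel N) v x - v x) \<partial>cubeM) - 0) < r" if "N \<ge> N0" for N
    proof -
      let ?f = "\<lambda>x. v x - h x"
      have m: "integrable cubeM (\<lambda>x. \<Psi> (conv (cos_kernel N) ?f x - ?f x))"
        "(\<integral>x. \<Psi> (conv (cos_kernel N) ?f x - ?f x) \<partial>cubeM) \<le> 4 * (\<integral>x. \<Psi> (?f x) \<partial>cubeM)"
        using main[of ?f N] h(3) by auto
      have le: "\<Psi> (conv (cos_kernel N) v x - v x) \<le> 2 * (\<Psi> (conv (cos_kernel N) ?f x - ?f x) + \<Psi> (conv (cos_kernel N) h x - h x))" for x
        using G(4)[of "conv (cos_kernel N) ?f x - ?f x" "conv (cos_kernel N) h x - h x"]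
        by (simp add: conv_diff[OF cos_kernel_torus iv hint])
      have ih: "integrable cubeM (\<lambda>x. \<Psi> (conv (cos_kernel N) h x - h x))"
        by (rule cubeM.integrable_const_bound[where B="\<Psi> (2 * B)"]) (use hb in \<open>auto simp: G(7) abs_of_nonneg\<close>)
      have "(\<integral>x. \<Psi> (conv (cos_kernel N) v x - v x) \<partial>cubeM) \<le> (\<integral>x. 2 * (\<Psi> (conv (cos_kernel N) ?f x - ?f x) + \<Psi> (conv (cos_kernel N) h x - h x)) \<partial>cubeM)"
        by (rule integral_mono[OF _ _ le]) (use m ih main[OF v int] in auto)
      also have "\<dots> = 2 * ((\<integral>x. \<Psi> (conv (cos_kernel N) ?f x - ?f x) \<partial>cubeM) + (\<integral>x. \<Psi> (conv (cos_kernel N) h x - h x) \<partial>cubeM))"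
        using m ih by simp
      also have "\<dots> < r" using m(2) h(4) N0[OF that] by simp
      finally show ?thesis using Bochner_Integration.integral_nonneg[of cubeM "\<lambda>x. \<Psi> (conv (cos_kernel N) v x - v x)"] by (simp add: G(7))
    qed
    then show "\<exists>N0. \<forall>N\<ge>N0. norm ((\<integral>x. \<Psi> (conv (cos_kernel N) v x - v x) \<partial>cubeM) - 0) < r" by blast
  qed
qed

text \<open>Mollifications converge to \<open>v\<close> in L1, so a constant shared by all of them
  is also the limit.\<close>

lemma conv_eq_0_imp:
  fixes v :: "real^'d \<Rightarrow> real"
  assumes v: "integrable cubeM v" and lim: "\<And>N x. conv (cos_kernel N) v x = c"
  shows "AE x in cubeM. v x = c"
proof -
  have [measurable]: "v \<in> borel_measurable borel" using v by auto
  have "(\<lambda>N. \<integral>x. \<bar>conv (cos_kernel N) v x - v x\<bar> \<partial>cubeM) \<longlonglongrightarrow> 0"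
    by (rule conv_tendsto(1)[OF gauge_abs]) (use v in auto)
  then have "(\<integral>x. \<bar>c - v x\<bar> \<partial>cubeM) = 0" by (simp add: lim LIMSEQ_const_iff)
  then have "AE x in cubeM. \<bar>c - v x\<bar> = 0"
    using v by (subst (asm) integral_nonneg_eq_0_iff_AE) auto
  then show ?thesis by (auto elim!: eventually_mono)
qed

section \<open>Integrals in time\<close>

definition timeM :: "real \<Rightarrow> real measure" where
  "timeM T = density lborel (indicator {0..T})"

lemma sets_timeM [measurable_cong, simp]: "sets (timeM T) = sets borel"
  by (simp add: timeM_def)

lemma space_timeM [simp]: "space (timeM T) = UNIV"
  by (simp add: timeM_def)

lemma AE_timeM: "(AE t in timeM T. P t) \<longleftrightarrow> (AE t in lborel. t \<in> {0..T} \<longrightarrow> P t)"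
  unfolding timeM_def by (subst AE_density) (auto simp: indicator_def split: if_splits)

lemma timeM_ac: "(AE t in lborel. P t) \<Longrightarrow> (AE t in timeM T. P t)"
  unfolding AE_timeM by (auto elim!: eventually_mono)

lemma AE_timeM_Icc: "AE t in timeM T. t \<in> {0..T}"
  unfolding AE_timeM by simp

interpretation timeM: finite_measure "timeM T" for T
proof
  have "emeasure (timeM T) (space (timeM T)) = emeasure lborel {0..T}"
    by (simp add: timeM_def emeasure_density)
  then show "emeasure (timeM T) (space (timeM T)) \<noteq> \<infinity>" by (simp add: emeasure_lborel_Icc_eq)
qed

interpretation time2: pair_sigma_finite "timeM T" "timeM T" for T ..

lemma integral_timeM: 
  fixes f :: "real \<Rightarrow> real"
  assumes [measurable]: "f \<in> borel_measurable borel"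
  shows "integral\<^sup>L (timeM T) f = (\<integral>t. indicator {0..T} t * f t \<partial>lborel)"
  unfolding timeM_def using integral_density[of f lborel "indicator {0..T}"]
  by (simp add: ennreal_indicator)

lemma timeM_integrable_mult_bounded:
  fixes m f :: "real \<Rightarrow> real"
  assumes "integrable (timeM T) m" "f \<in> borel_measurable borel" "\<And>t. t \<in> {0..T} \<Longrightarrow> \<bar>f t\<bar> \<le> B"
  shows "integrable (timeM T) (\<lambda>t. f t * m t)"
proof (rule integrable_bounded_mult[OF assms(1)])
  show "AE t in timeM T. \<bar>f t\<bar> \<le> B" using AE_timeM_Icc by eventually_elim (rule assms(3))
qed (use assms(2) in simp)

lemma power_abs_le: "t \<in> {0..T} \<Longrightarrow> \<bar>t ^ n\<bar> \<le> (T::real) ^ n"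
  by (auto simp: power_abs intro!: power_mono)

lemma timeM_integrable_power:
  assumes "integrable (timeM T) m" shows "integrable (timeM T) (\<lambda>t. t ^ n * m t)"
  by (rule timeM_integrable_mult_bounded[OF assms, where B="T ^ n"]) (simp, rule power_abs_le)

text \<open>Vanishing moments give vanishing integrals against polynomials, then against continuous
  functions by Weierstrass approximation on \<open>{0..T}\<close>, and finally against the sign of
  \<open>m\<close>, an almost everywhere limit of clipped continuous functions. The last integral is
  the L1 norm of \<open>m\<close>.\<close>

lemma moments_zero:
  fixes m :: "real \<Rightarrow> real"
  assumes m: "integrable (timeM T) m" and mom: "\<And>n. (\<integral>t. t ^ n * m t \<partial>timeM T) = 0"
  shows "AE t in timeM T. m t = 0"
proof -
  have [measurable]: "m \<in> borel_measurable borel" using m by auto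
  have cont_i: "integrable (timeM T) (\<lambda>t. f t * m t)" if f: "continuous_on UNIV f" for f :: "real \<Rightarrow> real"
  proof -
    have "compact (f ` {0..T})" by (intro compact_continuous_image continuous_on_subset[OF f]) auto
    then obtain B where "\<forall>y\<in>f ` {0..T}. norm y \<le> B" using compact_imp_bounded bounded_iff by metis
    then show ?thesis using f
      by (intro timeM_integrable_mult_bounded[OF m, where B=B] borel_measurable_continuous_onI) auto
  qed
  have poly: "(\<integral>t. p t * m t \<partial>timeM T) = 0" if rp: "real_polynomial_function p" for p
  proof -
    obtain a and n :: nat where p: "p = (\<lambda>x. \<Sum>i\<le>n. a i * x ^ i)"
      using real_polynomial_function_imp_sum[OF rp] by (elim exE)
    have "(\<integral>t. p t * m t \<partial>timeM T) = (\<integral>t. (\<Sum>i\<le>n. a i * (t ^ i * m t)) \<partial>timeM T)"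
      by (simp add: p sum_distrib_right mult.assoc)
    also have "\<dots> = (\<Sum>i\<le>n. \<integral>t. a i * (t ^ i * m t) \<partial>timeM T)"
      by (rule Bochner_Integration.integral_sum) (intro integrable_mult_right cont_i continuous_intros)
    also have "\<dots> = 0" by (simp add: mom)
    finally show ?thesis .
  qed
  have cont: "(\<integral>t. f t * m t \<partial>timeM T) = 0" if f: "continuous_on UNIV f" for f
  proof -
    have "\<bar>\<integral>t. f t * m t \<partial>timeM T\<bar> \<le> 0 + e" if "e > 0" for e
    proof -
      define A where "A = (\<integral>t. \<bar>m t\<bar> \<partial>timeM T)"
      have "A \<ge> 0" unfolding A_def by simp
      \<comment> \<open>Here \<open>A\<close> is the L1 norm of \<open>m\<close>; the summand 1
        covers the case \<open>A = 0\<close>.\<close>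
      obtain p where p: "real_polynomial_function p" "\<And>x. x \<in> {0..T} \<Longrightarrow> \<bar>f x - p x\<bar> < e / (A + 1)"
        using Stone_Weierstrass_real_polynomial_function[of "{0..T}" f "e / (A + 1)"] \<open>e > 0\<close> \<open>A \<ge> 0\<close>
          continuous_on_subset[OF f] by auto
      have pc: "continuous_on UNIV p"
        using p(1) by (simp add: continuous_on_polymonial_function real_polynomial_function_eq)
      have "(\<integral>t. f t * m t \<partial>timeM T) = (\<integral>t. f t * m t - p t * m t \<partial>timeM T)"
        using cont_i[OF f] cont_i[OF pc] poly[OF p(1)] by simp
      also have "\<bar>\<dots>\<bar> \<le> (\<integral>t. \<bar>f t * m t - p t * m t\<bar> \<partial>timeM T)" by (rule integral_abs_bound)
      also have "\<dots> \<le> (\<integral>t. e / (A + 1) * \<bar>m t\<bar> \<partial>timeM T)"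
      proof (rule integral_mono_AE)
        show "integrable (timeM T) (\<lambda>t. \<bar>f t * m t - p t * m t\<bar>)" using cont_i[OF f] cont_i[OF pc] by auto
        show "AE t in timeM T. \<bar>f t * m t - p t * m t\<bar> \<le> e / (A + 1) * \<bar>m t\<bar>"
          using AE_timeM_Icc
        proof eventually_elim
          case (elim t)
          have "\<bar>f t * m t - p t * m t\<bar> = \<bar>f t - p t\<bar> * \<bar>m t\<bar>"
            by (simp flip: abs_mult left_diff_distrib)
          also have "\<dots> \<le> e / (A + 1) * \<bar>m t\<bar>"
            using p(2)[OF elim] by (intro mult_right_mono) auto
          finally show ?case .
        qed
      qed (use m in auto)
      also have "\<dots> = e / (A + 1) * A" by (simp add: A_def)
      also have "\<dots> \<le> e" using \<open>e > 0\<close> \<open>A \<ge> 0\<close> by (simp add: field_simps)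
      finally show ?thesis by simp
    qed
    then have "\<bar>\<integral>t. f t * m t \<partial>timeM T\<bar> \<le> 0" by (rule field_le_epsilon)
    then show ?thesis by simp
  qed
  obtain h where h: "\<And>n::nat. continuous_on UNIV (h n)" "AE x in lborel. (\<lambda>n. h n x) \<longlonglongrightarrow> sgn (m x)"
    using continuous_AE_approx[of "\<lambda>x. sgn (m x)"] by auto
  have [measurable]: "h n \<in> borel_measurable borel" for n
    using h(1) by (rule borel_measurable_continuous_onI)
  have "(\<lambda>n. \<integral>t. clip 1 (h n t) * m t \<partial>timeM T) \<longlonglongrightarrow> (\<integral>t. \<bar>m t\<bar> \<partial>timeM T)"
  proof (rule integral_dominated_convergence[where w="\<lambda>t. \<bar>m t\<bar>"])
    show "AE t in timeM T. (\<lambda>n. clip 1 (h n t) * m t) \<longlonglongrightarrow> \<bar>m t\<bar>"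
      using timeM_ac[OF h(2)]
    proof eventually_elim
      case (elim t)
      have "(\<lambda>n. clip 1 (h n t) * m t) \<longlonglongrightarrow> clip 1 (sgn (m t)) * m t"
        by (intro tendsto_intros clip_tendsto elim)
      moreover have "clip 1 (sgn (m t)) * m t = \<bar>m t\<bar>"
        by (simp add: clip_id abs_sgn_eq abs_sgn mult.commute)
      ultimately show ?case by simp
    qed
    show "AE t in timeM T. norm (clip 1 (h n t) * m t) \<le> \<bar>m t\<bar>" for n
      using clip_bound[of 1] by (intro AE_I2) (auto simp: abs_mult intro!: mult_left_le_one_le)
  qed (use m in auto)
  moreover have "(\<integral>t. clip 1 (h n t) * m t \<partial>timeM T) = 0" for n
    by (rule cont) (rule continuous_on_compose2[OF clip_cont h(1)], auto)
  ultimately have "(\<integral>t. \<bar>m t\<bar> \<partial>timeM T) = 0" by (simp add: LIMSEQ_const_iff)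
  then have "AE t in timeM T. \<bar>m t\<bar> = 0"
    using m by (subst (asm) integral_nonneg_eq_0_iff_AE) auto
  then show ?thesis by (auto elim!: eventually_mono)
qed

section \<open>Primitives of integrable functions of time\<close>

definition primitive :: "real \<Rightarrow> (real \<Rightarrow> real) \<Rightarrow> real \<Rightarrow> real" where
  "primitive T G t = (\<integral>s. (if s \<le> t then G s else 0) \<partial>timeM T)"

lemma integrable_if_le:
  assumes "integrable (timeM T) (G :: real \<Rightarrow> real)"
  shows "integrable (timeM T) (\<lambda>s. if s \<le> t then G s else 0)"
proof (rule Bochner_Integration.integrable_bound[OF assms])
  have [measurable]: "G \<in> borel_measurable borel" using assms by auto
  show "(\<lambda>s. if s \<le> t then G s else 0) \<in> borel_measurable (timeM T)" by measurable
qed auto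

lemma primitive_borel [measurable]:
  assumes [measurable]: "G \<in> borel_measurable borel"
  shows "primitive T G \<in> borel_measurable borel"
  unfolding primitive_def[abs_def] by measurable

text \<open>The measure \<open>timeM T\<close> lives on \<open>{0..T}\<close>, and the single point
  that remains at \<open>t = 0\<close> is null.\<close>

lemma primitive_nonpos:
  assumes "t \<le> 0" shows "primitive T G t = 0"
proof -
  have "AE s in timeM T. s \<noteq> 0" by (rule timeM_ac) (rule AE_lborel_singleton)
  then have "AE s in timeM T. (if s \<le> t then G s else 0) = 0"
    using AE_timeM_Icc by eventually_elim (use assms in auto)
  then show ?thesis unfolding primitive_def by (rule integral_eq_zero_AE)
qed

lemma primitive_diff:
  assumes "integrable (timeM T) G" "a \<le> b"
  shows "primitive T G b - primitive T G a = (\<integral>s. (if a < s \<and> s \<le> b then G s else 0) \<partial>timeM T)"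
proof -
  have "primitive T G b - primitive T G a = (\<integral>s. (if s \<le> b then G s else 0) - (if s \<le> a then G s else 0) \<partial>timeM T)"
    unfolding primitive_def by (rule Bochner_Integration.integral_diff[symmetric]) (rule integrable_if_le[OF assms(1)])+
  also have "\<dots> = (\<integral>s. (if a < s \<and> s \<le> b then G s else 0) \<partial>timeM T)"
    by (rule Bochner_Integration.integral_cong) (use assms in auto)
  finally show ?thesis .
qed

lemma primitive_continuous:
  assumes G: "integrable (timeM T) G" shows "continuous_on S (primitive T G)"
proof -
  have [measurable]: "G \<in> borel_measurable borel" using G by auto
  have "isCont (primitive T G) t" for t
    unfolding continuous_at_sequentially comp_def
  proof (intro allI impI)
    fix X :: "nat \<Rightarrow> real" assume X: "X \<longlonglongrightarrow> t"
    show "(\<lambda>n. primitive T G (X n)) \<longlonglongrightarrow> primitive T G t"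
      unfolding primitive_def
    proof (rule integral_dominated_convergence[where w="\<lambda>s. \<bar>G s\<bar>"])
      have "AE s in timeM T. s \<noteq> t" by (rule timeM_ac) (rule AE_lborel_singleton)
      then show "AE s in timeM T. (\<lambda>n. if s \<le> X n then G s else 0) \<longlonglongrightarrow> (if s \<le> t then G s else 0)"
      proof eventually_elim
        case (elim s)
        show ?case
        proof (cases "s < t")
          case True
          then have "eventually (\<lambda>n. s < X n) sequentially" by (rule order_tendstoD(1)[OF X])
          then show ?thesis using True by (intro tendsto_eventually, elim eventually_mono) simp
        next
          case False
          then have "t < s" using elim by simp
          then have "eventually (\<lambda>n. X n < s) sequentially" by (rule order_tendstoD(2)[OF X])
          then show ?thesis using \<open>t < s\<close> by (intro tendsto_eventually, elim eventually_mono) simp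
        qed
      qed
    qed (use G in auto)
  qed
  then show ?thesis by (simp add: continuous_at_imp_continuous_on)
qed

text \<open>Integration by parts in time, obtained from Fubini on the triangle
  \<open>s <= t\<close>, because \<open>G\<close> is merely integrable and its primitive may fail to
  be differentiable at some times.\<close>

lemma integral_mult_primitive:
  fixes H H' G :: "real \<Rightarrow> real"
  assumes G: "integrable (timeM T) G" and H: "\<And>t. (H has_real_derivative H' t) (at t)" "continuous_on UNIV H'"
    and B: "\<And>t. t \<in> {0..T} \<Longrightarrow> \<bar>H' t\<bar> \<le> B"
  shows "(\<integral>t. H' t * primitive T G t \<partial>timeM T) = (\<integral>s. (H T - H s) * G s \<partial>timeM T)"
proof -
  have [measurable]: "H' \<in> borel_measurable borel" "G \<in> borel_measurable borel"
    using H(2) G by (auto intro: borel_measurable_continuous_onI)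
  have Hc: "continuous_on UNIV H" by (meson H(1) DERIV_isCont continuous_at_imp_continuous_on)
  have [measurable]: "H \<in> borel_measurable borel" using Hc by (rule borel_measurable_continuous_onI)
  have "(\<integral>t. H' t * primitive T G t \<partial>timeM T) = (\<integral>t. (\<integral>s. H' t * (if s \<le> t then G s else 0) \<partial>timeM T) \<partial>timeM T)"
    by (simp only: primitive_def integral_mult_right_zero)
  also have "\<dots> = (\<integral>s. (\<integral>t. H' t * (if s \<le> t then G s else 0) \<partial>timeM T) \<partial>timeM T)"
  proof (rule time2.Fubini_integral[symmetric])
    show "integrable (timeM T \<Otimes>\<^sub>M timeM T) (\<lambda>(t, s). H' t * (if s \<le> t then G s else 0))"
    proof (rule Bochner_Integration.integrable_bound[where f="\<lambda>(t, s). B * G s"])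
      show "integrable (timeM T \<Otimes>\<^sub>M timeM T) (\<lambda>(t, s). B * G s)"
        using G by (intro time2.Fubini_integrable) auto
      have "AE t in timeM T. AE s in timeM T. t \<in> {0..T}" using AE_timeM_Icc
        by (rule eventually_mono) simp
      then have "AE p in timeM T \<Otimes>\<^sub>M timeM T. fst p \<in> {0..T}"
        by (intro time2.AE_pair_measure[rotated]) (simp, measurable)
      then show "AE p in timeM T \<Otimes>\<^sub>M timeM T. norm (case p of (t, s) \<Rightarrow> H' t * (if s \<le> t then G s else 0))
          \<le> norm (case p of (t, s) \<Rightarrow> B * G s)"
      proof eventually_elim
        case (elim p)
        obtain t s where p: "p = (t, s)" by force
        show ?case using B[of t] elim unfolding p by (auto simp: abs_mult intro!: mult_right_mono)
      qed
    qed measurable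
  qed
  also have "\<dots> = (\<integral>s. (H T - H s) * G s \<partial>timeM T)"
  proof (rule integral_cong_AE)
    show "AE s in timeM T. (\<integral>t. H' t * (if s \<le> t then G s else 0) \<partial>timeM T) = (H T - H s) * G s"
      using AE_timeM_Icc
    proof eventually_elim
      case (elim s)
      have "(\<integral>t. H' t * (if s \<le> t then G s else 0) \<partial>timeM T)
        = (\<integral>t. indicator {0..T} t * (H' t * (if s \<le> t then G s else 0)) \<partial>lborel)"
        by (rule integral_timeM) measurable
      also have "\<dots> = (\<integral>t. (H' t * indicator {s..T} t) * G s \<partial>lborel)"
        by (rule Bochner_Integration.integral_cong) (use elim in \<open>auto simp: indicator_def\<close>)
      also have "\<dots> = (\<integral>t. H' t * indicator {s..T} t \<partial>lborel) * G s"
        by (rule integral_mult_left_zero)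
      also have "(\<integral>t. H' t * indicator {s..T} t \<partial>lborel) = H T - H s"
        by (rule integral_FTC_Icc_real) (use elim H in \<open>auto simp: continuous_on_eq_continuous_at\<close>)
      finally show ?case .
    qed
  qed measurable
  finally show ?thesis .
qed

lemma primitive_integrable:
  assumes G: "integrable (timeM T) G" shows "integrable (timeM T) (primitive T G)"
proof (rule timeM.integrable_const_bound[where B="\<integral>s. \<bar>G s\<bar> \<partial>timeM T"])
  have "\<bar>primitive T G t\<bar> \<le> (\<integral>s. \<bar>if s \<le> t then G s else 0\<bar> \<partial>timeM T)" for t
    unfolding primitive_def by (rule integral_abs_bound)
  also have "\<dots> t \<le> (\<integral>s. \<bar>G s\<bar> \<partial>timeM T)" for t
    using integrable_if_le[OF G, of t] G by (intro integral_mono) auto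
  finally show "AE t in timeM T. norm (primitive T G t) \<le> (\<integral>s. \<bar>G s\<bar> \<partial>timeM T)" by simp
  have [measurable]: "G \<in> borel_measurable borel" using G by auto
  show "primitive T G \<in> borel_measurable (timeM T)" by measurable
qed

lemma primitive_integral:
  assumes h: "integrable (timeM T) h"
  shows "(\<integral>t. primitive T h t \<partial>timeM T) = (\<integral>s. (T - s) * h s \<partial>timeM T)"
  using integral_mult_primitive[OF h, of "\<lambda>t. t" "\<lambda>_. 1" 1] by simp

text \<open>The assumption \<open>weak\<close> is an evolution equation tested with powers of time,
  its terminal term being expressed by the total integral of \<open>G\<close>. By
  \<open>integral_mult_primitive\<close> the primitive of \<open>G\<close> satisfies it too, so all
  moments of the difference vanish.\<close>

lemma weak_primitive:
  assumes m: "integrable (timeM T) m" and G: "integrable (timeM T) G"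
    and weak: "\<And>n. (\<integral>t. real (Suc n) * t ^ n * m t \<partial>timeM T) = (\<integral>t. (T ^ Suc n - t ^ Suc n) * G t \<partial>timeM T)"
  shows "AE t in timeM T. m t = primitive T G t"
proof -
  note pi = primitive_integrable[OF G]
  have "AE t in timeM T. m t - primitive T G t = 0"
  proof (rule moments_zero)
    show "integrable (timeM T) (\<lambda>t. m t - primitive T G t)" using m pi by simp
    fix n
    have "(\<integral>t. real (Suc n) * t ^ n * primitive T G t \<partial>timeM T) = (\<integral>t. (T ^ Suc n - t ^ Suc n) * G t \<partial>timeM T)"
    proof (rule integral_mult_primitive[OF G])
      show "((\<lambda>t. t ^ Suc n) has_real_derivative real (Suc n) * t ^ n) (at t)" for t
        using DERIV_pow[of "Suc n"] by simp
      show "\<bar>real (Suc n) * t ^ n\<bar> \<le> real (Suc n) * T ^ n" if "t \<in> {0..T}" for t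
        unfolding abs_mult using power_abs_le[OF that] by (intro mult_mono) auto
    qed (intro continuous_intros)
    also have "\<dots> = (\<integral>t. real (Suc n) * t ^ n * m t \<partial>timeM T)" by (rule weak[symmetric])
    finally have "real (Suc n) * (\<integral>t. t ^ n * primitive T G t \<partial>timeM T) = real (Suc n) * (\<integral>t. t ^ n * m t \<partial>timeM T)"
      by (simp only: mult.assoc integral_mult_right_zero)
    then have "(\<integral>t. t ^ n * primitive T G t \<partial>timeM T) = (\<integral>t. t ^ n * m t \<partial>timeM T)" by simp
    then show "(\<integral>t. t ^ n * (m t - primitive T G t) \<partial>timeM T) = 0"
      using timeM_integrable_power[OF m, of n] timeM_integrable_power[OF pi, of n] by (simp add: right_diff_distrib)
  qed
  then show ?thesis by (auto elim!: eventually_mono)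
qed

text \<open>By convexity, \<open>f(W b) - f(W a) \<le> f'(W b) (W b - W a)\<close>; summing over a fine partition yields one
  half of the chain rule without differentiating the primitive W.\<close>
lemma primitive_convex_chain:
  fixes f f' :: "real \<Rightarrow> real"
  assumes G: "integrable (timeM T) G" and f': "continuous_on UNIV f'" "\<And>r. \<bar>f' r\<bar> \<le> B"
    and conv: "\<And>a b. f b - f a \<le> f' b * (b - a)" and t: "0 \<le> t" "t \<le> T"
  shows "f (primitive T G t) - f 0 \<le> primitive T (\<lambda>s. f' (primitive T G s) * G s) t"
proof -
  have [measurable]: "G \<in> borel_measurable borel" "f' \<in> borel_measurable borel"
    using G f'(1) by (auto intro: borel_measurable_continuous_onI)
  define W where "W = primitive T G"
  have [measurable]: "W \<in> borel_measurable borel" unfolding W_def by measurable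
  have fG: "integrable (timeM T) (\<lambda>s. f' (W s) * G s)"
    by (rule timeM_integrable_mult_bounded[OF G _ f'(2)]) measurable
  define A where "A = (\<integral>s. \<bar>G s\<bar> \<partial>timeM T)"
  have A: "A \<ge> 0" unfolding A_def by simp
  have "f (W t) - f 0 \<le> primitive T (\<lambda>s. f' (W s) * G s) t + e" if "e > 0" for e
  proof -
    \<comment> \<open>The oscillation of \<open>f'\<close> along the primitive that is allowed on
      one partition interval; it costs at most \<open>d * A\<close> in total.\<close>
    define d where "d = e / (A + 1)"
    have d: "d > 0" "d * A \<le> e" using \<open>e > 0\<close> A by (auto simp: d_def field_simps)
    have "uniformly_continuous_on {0..T} (\<lambda>s. f' (W s))"
      unfolding W_def
      by (intro compact_uniformly_continuous continuous_on_compose2[OF f'(1)] primitive_continuous G) auto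
    then obtain r where r: "r > 0" "\<And>x y. x \<in> {0..T} \<Longrightarrow> y \<in> {0..T} \<Longrightarrow> dist y x < r \<Longrightarrow> dist (f' (W y)) (f' (W x)) < d"
      unfolding uniformly_continuous_on_def using d(1) by metis
    \<comment> \<open>The second summand pays for freezing \<open>f'\<close> at the right endpoint
      of a partition interval.\<close>
    define g where "g s = f' (W s) * G s + d * \<bar>G s\<bar>" for s
    have g: "integrable (timeM T) g" unfolding g_def using fG G by auto
    have step: "f (W b) - f (W a) \<le> primitive T g b - primitive T g a" if ab: "0 \<le> a" "a \<le> b" "b \<le> T" "b - a < r" for a b
    proof -
      have "f (W b) - f (W a) \<le> f' (W b) * (W b - W a)" by (rule conv)
      also have "\<dots> = (\<integral>s. f' (W b) * (if a < s \<and> s \<le> b then G s else 0) \<partial>timeM T)"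
        using primitive_diff[OF G ab(2)] by (simp add: W_def)
      also have "\<dots> \<le> (\<integral>s. (if a < s \<and> s \<le> b then g s else 0) \<partial>timeM T)"
      proof (rule integral_mono)
        have i: "integrable (timeM T) (\<lambda>s. if a < s \<and> s \<le> b then h s else 0)" if "integrable (timeM T) h" for h :: "real \<Rightarrow> real"
        proof (rule Bochner_Integration.integrable_bound[OF that])
          have [measurable]: "h \<in> borel_measurable borel" using that by auto
          show "(\<lambda>s. if a < s \<and> s \<le> b then h s else 0) \<in> borel_measurable (timeM T)" by measurable
        qed auto
        show "integrable (timeM T) (\<lambda>s. f' (W b) * (if a < s \<and> s \<le> b then G s else 0))"
          "integrable (timeM T) (\<lambda>s. if a < s \<and> s \<le> b then g s else 0)"
          using i[OF G] i[OF g] by auto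
        fix s
        show "f' (W b) * (if a < s \<and> s \<le> b then G s else 0) \<le> (if a < s \<and> s \<le> b then g s else 0)"
        proof (cases "a < s \<and> s \<le> b")
          case True
          then have "\<bar>f' (W b) - f' (W s)\<bar> \<le> d"
            using r(2)[of s b] ab by (simp add: dist_real_def less_imp_le)
          then have "\<bar>f' (W b) - f' (W s)\<bar> * \<bar>G s\<bar> \<le> d * \<bar>G s\<bar>" by (rule mult_right_mono) simp
          then have "(f' (W b) - f' (W s)) * G s \<le> d * \<bar>G s\<bar>"
            unfolding abs_mult[symmetric] by linarith
          then show ?thesis using True by (simp add: g_def algebra_simps)
        qed auto
      qed
      also have "\<dots> = primitive T g b - primitive T g a" using primitive_diff[OF g ab(2)] by simp
      finally show ?thesis .
    qed
    \<comment> \<open>Makes the mesh \<open>t / n\<close> of the equidistant partition smaller than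
      \<open>r\<close>.\<close>
    obtain n :: nat where n: "T / r < n" using reals_Archimedean2 by blast
    have n0: "0 < n"
    proof -
      have "0 \<le> T / r" using t r(1) by simp
      then show ?thesis using n by linarith
    qed
    have tn: "t / n < r"
    proof -
      have "T < n * r" using n r(1) by (simp add: field_simps)
      then have "t < n * r" using t by simp
      then show ?thesis using n0 by (simp add: field_simps)
    qed
    have "f (W (t * k / n)) - f (W 0) \<le> primitive T g (t * k / n) - primitive T g 0" if "k \<le> n" for k :: nat
      using that
    proof (induction k)
      case (Suc k)
      have "f (W (t * Suc k / n)) - f (W (t * k / n)) \<le> primitive T g (t * Suc k / n) - primitive T g (t * k / n)"
      proof (rule step)
        show "0 \<le> t * k / n" using t by simp
        show "t * k / n \<le> t * Suc k / n" using t by (simp add: divide_right_mono mult_left_mono)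
        have "t * Suc k / n \<le> t * n / n"
          using t Suc.prems by (intro divide_right_mono mult_left_mono) auto
        then show "t * Suc k / n \<le> T" using n0 t by simp
        show "t * Suc k / n - t * k / n < r" using tn by (simp add: field_simps flip: diff_divide_distrib)
      qed
      then show ?case using Suc by simp
    qed simp
    from this[of n] have "f (W t) - f 0 \<le> primitive T g t" using n0 by (simp add: W_def primitive_nonpos)
    also have "primitive T g t = primitive T (\<lambda>s. f' (W s) * G s) t + primitive T (\<lambda>s. d * \<bar>G s\<bar>) t"
      unfolding primitive_def
      by (subst Bochner_Integration.integral_add[symmetric])
        (auto intro!: integrable_if_le fG integrable_mult_right integrable_abs G Bochner_Integration.integral_cong simp: g_def)
    also have "primitive T (\<lambda>s. d * \<bar>G s\<bar>) t \<le> (\<integral>s. d * \<bar>G s\<bar> \<partial>timeM T)"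
      unfolding primitive_def
      by (intro integral_mono integrable_if_le integrable_mult_right integrable_abs G) (use d in auto)
    also have "\<dots> = d * A" by (simp add: A_def)
    finally show ?thesis using d(2) by linarith
  qed
  then show ?thesis unfolding W_def by (rule field_le_epsilon)
qed

section \<open>Functions on space-time\<close>

interpretation cyl: pair_sigma_finite "timeM T" "cubeM :: (real^'d) measure" for T ..

abbreviation cylM :: "real \<Rightarrow> (real \<times> (real^'d)) measure" where
  "cylM T \<equiv> timeM T \<Otimes>\<^sub>M cubeM"

lemma sets_cylM [measurable_cong, simp]: "sets (cylM T) = sets borel"
proof -
  have "sets (cylM T) = sets (borel \<Otimes>\<^sub>M borel)"
    by (rule sets_pair_measure_cong[OF sets_timeM sets_cubeM])
  then show ?thesis unfolding borel_prod .
qed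

lemma space_cylM [simp]: "space (cylM T) = UNIV"
  by (simp add: space_pair_measure)

lemma borel_measurable_cylM: "borel_measurable (cylM T) = borel_measurable borel"
  by (rule measurable_cong_sets[OF sets_cylM refl])

lemma fst_borel [measurable]: "(fst :: real \<times> (real^'d) \<Rightarrow> real) \<in> borel_measurable borel"
  by (intro borel_measurable_continuous_onI continuous_intros)

lemma snd_borel [measurable]: "(snd :: real \<times> (real^'d) \<Rightarrow> real^'d) \<in> borel_measurable borel"
  by (intro borel_measurable_continuous_onI continuous_intros)

lemma Omega_borel [measurable]: "Omega T \<in> sets borel"
  unfolding Omega_def cube_def by (intro borel_closed closed_Times) auto

text \<open>The bridge between the set integrals over \<open>Omega T\<close> in the definition of a
  weak solution and the product measure, to which Fubini applies.\<close>

lemma cylM_eq: "(cylM T :: (real \<times> (real^'d)) measure) = density lborel (indicator (Omega T))"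
proof -
  have "(cylM T :: (real \<times> (real^'d)) measure) = density (lborel \<Otimes>\<^sub>M lborel) (\<lambda>(x, y). indicator {0..T} x * indicator cube y)"
    unfolding timeM_def cubeM_def
  proof (rule pair_measure_density)
    show "sigma_finite_measure (density lborel (indicator (cube :: (real^'d) set)))"
      using cubeM.sigma_finite_measure_axioms unfolding cubeM_def .
  qed (auto intro: sigma_finite_lborel)
  also have "(\<lambda>(x, y). indicator {0..T} x * indicator cube y) = (indicator (Omega T) :: _ \<Rightarrow> ennreal)"
    by (auto simp: Omega_def indicator_def fun_eq_iff)
  finally show ?thesis by (simp add: lborel_prod)
qed

interpretation cylM: finite_measure "cylM T :: (real \<times> (real^'d)) measure" for T
  by (rule finite_measure_pair_measure) unfold_locales

lemma AE_cylM: "(AE p in cylM T. Q p) \<longleftrightarrow> (AE p in lborel. p \<in> Omega T \<longrightarrow> Q p)"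
  unfolding cylM_eq by (subst AE_density) (auto simp: indicator_def split: if_splits)

lemma integral_cylM:
  fixes f :: "real \<times> (real^'d) \<Rightarrow> real"
  assumes [measurable]: "f \<in> borel_measurable borel"
  shows "(LINT p:Omega T|lborel. f p) = integral\<^sup>L (cylM T) f"
  unfolding cylM_eq set_lebesgue_integral_def using integral_density[of f lborel "indicator (Omega T)"]
  by (simp add: ennreal_indicator)

lemma integrable_cylM:
  fixes f :: "real \<times> (real^'d) \<Rightarrow> real"
  assumes [measurable]: "f \<in> borel_measurable borel"
  shows "set_integrable lborel (Omega T) f \<longleftrightarrow> integrable (cylM T) f"
  unfolding cylM_eq set_integrable_def using integrable_density[of f lborel "indicator (Omega T)"]
  by (simp add: ennreal_indicator)

lemma AE_cylM_fst: "AE p in cylM T. fst p \<in> {0..T}"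
  unfolding AE_cylM by (auto simp: Omega_def)

lemma AE_cylM_I:
  assumes "AE t in timeM T. AE x in cubeM. Q (t, x)" "Measurable.pred borel Q"
  shows "AE p in cylM T. Q p"
proof (rule cyl.AE_pair_measure[OF _ assms(1)])
  show "{p \<in> space (cylM T). Q p} \<in> sets (cylM T)"
    using assms(2) unfolding pred_def sets_cylM space_cylM by simp
qed

lemma cylM_integrable_mult_bounded:
  fixes h f :: "real \<times> (real^'d) \<Rightarrow> real"
  assumes "integrable (cylM T) h" "f \<in> borel_measurable borel" "\<And>p. fst p \<in> {0..T} \<Longrightarrow> \<bar>f p\<bar> \<le> B"
  shows "integrable (cylM T) (\<lambda>p. f p * h p)"
proof (rule integrable_bounded_mult[OF assms(1)])
  show "AE p in cylM T. \<bar>f p\<bar> \<le> B" using AE_cylM_fst by eventually_elim (rule assms(3))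
qed (use assms(2) in \<open>simp add: borel_measurable_cylM\<close>)

section \<open>Time slices and weak gradients\<close>

lemma slice_borel [measurable]:
  assumes [measurable]: "h \<in> borel_measurable (borel :: (real \<times> (real^'d)) measure)"
  shows "(\<lambda>y. h (t, y)) \<in> borel_measurable borel"
  by measurable

lemma cylM_integrable_power:
  fixes h :: "real \<times> (real^'d) \<Rightarrow> real"
  assumes "integrable (cylM T) h"
  shows "integrable (cylM T) (\<lambda>p. fst p ^ n * h p)"
  by (rule cylM_integrable_mult_bounded[OF assms _ power_abs_le]) measurable

lemma slice_moment:
  fixes h :: "real \<times> (real^'d) \<Rightarrow> real"
  assumes "integrable (cylM T) h"
  shows "(\<integral>p. fst p ^ n * h p \<partial>cylM T) = (\<integral>t. t ^ n * (\<integral>y. h (t, y) \<partial>cubeM) \<partial>timeM T)"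
  using cyl.integral_fst'[OF cylM_integrable_power[OF assms, of n]] by simp

lemma slice_zero:
  fixes h :: "real \<times> (real^'d) \<Rightarrow> real"
  assumes h: "integrable (cylM T) h" and mom: "\<And>n. (\<integral>p. fst p ^ n * h p \<partial>cylM T) = 0"
  shows "AE t in timeM T. (\<integral>y. h (t, y) \<partial>cubeM) = 0"
  by (rule moments_zero[OF cyl.integrable_fst'[OF h]]) (use mom in \<open>simp add: slice_moment[OF h]\<close>)

lemma kernel_integrable_cylM:
  fixes v :: "real \<times> (real^'d) \<Rightarrow> real"
  assumes K: "torus_fun K" and v: "integrable (cylM T) v"
  shows "integrable (cylM T) (\<lambda>p. K (x - snd p) * v p)"
proof -
  obtain L where L: "L > 0" "\<And>x. \<bar>K x\<bar> \<le> L" using torus_fun_bounded[OF K] by blast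
  have [measurable]: "K \<in> borel_measurable borel" using K by (rule torus_fun_borel)
  show ?thesis by (rule cylM_integrable_mult_bounded[OF v _ L(2)]) measurable
qed

text \<open>The gradient identity tested with the field \<open>fst p ^ n * K (x - snd p)\<close> in
  direction \<open>i\<close>. No minus sign appears: the one from integration by parts cancels
  against the one from differentiating \<open>K (x - y)\<close> in \<open>y\<close>.\<close>

definition weak_grad :: "real \<Rightarrow> (real \<times> (real^'d) \<Rightarrow> real) \<Rightarrow> 'd \<Rightarrow> (real \<times> (real^'d) \<Rightarrow> real) \<Rightarrow> bool" where
  "weak_grad T u i g \<longleftrightarrow> (\<forall>K n x. torus_fun K \<longrightarrow>
     (\<integral>p. fst p ^ n * (pdx K i (x - snd p) * u p) \<partial>cylM T) = (\<integral>p. fst p ^ n * (K (x - snd p) * g p) \<partial>cylM T))"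

text \<open>For a single \<open>x\<close>, the moments in time give the identity for almost every
  \<open>t\<close>. The exceptional set depends on \<open>x\<close>, so a countable dense set of
  points is treated first; both convolutions are continuous in \<open>x\<close>, which extends the
  identity to all points at once.\<close>

lemma weak_grad_slice:
  fixes u g :: "real \<times> (real^'d) \<Rightarrow> real"
  assumes wg: "weak_grad T u i g" and u: "integrable (cylM T) u" and g: "integrable (cylM T) g"
    and K: "torus_fun K"
  shows "AE t in timeM T. \<forall>x. conv (pdx K i) (\<lambda>y. u (t, y)) x = conv K (\<lambda>y. g (t, y)) x"
proof -
  obtain D :: "(real^'d) set" where D: "countable D" "UNIV \<subseteq> closure D"
    using separable[of "UNIV :: (real^'d) set"] by metis
  have "AE t in timeM T. \<forall>x\<in>D. conv (pdx K i) (\<lambda>y. u (t, y)) x = conv K (\<lambda>y. g (t, y)) x"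
    unfolding AE_ball_countable[OF D(1)]
  proof
    fix x
    note i1 = kernel_integrable_cylM[OF torus_fun_pdx[OF K, of i] u, of x] and i2 = kernel_integrable_cylM[OF K g, of x]
    have "AE t in timeM T. (\<integral>y. pdx K i (x - snd (t, y)) * u (t, y) - K (x - snd (t, y)) * g (t, y) \<partial>cubeM) = 0"
    proof (rule slice_zero)
      show "integrable (cylM T) (\<lambda>p. pdx K i (x - snd p) * u p - K (x - snd p) * g p)" using i1 i2 by simp
      fix n
      show "(\<integral>p. fst p ^ n * (pdx K i (x - snd p) * u p - K (x - snd p) * g p) \<partial>cylM T) = 0"
        using wg K cylM_integrable_power[OF i1, of n] cylM_integrable_power[OF i2, of n]
        by (simp add: weak_grad_def right_diff_distrib)
    qed
    moreover have "AE t in timeM T. integrable cubeM (\<lambda>y. pdx K i (x - y) * u (t, y))"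
      using cyl.AE_integrable_fst'[OF i1] by simp
    moreover have "AE t in timeM T. integrable cubeM (\<lambda>y. K (x - y) * g (t, y))"
      using cyl.AE_integrable_fst'[OF i2] by simp
    ultimately show "AE t in timeM T. conv (pdx K i) (\<lambda>y. u (t, y)) x = conv K (\<lambda>y. g (t, y)) x"
      by eventually_elim (simp add: conv_def)
  qed
  moreover note cyl.AE_integrable_fst'[OF u] cyl.AE_integrable_fst'[OF g]
  ultimately show ?thesis
  proof eventually_elim
    case (elim t)
    have c: "continuous_on UNIV (\<lambda>x. conv (pdx K i) (\<lambda>y. u (t, y)) x - conv K (\<lambda>y. g (t, y)) x)"
      by (intro continuous_on_diff conv_continuous torus_fun_pdx K elim)
    have "conv (pdx K i) (\<lambda>y. u (t, y)) x - conv K (\<lambda>y. g (t, y)) x = 0" for x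
      by (rule continuous_constant_on_closure[OF continuous_on_subset[OF c subset_UNIV, of "closure D"]]) (use D elim in auto)
    then show ?case by simp
  qed
qed

text \<open>The function \<open>f (conv K v x) * b x\<close> is periodic and differentiable along
  the axis, so its derivative integrates to 0. The assumption \<open>wd\<close> identifies the
  derivative of the mollified \<open>v\<close> with the mollified \<open>a\<close>; thus
  \<open>v\<close> itself is never differentiated.\<close>

lemma chain_integration_by_parts:
  fixes v a b b' :: "real^'d \<Rightarrow> real"
  assumes K: "torus_fun K" and v: "integrable cubeM v" and a: "integrable cubeM a"
    and wd: "\<And>x. conv (pdx K i) v x = conv K a x"
    and f: "\<And>r. (f has_real_derivative f' r) (at r)" "continuous_on UNIV f'"
    and fb: "\<And>r. \<bar>f r\<bar> \<le> B" "\<And>r. \<bar>f' r\<bar> \<le> B'"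
    and bm [measurable]: "b \<in> borel_measurable borel" "b' \<in> borel_measurable borel"
    and bb: "\<And>x. \<bar>b x\<bar> \<le> M" "\<And>x. \<bar>b' x\<bar> \<le> M'" and bp: "periodic b"
    and bd: "\<And>x s. ((\<lambda>s. b (x + s *\<^sub>R axis i 1)) has_real_derivative b' (x + s *\<^sub>R axis i 1)) (at s)"
  shows "(\<integral>x. f (conv K v x) * b' x \<partial>cubeM) = - (\<integral>x. f' (conv K v x) * (conv K a x * b x) \<partial>cubeM)"
proof -
  have fc: "continuous_on UNIV f" by (meson f(1) DERIV_isCont continuous_at_imp_continuous_on)
  have [measurable]: "f \<in> borel_measurable borel" "f' \<in> borel_measurable borel"
    using fc f(2) by (auto intro: borel_measurable_continuous_onI)
  have [measurable]: "v \<in> borel_measurable borel" "a \<in> borel_measurable borel" "K \<in> borel_measurable borel"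
    using v a torus_fun_borel[OF K] by auto
  obtain L where L: "L > 0" "\<And>x. \<bar>K x\<bar> \<le> L" using torus_fun_bounded[OF K] by blast
  define A where "A = L * (\<integral>y. \<bar>a y\<bar> \<partial>cubeM)"
  have ba: "\<bar>conv K a x\<bar> \<le> A" for x unfolding A_def by (rule conv_bound[OF K L(2) a])
  have B0: "0 \<le> B" "0 \<le> B'" "0 \<le> A" "0 \<le> M"
    using fb[of 0] ba[of 0] bb(1)[of 0] by linarith+
  have b1: "\<bar>f (conv K v x) * b' x\<bar> \<le> B * M'" for x
    unfolding abs_mult using fb bb B0 by (intro mult_mono) auto
  have b2: "\<bar>f' (conv K v x) * (conv K a x * b x)\<bar> \<le> B' * (A * M)" for x
    unfolding abs_mult using fb ba bb B0 by (intro mult_mono) auto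
  have "(\<integral>x. f' (conv K v x) * (conv K a x * b x) + f (conv K v x) * b' x \<partial>cubeM) = 0"
  proof (rule integral_cubeM_deriv_0[where H="\<lambda>x. f (conv K v x) * b x" and i=i])
    show "\<bar>f (conv K v x) * b x\<bar> \<le> B * M" for x
      unfolding abs_mult using fb bb B0 by (intro mult_mono) auto
    show "\<bar>f' (conv K v x) * (conv K a x * b x) + f (conv K v x) * b' x\<bar> \<le> B' * (A * M) + B * M'" for x
      using b1[of x] b2[of x] by linarith
    show "periodic (\<lambda>x. f (conv K v x) * b x)"
      using bp by (simp add: periodic_def conv_periodic[OF K])
    fix x s
    have "((\<lambda>s. f (conv K v (x + s *\<^sub>R axis i 1))) has_real_derivative
        f' (conv K v (x + s *\<^sub>R axis i 1)) * conv K a (x + s *\<^sub>R axis i 1)) (at s)"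
      using DERIV_chain2[OF f(1) conv_DERIV[OF K v, of x i s]] by (simp add: wd)
    from DERIV_mult[OF this bd[of x s]]
    show "((\<lambda>s. f (conv K v (x + s *\<^sub>R axis i 1)) * b (x + s *\<^sub>R axis i 1)) has_real_derivative
      f' (conv K v (x + s *\<^sub>R axis i 1)) * (conv K a (x + s *\<^sub>R axis i 1) * b (x + s *\<^sub>R axis i 1))
       + f (conv K v (x + s *\<^sub>R axis i 1)) * b' (x + s *\<^sub>R axis i 1)) (at s)"
      by (simp add: algebra_simps)
  qed measurable
  moreover have "integrable cubeM (\<lambda>x. f (conv K v x) * b' x)"
    by (rule continuous_bounded_integrable_cubeM[OF _ b1]) measurable
  moreover have "integrable cubeM (\<lambda>x. f' (conv K v x) * (conv K a x * b x))"
    by (rule continuous_bounded_integrable_cubeM[OF _ b2]) measurable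
  ultimately show ?thesis by simp
qed

text \<open>The case in which the second factor is a mollified function too. It moves the derivative
  from a mollified flux onto the nonlinear factor.\<close>

lemma conv_integration_by_parts:
  fixes v a b :: "real^'d \<Rightarrow> real"
  assumes K: "torus_fun K" and v: "integrable cubeM v" and a: "integrable cubeM a" and b: "integrable cubeM b"
    and wd: "\<And>x. conv (pdx K i) v x = conv K a x"
    and f': "\<And>r. (f' has_real_derivative f'' r) (at r)" "continuous_on UNIV f''"
    and fb: "\<And>r. \<bar>f' r\<bar> \<le> B" "\<And>r. \<bar>f'' r\<bar> \<le> B'"
  shows "(\<integral>x. f' (conv K v x) * conv (pdx K i) b x \<partial>cubeM) = - (\<integral>x. f'' (conv K v x) * (conv K a x * conv K b x) \<partial>cubeM)"
proof -
  note pdx = torus_fun_pdx[OF K, of i]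
  obtain L where L: "\<And>x. \<bar>K x\<bar> \<le> L" using torus_fun_bounded[OF K] by blast
  obtain L' where L': "\<And>x. \<bar>pdx K i x\<bar> \<le> L'" using torus_fun_bounded[OF pdx] by blast
  show ?thesis
    by (rule chain_integration_by_parts[OF K v a wd f' fb _ _ conv_bound[OF K L b] conv_bound[OF pdx L' b] _ conv_DERIV[OF K b]])
      (use b torus_fun_borel[OF K] torus_fun_borel[OF pdx] in \<open>auto simp: periodic_def conv_periodic[OF K]\<close>)
qed

text \<open>Stampacchia's theorem: test with \<epsilon> arctan ((u - c) / \<epsilon>) and let \<epsilon> tend to 0.\<close>
lemma weak_derivative_level_set:
  fixes u g :: "real^'d \<Rightarrow> real"
  assumes ub: "integrable cubeM u" and g: "integrable cubeM g"
    and wd: "\<And>N x. conv (pdx (cos_kernel N) i) u x = conv (cos_kernel N) g x"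
  shows "AE x in cubeM. u x = c \<longrightarrow> g x = 0"
proof -
  have [measurable]: "u \<in> borel_measurable borel" "g \<in> borel_measurable borel" using ub g by auto
  have q1: "\<bar>1 / (1 + a\<^sup>2)\<bar> \<le> 1" for a :: real
  proof -
    have "0 < 1 + a\<^sup>2" using zero_le_power2[of a] by linarith
    then show ?thesis by simp
  qed
  note cui = conv_integrable[OF cos_kernel_torus]
  \<comment> \<open>L1 convergence gives pointwise convergence only along a subsequence, and the
    nonlinear factors below call for the latter.\<close>
  have "\<exists>r::nat \<Rightarrow> nat. strict_mono r \<and> (AE x in cubeM. (\<lambda>n. conv (cos_kernel (r n)) u x - u x) \<longlonglongrightarrow> 0)"
    using tendsto_L1_AE_subseq[of cubeM "\<lambda>N x. conv (cos_kernel N) u x - u x"] cui[OF ub] ub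
      conv_tendsto(1)[OF gauge_abs, of u] by simp
  then obtain r :: "nat \<Rightarrow> nat" where r: "strict_mono r"
      "AE x in cubeM. (\<lambda>n. conv (cos_kernel (r n)) u x - u x) \<longlonglongrightarrow> 0" by blast
  have ulim: "AE x in cubeM. (\<lambda>n. conv (cos_kernel (r n)) u x) \<longlonglongrightarrow> u x"
    using r(2) by eventually_elim (simp add: LIM_zero_iff)
  have glim: "(\<lambda>n. \<integral>x. \<bar>conv (cos_kernel (r n)) g x - g x\<bar> \<partial>cubeM) \<longlonglongrightarrow> 0"
    using LIMSEQ_subseq_LIMSEQ[OF conv_tendsto(1)[OF gauge_abs, of g] r(1)] g by (simp add: comp_def)
  have key: "(\<integral>x. K (x0 - x) * (if u x = c then g x else 0) \<partial>cubeM) = 0" if K: "torus_fun K" for K x0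
  proof -
    obtain L where L: "L > 0" "\<And>x. \<bar>K x\<bar> \<le> L" using torus_fun_bounded[OF K] by blast
    obtain L' where L': "L' > 0" "\<And>x. \<bar>pdx K i x\<bar> \<le> L'" using torus_fun_bounded[OF torus_fun_pdx[OF K]] by blast
    have [measurable]: "K \<in> borel_measurable borel" "pdx K i \<in> borel_measurable borel"
      using K by (auto intro: torus_fun_borel torus_fun_pdx)
    \<comment> \<open>The chain rule for \<open>u\<close> itself: for every mollification it is
      \<open>chain_integration_by_parts\<close>, and it passes to the limit along
      \<open>r\<close>.\<close>
    have eps: "(\<integral>x. 1 / (1 + ((u x - c) / e)\<^sup>2) * K (x0 - x) * g x \<partial>cubeM)
      = (\<integral>x. e * arctan ((u x - c) / e) * pdx K i (x0 - x) \<partial>cubeM)" if e: "e > 0" for e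
    proof -
      define f where "f r = e * arctan ((r - c) / e)" for r
      define f' where "f' r = 1 / (1 + ((r - c) / e)\<^sup>2)" for r
      have f: "(f has_real_derivative f' r) (at r)" for r
        unfolding f_def[abs_def] f'_def using e by (auto intro!: derivative_eq_intros simp: inverse_eq_divide)
      have fc: "continuous_on UNIV f" by (meson f DERIV_isCont continuous_at_imp_continuous_on)
      have "1 + ((r - c) / e)\<^sup>2 \<noteq> 0" for r
        using zero_le_power2[of "(r - c) / e"] by linarith
      then have f'c: "continuous_on UNIV f'"
        unfolding f'_def[abs_def] using e by (intro continuous_intros) auto
      have [measurable]: "f \<in> borel_measurable borel" "f' \<in> borel_measurable borel"
        using fc f'c by (auto intro: borel_measurable_continuous_onI)
      have fb: "\<bar>f r\<bar> \<le> e * (pi / 2)" for r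
        using e arctan_bounded[of "(r - c) / e"] by (auto simp: f_def abs_mult intro!: mult_left_mono)
      have f'b: "\<bar>f' r\<bar> \<le> 1" for r
        unfolding f'_def by (rule q1)
      have per: "K (x0 - (x + axis j 1)) = K (x0 - x)" for x j
        using torus_funD(2)[OF K, of "x0 - (x + axis j 1)" j] by simp
      have der: "((\<lambda>s. K (x0 - (x + s *\<^sub>R axis i 1))) has_real_derivative - pdx K i (x0 - (x + s *\<^sub>R axis i 1))) (at s)" for x s
      proof -
        have "((\<lambda>s. K (x0 - x + (- s) *\<^sub>R axis i 1)) has_real_derivative
           pdx K i (x0 - x + (- s) *\<^sub>R axis i 1) * (- 1)) (at s)"
          by (rule DERIV_chain2[where f="\<lambda>s. K (x0 - x + s *\<^sub>R axis i 1)" and g=uminus,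
              OF pdx_has_derivative[OF K] DERIV_minus[OF DERIV_ident]])
        then show ?thesis by (simp add: algebra_simps)
      qed
      have eqN: "(\<integral>x. f' (conv (cos_kernel N) u x) * K (x0 - x) * conv (cos_kernel N) g x \<partial>cubeM)
        = (\<integral>x. f (conv (cos_kernel N) u x) * pdx K i (x0 - x) \<partial>cubeM)" for N
        using chain_integration_by_parts[OF cos_kernel_torus ub g wd f f'c fb f'b,
            of "\<lambda>x. K (x0 - x)" "\<lambda>x. - pdx K i (x0 - x)" L L'] L L' per der
        by (simp add: periodic_def mult_ac)
      have r1: "(\<lambda>n. \<integral>x. f (conv (cos_kernel (r n)) u x) * pdx K i (x0 - x) \<partial>cubeM) \<longlonglongrightarrow> (\<integral>x. f (u x) * pdx K i (x0 - x) \<partial>cubeM)"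
      proof (rule tendsto_integral_bounded_mult[where B="e * (pi / 2)"])
        show "AE x in cubeM. (\<lambda>n. f (conv (cos_kernel (r n)) u x)) \<longlonglongrightarrow> f (u x)"
          using ulim by eventually_elim (rule continuous_on_tendsto_compose[OF fc], auto)
        show "integrable cubeM (\<lambda>x. pdx K i (x0 - x))" for n :: nat
          by (rule continuous_bounded_integrable_cubeM[OF _ L'(2)]) measurable
        then show "integrable cubeM (\<lambda>x. pdx K i (x0 - x))" .
      qed (use fb in auto)
      have r2: "(\<lambda>n. \<integral>x. f' (conv (cos_kernel (r n)) u x) * K (x0 - x) * conv (cos_kernel (r n)) g x \<partial>cubeM) \<longlonglongrightarrow> (\<integral>x. f' (u x) * K (x0 - x) * g x \<partial>cubeM)"
      proof (rule tendsto_integral_bounded_mult[where B="1 * L"])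
        show "AE x in cubeM. (\<lambda>n. f' (conv (cos_kernel (r n)) u x) * K (x0 - x)) \<longlonglongrightarrow> f' (u x) * K (x0 - x)"
          using ulim by eventually_elim (intro tendsto_intros continuous_on_tendsto_compose[OF f'c], auto)
        show "AE x in cubeM. \<bar>f' (conv (cos_kernel (r n)) u x) * K (x0 - x)\<bar> \<le> 1 * L" for n
          unfolding abs_mult using f'b L by (intro AE_I2 mult_mono) auto
      qed (use glim cui[OF g] g in auto)
      show ?thesis
        using LIMSEQ_unique[OF r2[unfolded eqN] r1] by (simp add: f_def f'_def)
    qed
    define \<epsilon> where "\<epsilon> n = inverse (real (Suc n))" for n
    have e0: "\<epsilon> \<longlonglongrightarrow> 0" and ep: "\<epsilon> n > 0" for n
      unfolding \<epsilon>_def[abs_def] using LIMSEQ_inverse_real_of_nat by auto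
    \<comment> \<open>The derivative of the test nonlinearity tends to the indicator of the level
      set, whereas the nonlinearity itself is at most \<open>\<epsilon> n * (pi / 2)\<close> in
      modulus.\<close>
    have l1: "(\<lambda>n. \<integral>x. 1 / (1 + ((u x - c) / \<epsilon> n)\<^sup>2) * K (x0 - x) * g x \<partial>cubeM)
       \<longlonglongrightarrow> (\<integral>x. (if u x = c then 1 else 0) * K (x0 - x) * g x \<partial>cubeM)"
    proof (rule tendsto_integral_bounded_mult[where B="1 * L"])
      show "AE x in cubeM. (\<lambda>n. 1 / (1 + ((u x - c) / \<epsilon> n)\<^sup>2) * K (x0 - x)) \<longlonglongrightarrow> (if u x = c then 1 else 0) * K (x0 - x)"
      proof (rule AE_I2, rule tendsto_mult_right)
        fix x
        show "(\<lambda>n. 1 / (1 + ((u x - c) / \<epsilon> n)\<^sup>2)) \<longlonglongrightarrow> (if u x = c then 1 else 0)"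
        proof (cases "u x = c")
          case False
          have "1 / (1 + ((u x - c) / \<epsilon> n)\<^sup>2) = (\<epsilon> n)\<^sup>2 / ((\<epsilon> n)\<^sup>2 + (u x - c)\<^sup>2)" for n
          proof -
            have "1 + ((u x - c) / \<epsilon> n)\<^sup>2 = ((\<epsilon> n)\<^sup>2 + (u x - c)\<^sup>2) / (\<epsilon> n)\<^sup>2"
              using ep[of n] by (simp add: field_simps)
            then show ?thesis by simp
          qed
          moreover have "(\<lambda>n. (\<epsilon> n)\<^sup>2 / ((\<epsilon> n)\<^sup>2 + (u x - c)\<^sup>2)) \<longlonglongrightarrow> 0\<^sup>2 / (0\<^sup>2 + (u x - c)\<^sup>2)"
            using False by (intro tendsto_intros e0) auto
          ultimately show ?thesis using False by simp
        qed simp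
      qed
      show "AE x in cubeM. \<bar>1 / (1 + ((u x - c) / \<epsilon> n)\<^sup>2) * K (x0 - x)\<bar> \<le> 1 * L" for n
        unfolding abs_mult[of _ "K _"] using q1 L by (intro AE_I2 mult_mono) auto
    qed (use g in auto)
    have l2: "(\<lambda>n. \<integral>x. \<epsilon> n * arctan ((u x - c) / \<epsilon> n) * pdx K i (x0 - x) \<partial>cubeM) \<longlonglongrightarrow> 0"
    proof (rule Lim_null_comparison)
      show "(\<lambda>n. \<epsilon> n * (pi / 2) * L') \<longlonglongrightarrow> 0"
        using tendsto_mult_right[OF e0, of "pi / 2 * L'"] by (simp add: mult.assoc)
      show "\<forall>\<^sub>F n in sequentially. norm (\<integral>x. \<epsilon> n * arctan ((u x - c) / \<epsilon> n) * pdx K i (x0 - x) \<partial>cubeM) \<le> \<epsilon> n * (pi / 2) * L'"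
      proof (rule always_eventually, rule allI)
        fix n
        have le: "\<bar>\<epsilon> n * arctan ((u x - c) / \<epsilon> n) * pdx K i (x0 - x)\<bar> \<le> \<epsilon> n * (pi / 2) * L'" for x
          unfolding abs_mult using ep[of n] arctan_bounded[of "(u x - c) / \<epsilon> n"] L'
          by (intro mult_mono) auto
        have "norm (\<integral>x. \<epsilon> n * arctan ((u x - c) / \<epsilon> n) * pdx K i (x0 - x) \<partial>cubeM)
          \<le> (\<integral>x. \<bar>\<epsilon> n * arctan ((u x - c) / \<epsilon> n) * pdx K i (x0 - x)\<bar> \<partial>cubeM)"
          unfolding real_norm_def by (rule integral_abs_bound)
        also have "\<dots> \<le> (\<integral>x. \<epsilon> n * (pi / 2) * L' \<partial>(cubeM :: (real^'d) measure))"
        proof (rule integral_mono[OF _ _ le])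
          show "integrable cubeM (\<lambda>x. \<bar>\<epsilon> n * arctan ((u x - c) / \<epsilon> n) * pdx K i (x0 - x)\<bar>)"
            by (intro integrable_abs continuous_bounded_integrable_cubeM[OF _ le]) measurable
        qed simp
        finally show "norm (\<integral>x. \<epsilon> n * arctan ((u x - c) / \<epsilon> n) * pdx K i (x0 - x) \<partial>cubeM) \<le> \<epsilon> n * (pi / 2) * L'"
          by simp
      qed
    qed
    have "(\<integral>x. (if u x = c then 1 else 0) * K (x0 - x) * g x \<partial>cubeM) = 0"
      using LIMSEQ_unique[OF l1[unfolded eps[OF ep]] l2] .
    moreover have "(if u x = c then 1 else 0) * K (x0 - x) * g x = K (x0 - x) * (if u x = c then g x else 0)" for x
      by simp
    ultimately show ?thesis by simp
  qed
  have "AE x in cubeM. (if u x = c then g x else 0) = 0"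
  proof (rule conv_eq_0_imp)
    show "integrable cubeM (\<lambda>x. if u x = c then g x else 0)"
      by (rule Bochner_Integration.integrable_bound[OF g]) auto
    show "conv (cos_kernel N) (\<lambda>x. if u x = c then g x else 0) x = 0" for N x
      unfolding conv_def by (rule key[OF cos_kernel_torus])
  qed
  then show ?thesis by (auto elim!: eventually_mono)
qed

section \<open>Mollification in space of functions on space-time\<close>

definition conv_x :: "(real^'d \<Rightarrow> real) \<Rightarrow> (real \<times> (real^'d) \<Rightarrow> real) \<Rightarrow> real \<times> (real^'d) \<Rightarrow> real" where
  "conv_x K v p = conv K (\<lambda>y. v (fst p, y)) (snd p)"

lemma conv_x_borel [measurable]:
  assumes [measurable]: "K \<in> borel_measurable borel" "v \<in> borel_measurable borel"
  shows "conv_x K v \<in> borel_measurable borel"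
proof -
  have "(\<lambda>p. conv_x K v p) \<in> borel_measurable (borel \<Otimes>\<^sub>M borel)"
    unfolding conv_x_def conv_def by measurable
  then show ?thesis by (simp add: borel_prod)
qed

text \<open>Convergence on almost every time slice, integrated over time; the bound with factor 4 in
  \<open>conv_tendsto\<close> supplies the dominating function.\<close>

lemma conv_x_tendsto:
  fixes v :: "real \<times> (real^'d) \<Rightarrow> real"
  assumes g: "gauge_fun \<Psi>" and v [measurable]: "v \<in> borel_measurable borel"
    and int: "integrable (cylM T) (\<lambda>p. \<Psi> (v p))"
  shows "(\<lambda>N. \<integral>p. \<Psi> (conv_x (cos_kernel N) v p - v p) \<partial>cylM T) \<longlonglongrightarrow> 0"
    and "integrable (cylM T) (\<lambda>p. \<Psi> (conv_x (cos_kernel N) v p - v p))"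
proof -
  note G = gauge_funD[OF g]
  have [measurable]: "\<Psi> \<in> borel_measurable borel" by (rule G)
  have sl: "AE t in timeM T. integrable cubeM (\<lambda>y. \<Psi> (v (t, y)))" using cyl.AE_integrable_fst'[OF int] .
  have isl: "integrable (timeM T) (\<lambda>t. 4 * (\<integral>y. \<Psi> (v (t, y)) \<partial>cubeM))" using cyl.integrable_fst'[OF int] by simp
  have m [measurable]: "(\<lambda>t. \<integral>x. \<Psi> (conv_x (cos_kernel N) v (t, x) - v (t, x)) \<partial>cubeM) \<in> borel_measurable borel" for N
    by measurable
  have bd: "AE t in timeM T. norm (\<integral>x. \<Psi> (conv_x (cos_kernel N) v (t, x) - v (t, x)) \<partial>cubeM) \<le> 4 * (\<integral>y. \<Psi> (v (t, y)) \<partial>cubeM)" for N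
    using sl
  proof eventually_elim
    case (elim t)
    show ?case using conv_tendsto(3)[OF g slice_borel[OF v] elim, of N]
      Bochner_Integration.integral_nonneg[of cubeM "\<lambda>x. \<Psi> (conv_x (cos_kernel N) v (t, x) - v (t, x))"]
      by (simp add: conv_x_def G(7))
  qed
  show i: "integrable (cylM T) (\<lambda>p. \<Psi> (conv_x (cos_kernel N) v p - v p))" for N
  proof (rule cyl.Fubini_integrable)
    show "integrable (timeM T) (\<lambda>x. LINT y|cubeM. norm (\<Psi> (conv_x (cos_kernel N) v (x, y) - v (x, y))))"
      using Bochner_Integration.integrable_bound[OF isl, of "\<lambda>t. \<integral>x. \<Psi> (conv_x (cos_kernel N) v (t, x) - v (t, x)) \<partial>cubeM"] bd[of N]
      by (auto simp: G(7) abs_of_nonneg elim!: eventually_mono)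
    show "AE x in timeM T. integrable cubeM (\<lambda>y. \<Psi> (conv_x (cos_kernel N) v (x, y) - v (x, y)))"
      using sl by eventually_elim (use conv_tendsto(2)[OF g slice_borel[OF v]] in \<open>auto simp: conv_x_def\<close>)
  qed (simp add: borel_measurable_cylM)
  have "(\<lambda>N. \<integral>t. (\<integral>x. \<Psi> (conv_x (cos_kernel N) v (t, x) - v (t, x)) \<partial>cubeM) \<partial>timeM T) \<longlonglongrightarrow> (\<integral>t. 0 \<partial>timeM T)"
  proof (rule integral_dominated_convergence[OF _ _ isl])
    show "AE t in timeM T. (\<lambda>N. \<integral>x. \<Psi> (conv_x (cos_kernel N) v (t, x) - v (t, x)) \<partial>cubeM) \<longlonglongrightarrow> 0"
      using sl by eventually_elim (use conv_tendsto(1)[OF g slice_borel[OF v]] in \<open>auto simp: conv_x_def\<close>)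
  qed (use bd m in auto)
  then show "(\<lambda>N. \<integral>p. \<Psi> (conv_x (cos_kernel N) v p - v p) \<partial>cylM T) \<longlonglongrightarrow> 0"
    by (simp add: cyl.integral_fst'[OF i])
qed

section \<open>The energy inequality\<close>

lemma integrable_mult_L2:
  fixes a b :: "'a \<Rightarrow> real"
  assumes [measurable]: "a \<in> borel_measurable M" "b \<in> borel_measurable M"
    and "integrable M (\<lambda>x. (a x)\<^sup>2)" "integrable M (\<lambda>x. (b x)\<^sup>2)"
  shows "integrable M (\<lambda>x. a x * b x)"
proof (rule Bochner_Integration.integrable_bound[where f="\<lambda>x. (a x)\<^sup>2 + (b x)\<^sup>2"])
  have "\<bar>r * s\<bar> \<le> r\<^sup>2 + s\<^sup>2" for r s :: real
  proof -
    have "2 * \<bar>r * s\<bar> \<le> r\<^sup>2 + s\<^sup>2"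
      using zero_le_power2[of "\<bar>r\<bar> - \<bar>s\<bar>"] by (simp add: power2_diff abs_mult mult.assoc)
    moreover have "0 \<le> \<bar>r * s\<bar>" by simp
    ultimately show ?thesis by linarith
  qed
  then show "AE x in M. norm (a x * b x) \<le> norm ((a x)\<^sup>2 + (b x)\<^sup>2)" by (intro AE_I2) simp
qed (use assms in auto)

lemma L2_add:
  fixes a b :: "'a \<Rightarrow> real"
  assumes [measurable]: "a \<in> borel_measurable M" "b \<in> borel_measurable M"
    and "integrable M (\<lambda>x. (a x)\<^sup>2)" "integrable M (\<lambda>x. (b x)\<^sup>2)"
  shows "integrable M (\<lambda>x. (a x + b x)\<^sup>2)"
proof -
  have "integrable M (\<lambda>x. (a x)\<^sup>2 + (b x)\<^sup>2 + 2 * (a x * b x))"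
    using assms(3,4) integrable_mult_L2[OF assms] by (intro Bochner_Integration.integrable_add) auto
  then show ?thesis by (simp add: power2_sum mult.assoc)
qed

lemma L2_bounded_mult:
  fixes a \<phi> :: "'a \<Rightarrow> real"
  assumes "integrable M (\<lambda>x. (a x)\<^sup>2)" "\<phi> \<in> borel_measurable M" "AE x in M. \<bar>\<phi> x\<bar> \<le> B"
  shows "integrable M (\<lambda>x. (\<phi> x * a x)\<^sup>2)"
proof -
  have "integrable M (\<lambda>x. (\<phi> x)\<^sup>2 * (a x)\<^sup>2)"
  proof (rule integrable_bounded_mult[OF assms(1), where B="B\<^sup>2"])
    show "AE x in M. \<bar>(\<phi> x)\<^sup>2\<bar> \<le> B\<^sup>2" using assms(3)
      by eventually_elim (auto intro: power2_le_iff_abs_le[THEN iffD2] simp: abs_le_square_iff[symmetric])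
  qed (use assms in auto)
  then show ?thesis by (simp add: power_mult_distrib)
qed

text \<open>Young's inequality with a weight \<open>d\<close> replaces Cauchy-Schwarz: a cross term
  costs the squared error divided by \<open>d\<close>, plus \<open>d\<close> times a fixed squared
  norm. Choose \<open>d\<close> small first, then \<open>n\<close> large.\<close>

lemma L2_mult_tendsto_L1:
  fixes a b :: "nat \<Rightarrow> 'a \<Rightarrow> real"
  assumes [measurable]: "\<And>n. a n \<in> borel_measurable M" "\<And>n. b n \<in> borel_measurable M"
      "a' \<in> borel_measurable M" "b' \<in> borel_measurable M"
    and i: "integrable M (\<lambda>x. (a' x)\<^sup>2)" "integrable M (\<lambda>x. (b' x)\<^sup>2)"
      "\<And>n. integrable M (\<lambda>x. (a n x - a' x)\<^sup>2)" "\<And>n. integrable M (\<lambda>x. (b n x - b' x)\<^sup>2)"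
    and l: "(\<lambda>n. \<integral>x. (a n x - a' x)\<^sup>2 \<partial>M) \<longlonglongrightarrow> 0" "(\<lambda>n. \<integral>x. (b n x - b' x)\<^sup>2 \<partial>M) \<longlonglongrightarrow> 0"
  shows "(\<lambda>n. \<integral>x. \<bar>a n x * b n x - a' x * b' x\<bar> \<partial>M) \<longlonglongrightarrow> 0"
    and "integrable M (\<lambda>x. a n x * b n x)"
proof -
  have L2: "integrable M (\<lambda>x. (a n x)\<^sup>2)" "integrable M (\<lambda>x. (b n x)\<^sup>2)" for n
    using L2_add[of "\<lambda>x. a n x - a' x" M a'] L2_add[of "\<lambda>x. b n x - b' x" M b'] i by auto
  show pi: "integrable M (\<lambda>x. a n x * b n x)" for n
    using L2 by (intro integrable_mult_L2) auto
  have pi': "integrable M (\<lambda>x. a' x * b' x)"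
    using i by (intro integrable_mult_L2) auto
  define S where "S = (\<integral>x. (a' x)\<^sup>2 \<partial>M) + (\<integral>x. (b' x)\<^sup>2 \<partial>M)"
  define E where "E n = (\<integral>x. (a n x - a' x)\<^sup>2 \<partial>M) + (\<integral>x. (b n x - b' x)\<^sup>2 \<partial>M)" for n
  have S: "S \<ge> 0" unfolding S_def by simp
  have E: "E \<longlonglongrightarrow> 0" unfolding E_def[abs_def] using tendsto_add[OF l] by simp
  have young: "\<bar>x * y\<bar> \<le> x\<^sup>2 / d + d * y\<^sup>2" if "d > 0" for x y d :: real
  proof -
    have "0 \<le> (\<bar>x\<bar> - d * \<bar>y\<bar>)\<^sup>2" by simp
    then have "2 * d * \<bar>x * y\<bar> \<le> x\<^sup>2 + d\<^sup>2 * y\<^sup>2"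
      by (simp add: power2_diff power_mult_distrib abs_mult mult_ac)
    moreover have "0 \<le> d * \<bar>x * y\<bar>" using that by simp
    ultimately have "d * \<bar>x * y\<bar> \<le> x\<^sup>2 + d\<^sup>2 * y\<^sup>2" by linarith
    then show ?thesis using that by (simp add: field_simps power2_eq_square)
  qed
  have bound: "(\<integral>x. \<bar>a n x * b n x - a' x * b' x\<bar> \<partial>M) \<le> (1 + 1 / d) * E n + d * S" if d: "d > 0" for n d
  proof -
    let ?A = "\<lambda>x. (a n x - a' x)\<^sup>2" and ?B = "\<lambda>x. (b n x - b' x)\<^sup>2"
    have le: "\<bar>a n x * b n x - a' x * b' x\<bar> \<le> (1 + 1 / d) * (?A x + ?B x) + d * ((a' x)\<^sup>2 + (b' x)\<^sup>2)" for x
    proof -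
      have "a n x * b n x - a' x * b' x = (a n x - a' x) * (b n x - b' x) + (a n x - a' x) * b' x + (b n x - b' x) * a' x"
        by (simp add: algebra_simps)
      then have "\<bar>a n x * b n x - a' x * b' x\<bar> \<le> \<bar>(a n x - a' x) * (b n x - b' x)\<bar> + \<bar>(a n x - a' x) * b' x\<bar> + \<bar>(b n x - b' x) * a' x\<bar>"
        by linarith
      also have "\<dots> \<le> (?A x + ?B x) + (?A x / d + d * (b' x)\<^sup>2) + (?B x / d + d * (a' x)\<^sup>2)"
        using young[of 1 "a n x - a' x" "b n x - b' x"] young[OF d, of "a n x - a' x" "b' x"] young[OF d, of "b n x - b' x" "a' x"]
        by simp
      finally show ?thesis by (simp add: algebra_simps add_divide_distrib)
    qed
    have "(\<integral>x. \<bar>a n x * b n x - a' x * b' x\<bar> \<partial>M) \<le> (\<integral>x. (1 + 1 / d) * (?A x + ?B x) + d * ((a' x)\<^sup>2 + (b' x)\<^sup>2) \<partial>M)"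
      by (rule integral_mono[OF _ _ le]) (use pi[of n] pi' i in auto)
    also have "\<dots> = (1 + 1 / d) * E n + d * S"
      using i by (simp add: E_def S_def)
    finally show ?thesis .
  qed
  show "(\<lambda>n. \<integral>x. \<bar>a n x * b n x - a' x * b' x\<bar> \<partial>M) \<longlonglongrightarrow> 0"
  proof (rule LIMSEQ_I)
    fix e :: real assume e: "e > 0"
    define d where "d = e / (2 * (S + 1))"
    have d: "d > 0" "d * S < e / 2 + 0" using e S by (auto simp: d_def field_simps)
    have "(\<lambda>n. (1 + 1 / d) * E n) \<longlonglongrightarrow> (1 + 1 / d) * 0" by (intro tendsto_intros E)
    then have "eventually (\<lambda>n. (1 + 1 / d) * E n < e / 2) sequentially"
      using e by (intro order_tendstoD(2)) auto
    then obtain n0 where n0: "\<And>n. n \<ge> n0 \<Longrightarrow> (1 + 1 / d) * E n < e / 2" by (auto simp: eventually_sequentially)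
    have "norm ((\<integral>x. \<bar>a n x * b n x - a' x * b' x\<bar> \<partial>M) - 0) < e" if "n \<ge> n0" for n
    proof -
      have "(\<integral>x. \<bar>a n x * b n x - a' x * b' x\<bar> \<partial>M) < e" using bound[OF d(1), of n] n0[OF that] d(2) by linarith
      moreover have "0 \<le> (\<integral>x. \<bar>a n x * b n x - a' x * b' x\<bar> \<partial>M)" by simp
      ultimately show ?thesis unfolding real_norm_def by linarith
    qed
    then show "\<exists>n0. \<forall>n\<ge>n0. norm ((\<integral>x. \<bar>a n x * b n x - a' x * b' x\<bar> \<partial>M) - 0) < e" by blast
  qed
qed

lemma primitive_cong_AE:
  assumes "AE s in timeM T. g s = h s" and [measurable]: "g \<in> borel_measurable borel" "h \<in> borel_measurable borel"
  shows "primitive T g t = primitive T h t"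
  unfolding primitive_def by (rule integral_cong_AE) (use assms(1) in \<open>auto elim!: eventually_mono\<close>)

lemma conv_x_integrable:
  fixes v :: "real \<times> (real^'d) \<Rightarrow> real"
  assumes K: "torus_fun K" and v: "integrable (cylM T) v"
  shows "integrable (cylM T) (conv_x K v)"
proof -
  have [measurable]: "v \<in> borel_measurable borel" using v by (simp add: borel_measurable_cylM[symmetric] borel_measurable_integrable)
  have [measurable]: "K \<in> borel_measurable borel" using K by (rule torus_fun_borel)
  obtain L where L: "L > 0" "\<And>x. \<bar>K x\<bar> \<le> L" using torus_fun_bounded[OF K] by blast
  have i: "integrable (timeM T) (\<lambda>t. \<integral>y. \<bar>v (t, y)\<bar> \<partial>cubeM)" using cyl.integrable_fst'[OF integrable_abs[OF v]] .
  have "(\<lambda>t. \<integral>y. \<bar>v (t, y)\<bar> \<partial>cubeM) \<in> borel_measurable borel" using i by auto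
  from measurable_compose[OF fst_borel this]
  have m: "(\<lambda>p::real \<times> (real^'d). norm (L * (\<integral>y. \<bar>v (fst p, y)\<bar> \<partial>cubeM))) \<in> borel_measurable borel"
    by simp
  have c [measurable]: "conv_x K v \<in> borel_measurable borel" by measurable
  show ?thesis
  proof (rule Bochner_Integration.integrable_bound[where f="\<lambda>p. L * (\<integral>y. \<bar>v (fst p, y)\<bar> \<partial>cubeM)"])
    show "integrable (cylM T) (\<lambda>p::real \<times> (real^'d). L * (\<integral>y. \<bar>v (fst p, y)\<bar> \<partial>cubeM))"
    proof (rule cyl.Fubini_integrable)
      show "(\<lambda>p::real \<times> (real^'d). L * (\<integral>y. \<bar>v (fst p, y)\<bar> \<partial>cubeM)) \<in> borel_measurable (cylM T)" by measurable
    qed (use i in \<open>auto simp: abs_mult\<close>)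
    show "AE p in cylM T. norm (conv_x K v p) \<le> norm (L * (\<integral>y. \<bar>v (fst p, y)\<bar> \<partial>cubeM))"
    proof (rule AE_cylM_I)
      show "AE t in timeM T. AE x in cubeM. norm (conv_x K v (t, x)) \<le> norm (L * (\<integral>y. \<bar>v (fst (t, x), y)\<bar> \<partial>cubeM))"
        using cyl.AE_integrable_fst'[OF v]
      proof eventually_elim
        case (elim t)
        show ?case using conv_bound[OF K L(2) elim] L
          by (intro AE_I2) (auto simp: conv_x_def abs_mult intro: order_trans[OF _ abs_ge_self])
      qed
      show "Measurable.pred borel (\<lambda>p. norm (conv_x K v p) \<le> norm (L * (\<integral>y. \<bar>v (fst p, y)\<bar> \<partial>cubeM)))"
        unfolding Measurable.pred_def by (rule borel_measurable_le[OF measurable_compose[OF c borel_measurable_norm] m])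
    qed
  qed (simp add: borel_measurable_cylM)
qed

lemma L2_integrable_cylM:
  fixes v :: "real \<times> (real^'d) \<Rightarrow> real"
  assumes "v \<in> borel_measurable borel" "integrable (cylM T) (\<lambda>p. (v p)\<^sup>2)"
  shows "integrable (cylM T) v"
  by (rule cylM.gauge_integrable[OF gauge_square]) (use assms in \<open>auto simp: borel_measurable_cylM\<close>)

text \<open>For fixed \<open>x\<close> the mollified \<open>w\<close> is a primitive starting from
  0, so \<open>primitive_convex_chain\<close> bounds \<open>f\<close> of it by the primitive of
  \<open>h\<close>. Integrating in time turns that primitive into the weight \<open>T - t\<close>.
  At fixed \<open>t\<close> the divergence is then moved onto \<open>f'\<close>, where
  \<open>wg\<close> supplies the gradient of the mollified \<open>w\<close>.\<close>

lemma energy_mollified: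
  fixes w :: "real \<times> (real^'d) \<Rightarrow> real" and g F :: "'d \<Rightarrow> real \<times> (real^'d) \<Rightarrow> real"
  assumes T: "T \<ge> 0" and w: "integrable (cylM T) w"
    and gm [measurable]: "\<And>i. g i \<in> borel_measurable borel" and g: "\<And>i. integrable (cylM T) (\<lambda>p. (g i p)\<^sup>2)"
    and Fm [measurable]: "\<And>i. F i \<in> borel_measurable borel" and F: "\<And>i. integrable (cylM T) (\<lambda>p. (F i p)\<^sup>2)"
    and wg: "\<And>i. weak_grad T w i (g i)"
    and pr: "\<And>K x. torus_fun K \<Longrightarrow> AE t in timeM T. conv_x K w (t, x) = primitive T (\<lambda>s. \<Sum>i\<in>UNIV. conv_x (pdx K i) (F i) (s, x)) t"
    and f: "\<And>a b. f b - f a \<le> f' b * (b - a)" "f 0 = 0" "continuous_on UNIV f"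
    and f': "\<And>r. (f' has_real_derivative f'' r) (at r)" "continuous_on UNIV f''"
    and fb: "\<And>r. \<bar>f' r\<bar> \<le> B" "\<And>r. \<bar>f'' r\<bar> \<le> B'"
    and fi: "integrable (cylM T) (\<lambda>p. f (conv_x (cos_kernel N) w p))"
  shows "(\<integral>p. f (conv_x (cos_kernel N) w p) \<partial>cylM T)
    \<le> - (\<integral>p. (T - fst p) * f'' (conv_x (cos_kernel N) w p) * (\<Sum>i\<in>UNIV. conv_x (cos_kernel N) (g i) p * conv_x (cos_kernel N) (F i) p) \<partial>cylM T)"
proof -
  define K where "K = (cos_kernel N :: real^'d \<Rightarrow> real)"
  have K: "torus_fun K" unfolding K_def by (rule cos_kernel_torus)
  note pdx = torus_fun_pdx[OF K]
  have f'c: "continuous_on UNIV f'" by (meson f'(1) DERIV_isCont continuous_at_imp_continuous_on)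
  have [measurable]: "f \<in> borel_measurable borel" "f' \<in> borel_measurable borel" "f'' \<in> borel_measurable borel"
    using f(3) f'c f'(2) by (auto intro: borel_measurable_continuous_onI)
  have [measurable]: "K \<in> borel_measurable borel" "pdx K i \<in> borel_measurable borel" for i
    using torus_fun_borel[OF K] torus_fun_borel[OF pdx] by auto
  have [measurable]: "w \<in> borel_measurable borel" using w by (simp add: borel_measurable_cylM[symmetric] borel_measurable_integrable)
  have g1: "integrable (cylM T) (g i)" and F1: "integrable (cylM T) (F i)" for i
    using L2_integrable_cylM[OF gm g] L2_integrable_cylM[OF Fm F] by auto
  define G where "G p = (\<Sum>i\<in>UNIV. conv_x (pdx K i) (F i) p)" for p
  have [measurable]: "G \<in> borel_measurable borel" unfolding G_def[abs_def] by measurable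
  have Gi: "integrable (cylM T) G" unfolding G_def[abs_def]
    by (intro Bochner_Integration.integrable_sum conv_x_integrable[OF pdx F1])
  define h where "h p = f' (conv_x K w p) * G p" for p
  have [measurable]: "h \<in> borel_measurable borel" unfolding h_def[abs_def] by measurable
  have hi: "integrable (cylM T) h" unfolding h_def
    by (rule cylM_integrable_mult_bounded[OF Gi _ fb(1)]) measurable
  have Ths: "\<bar>T - fst p\<bar> \<le> T" if "fst p \<in> {0..T}" for p :: "real \<times> (real^'d)" using that by auto
  have hTi: "integrable (cylM T) (\<lambda>p. (T - fst p) * h p)"
    by (rule cylM_integrable_mult_bounded[OF hi _ Ths]) measurable
  have sn: "integrable (cylM T) q \<Longrightarrow> integrable (timeM T \<Otimes>\<^sub>M cubeM) (case_prod (\<lambda>t x. q (t, x)))" for q :: "real \<times> (real^'d) \<Rightarrow> real"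
    by (simp add: case_prod_beta')
  \<comment> \<open>Space is the outer variable, because the chain rule in time works at a fixed
    point \<open>x\<close>.\<close>
  have "(\<integral>p. f (conv_x K w p) \<partial>cylM T) = (\<integral>x. (\<integral>t. f (conv_x K w (t, x)) \<partial>timeM T) \<partial>cubeM)"
    using cyl.integral_snd[OF sn[OF fi]] by (simp add: K_def case_prod_beta')
  also have "\<dots> \<le> (\<integral>x. (\<integral>t. (T - t) * h (t, x) \<partial>timeM T) \<partial>cubeM)"
  proof (rule integral_mono_AE)
    show "integrable cubeM (\<lambda>x. \<integral>t. f (conv_x K w (t, x)) \<partial>timeM T)" using cyl.integrable_snd[OF sn[OF fi]] by (simp add: K_def)
    show "integrable cubeM (\<lambda>x. \<integral>t. (T - t) * h (t, x) \<partial>timeM T)" using cyl.integrable_snd[OF sn[OF hTi]] by simp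
    show "AE x in cubeM. (\<integral>t. f (conv_x K w (t, x)) \<partial>timeM T) \<le> (\<integral>t. (T - t) * h (t, x) \<partial>timeM T)"
      using cyl.AE_integrable_snd[OF sn[OF fi]] cyl.AE_integrable_snd[OF sn[OF hi]] cyl.AE_integrable_snd[OF sn[OF Gi]]
    proof eventually_elim
      case (elim x)
      let ?G = "\<lambda>s. G (s, x)"
      have Gx: "integrable (timeM T) ?G" using elim by simp
      have hx: "integrable (timeM T) (\<lambda>s. h (s, x))" using elim by simp
      have wx: "AE t in timeM T. conv_x K w (t, x) = primitive T ?G t" using pr[OF K, of x] by (simp add: G_def)
      have [measurable]: "(\<lambda>s. h (s, x)) \<in> borel_measurable borel" "?G \<in> borel_measurable borel"
        using hx Gx by auto
      \<comment> \<open>Inside a time integral the primitive and the mollified \<open>w\<close> may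
        be exchanged, as they agree at almost every time.\<close>
      have h': "AE s in timeM T. f' (primitive T ?G s) * ?G s = h (s, x)"
        using wx by eventually_elim (simp add: h_def)
      have "(\<integral>t. f (conv_x K w (t, x)) \<partial>timeM T) \<le> (\<integral>t. primitive T (\<lambda>s. h (s, x)) t \<partial>timeM T)"
      proof (rule integral_mono_AE)
        show "integrable (timeM T) (\<lambda>t. f (conv_x K w (t, x)))" using elim by (simp add: K_def)
        show "integrable (timeM T) (primitive T (\<lambda>s. h (s, x)))" by (rule primitive_integrable[OF hx])
        show "AE t in timeM T. f (conv_x K w (t, x)) \<le> primitive T (\<lambda>s. h (s, x)) t"
          using wx AE_timeM_Icc
        proof eventually_elim
          case (elim t)
          have "f (primitive T ?G t) - f 0 \<le> primitive T (\<lambda>s. f' (primitive T ?G s) * ?G s) t"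
            by (rule primitive_convex_chain[OF Gx f'c fb(1) f(1)]) (use elim in auto)
          also have "\<dots> = primitive T (\<lambda>s. h (s, x)) t"
            by (rule primitive_cong_AE[OF h']) measurable
          finally show ?case using elim f(2) by simp
        qed
      qed
      also have "\<dots> = (\<integral>t. (T - t) * h (t, x) \<partial>timeM T)" by (rule primitive_integral[OF hx])
      finally show ?case .
    qed
  qed
  \<comment> \<open>Now time becomes the outer variable, since integration by parts in space works
    at a fixed \<open>t\<close>.\<close>
  also have "\<dots> = (\<integral>t. (\<integral>x. (T - t) * h (t, x) \<partial>cubeM) \<partial>timeM T)"
    using cyl.Fubini_integral[OF sn[OF hTi]] by simp
  also have "\<dots> = (\<integral>t. (\<integral>x. - ((T - t) * f'' (conv_x K w (t, x)) * (\<Sum>i\<in>UNIV. conv_x K (g i) (t, x) * conv_x K (F i) (t, x))) \<partial>cubeM) \<partial>timeM T)"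
  proof (rule integral_cong_AE)
    have "AE t in timeM T. \<forall>i\<in>UNIV. \<forall>x. conv (pdx K i) (\<lambda>y. w (t, y)) x = conv K (\<lambda>y. g i (t, y)) x"
      by (subst AE_ball_countable) (auto intro: weak_grad_slice[OF wg w g1 K] countable_finite)
    moreover have "AE t in timeM T. \<forall>i\<in>UNIV. integrable cubeM (\<lambda>y. g i (t, y)) \<and> integrable cubeM (\<lambda>y. F i (t, y))"
      by (subst AE_ball_countable) (auto intro: countable_finite cyl.AE_integrable_fst'[OF g1] cyl.AE_integrable_fst'[OF F1])
    moreover note cyl.AE_integrable_fst'[OF w]
    ultimately show "AE t in timeM T. (\<integral>x. (T - t) * h (t, x) \<partial>cubeM)
       = (\<integral>x. - ((T - t) * f'' (conv_x K w (t, x)) * (\<Sum>i\<in>UNIV. conv_x K (g i) (t, x) * conv_x K (F i) (t, x))) \<partial>cubeM)"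
    proof eventually_elim
      case (elim t)
      let ?w = "\<lambda>y. w (t, y)" and ?g = "\<lambda>i y. g i (t, y)" and ?F = "\<lambda>i y. F i (t, y)"
      have cb: "\<exists>C. \<forall>x. \<bar>conv k v x\<bar> \<le> C" if "torus_fun k" "integrable cubeM v" for k and v :: "real^'d \<Rightarrow> real"
        using torus_fun_bounded[OF that(1)] conv_bound[OF that(1) _ that(2)] by metis
      have fm: "integrable cubeM (\<lambda>x. \<phi> (conv K ?w x) * conv k v x)" if kv: "torus_fun k" "integrable cubeM v" and
         "\<phi> \<in> borel_measurable borel" "\<And>r. \<bar>\<phi> r\<bar> \<le> M" for k M and \<phi> :: "real \<Rightarrow> real" and v :: "real^'d \<Rightarrow> real"
      proof -
        have [measurable]: "k \<in> borel_measurable borel" "v \<in> borel_measurable borel" "\<phi> \<in> borel_measurable borel"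
          using that by (auto intro: torus_fun_borel)
        obtain C where C: "\<And>x. \<bar>conv k v x\<bar> \<le> C" using cb[OF kv] by blast
        have "integrable cubeM (conv k v)" by (rule continuous_bounded_integrable_cubeM[OF _ C]) measurable
        then show ?thesis by (rule integrable_bounded_mult[where B=M]) (use that(4) in auto)
      qed
      have i1: "integrable cubeM (\<lambda>x. f' (conv K ?w x) * conv (pdx K i) (?F i) x)" for i
        by (rule fm[OF pdx _ _ fb(1)]) (use elim in auto)
      have i2: "integrable cubeM (\<lambda>x. f'' (conv K ?w x) * (conv K (?g i) x * conv K (?F i) x))" for i
      proof -
        obtain C where C: "\<And>x. \<bar>conv K (?g i) x\<bar> \<le> C" using cb[OF K] elim by blast
        have "integrable cubeM (\<lambda>x. f'' (conv K ?w x) * conv K (?F i) x)"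
          by (rule fm[OF K _ _ fb(2)]) (use elim in auto)
        then have "integrable cubeM (\<lambda>x. conv K (?g i) x * (f'' (conv K ?w x) * conv K (?F i) x))"
          by (rule integrable_bounded_mult[where B=C]) (use C in auto)
        then show ?thesis by (simp add: mult_ac)
      qed
      have "(\<integral>x. (T - t) * h (t, x) \<partial>cubeM) = (T - t) * (\<integral>x. (\<Sum>i\<in>UNIV. f' (conv K ?w x) * conv (pdx K i) (?F i) x) \<partial>cubeM)"
      proof -
        have "h (t, x) = (\<Sum>i\<in>UNIV. f' (conv K ?w x) * conv (pdx K i) (?F i) x)" for x
          by (simp add: h_def G_def conv_x_def sum_distrib_left)
        then show ?thesis by (simp only: integral_mult_right_zero)
      qed
      also have "\<dots> = (T - t) * (\<Sum>i\<in>UNIV. (\<integral>x. f' (conv K ?w x) * conv (pdx K i) (?F i) x \<partial>cubeM))"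
        by (subst Bochner_Integration.integral_sum) (use i1 in auto)
      also have "\<dots> = (T - t) * (\<Sum>i\<in>UNIV. - (\<integral>x. f'' (conv K ?w x) * (conv K (?g i) x * conv K (?F i) x) \<partial>cubeM))"
      proof -
        have "(\<integral>x. f' (conv K ?w x) * conv (pdx K i) (?F i) x \<partial>cubeM)
          = - (\<integral>x. f'' (conv K ?w x) * (conv K (?g i) x * conv K (?F i) x) \<partial>cubeM)" for i
          by (rule conv_integration_by_parts[OF K _ _ _ _ f' fb]) (use elim in auto)
        then show ?thesis by simp
      qed
      also have "\<dots> = - ((T - t) * (\<integral>x. (\<Sum>i\<in>UNIV. f'' (conv K ?w x) * (conv K (?g i) x * conv K (?F i) x)) \<partial>cubeM))"
        by (subst Bochner_Integration.integral_sum) (use i2 in \<open>auto simp: sum_negf\<close>)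
      also have "\<dots> = (\<integral>x. - ((T - t) * f'' (conv_x K w (t, x)) * (\<Sum>i\<in>UNIV. conv_x K (g i) (t, x) * conv_x K (F i) (t, x))) \<partial>cubeM)"
      proof -
        have "(T - t) * f'' (conv_x K w (t, x)) * (\<Sum>i\<in>UNIV. conv_x K (g i) (t, x) * conv_x K (F i) (t, x))
          = (T - t) * (\<Sum>i\<in>UNIV. f'' (conv K ?w x) * (conv K (?g i) x * conv K (?F i) x))" for x
          by (simp only: conv_x_def sum_distrib_left mult.assoc fst_conv snd_conv)
        then show ?thesis by (simp only: integral_mult_right_zero integral_minus)
      qed
      finally show ?case .
    qed
  qed measurable
  also have "\<dots> = (\<integral>p. - ((T - fst p) * f'' (conv_x K w p) * (\<Sum>i\<in>UNIV. conv_x K (g i) p * conv_x K (F i) p)) \<partial>cylM T)"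
  proof -
    have L2: "integrable (cylM T) (\<lambda>p. (conv_x K v p)\<^sup>2)" if vm [measurable]: "v \<in> borel_measurable borel" and vi: "integrable (cylM T) (\<lambda>p. (v p)\<^sup>2)" for v :: "real \<times> (real^'d) \<Rightarrow> real"
      using L2_add[of "\<lambda>p. conv_x K v p - v p" "cylM T" v] conv_x_tendsto(2)[OF gauge_square vm vi, of N] vi
      by (simp add: K_def borel_measurable_cylM)
    have "integrable (cylM T) (\<lambda>p. conv_x K (g i) p * conv_x K (F i) p)" for i
      by (rule integrable_mult_L2) (use L2[OF gm g] L2[OF Fm F] in \<open>auto simp: borel_measurable_cylM\<close>)
    then have s: "integrable (cylM T) (\<lambda>p. \<Sum>i\<in>UNIV. conv_x K (g i) p * conv_x K (F i) p)"
      by (intro Bochner_Integration.integrable_sum)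
    have "integrable (cylM T) (\<lambda>p. f'' (conv_x K w p) * (\<Sum>i\<in>UNIV. conv_x K (g i) p * conv_x K (F i) p))"
      by (rule cylM_integrable_mult_bounded[OF s _ fb(2)]) measurable
    then have "integrable (cylM T) (\<lambda>p. (T - fst p) * (f'' (conv_x K w p) * (\<Sum>i\<in>UNIV. conv_x K (g i) p * conv_x K (F i) p)))"
      by (rule cylM_integrable_mult_bounded[OF _ _ Ths]) measurable
    from Bochner_Integration.integrable_minus[OF this]
    have "integrable (cylM T) (\<lambda>p. - ((T - fst p) * f'' (conv_x K w p) * (\<Sum>i\<in>UNIV. conv_x K (g i) p * conv_x K (F i) p)))"
      by (simp only: mult.assoc)
    from cyl.integral_fst'[OF this] show ?thesis by simp
  qed
  finally show ?thesis by (simp add: K_def)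
qed

text \<open>The mollification is removed. On the left \<open>f\<close> is Lipschitz with constant
  \<open>B\<close>, so L1 convergence of \<open>w\<close> suffices. On the right each product of
  gradient and flux converges in L1 by \<open>L2_mult_tendsto_L1\<close>, and the bounded factor
  with \<open>f''\<close> converges almost everywhere along a subsequence.\<close>

lemma energy_inequality:
  fixes w :: "real \<times> (real^'d) \<Rightarrow> real" and g F :: "'d \<Rightarrow> real \<times> (real^'d) \<Rightarrow> real"
  assumes T: "T \<ge> 0" and w: "integrable (cylM T) w"
    and gm [measurable]: "\<And>i. g i \<in> borel_measurable borel" and g: "\<And>i. integrable (cylM T) (\<lambda>p. (g i p)\<^sup>2)"
    and Fm [measurable]: "\<And>i. F i \<in> borel_measurable borel" and F: "\<And>i. integrable (cylM T) (\<lambda>p. (F i p)\<^sup>2)"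
    and wg: "\<And>i. weak_grad T w i (g i)"
    and pr: "\<And>K x. torus_fun K \<Longrightarrow> AE t in timeM T. conv_x K w (t, x) = primitive T (\<lambda>s. \<Sum>i\<in>UNIV. conv_x (pdx K i) (F i) (s, x)) t"
    and f: "\<And>a b. f b - f a \<le> f' b * (b - a)" "f 0 = 0"
    and f'0: "\<And>r. (f has_real_derivative f' r) (at r)"
    and f': "\<And>r. (f' has_real_derivative f'' r) (at r)" "continuous_on UNIV f''"
    and fb: "\<And>r. \<bar>f' r\<bar> \<le> B" "\<And>r. \<bar>f'' r\<bar> \<le> B'"
  shows "(\<integral>p. f (w p) \<partial>cylM T) \<le> - (\<integral>p. (T - fst p) * f'' (w p) * (\<Sum>i\<in>UNIV. g i p * F i p) \<partial>cylM T)"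
    and "integrable (cylM T) (\<lambda>p. f (w p))"
    and "integrable (cylM T) (\<lambda>p. (T - fst p) * f'' (w p) * (\<Sum>i\<in>UNIV. g i p * F i p))"
proof -
  have fc: "continuous_on UNIV f" by (meson f'0 DERIV_isCont continuous_at_imp_continuous_on)
  have [measurable]: "f \<in> borel_measurable borel" "f'' \<in> borel_measurable borel"
    using fc f'(2) by (auto intro: borel_measurable_continuous_onI)
  have wm [measurable]: "w \<in> borel_measurable borel" using w by (simp add: borel_measurable_cylM[symmetric] borel_measurable_integrable)
  have lip: "\<bar>f a - f b\<bar> \<le> B * \<bar>a - b\<bar>" for a b
    using field_differentiable_bound[of UNIV f f' B a b] f'0 fb(1) by (auto simp: has_field_derivative_at_within)
  have fint: "integrable (cylM T) (\<lambda>p. f (v p))" if v: "integrable (cylM T) v" for v :: "real \<times> (real^'d) \<Rightarrow> real"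
  proof (rule Bochner_Integration.integrable_bound[where f="\<lambda>p. B * v p"])
    have vm [measurable]: "v \<in> borel_measurable (cylM T)" using v by (rule borel_measurable_integrable)
    show "(\<lambda>p. f (v p)) \<in> borel_measurable (cylM T)" by (rule measurable_compose[OF vm]) simp
    show "AE p in cylM T. norm (f (v p)) \<le> norm (B * v p)"
      using lip[of _ 0] f(2) by (intro AE_I2) (auto simp: abs_mult intro!: order_trans[OF lip[of _ 0, simplified f(2) diff_zero]] mult_right_mono)
  qed (use v in simp)
  have wN: "integrable (cylM T) (conv_x (cos_kernel N) w)" for N by (rule conv_x_integrable[OF cos_kernel_torus w])
  show "integrable (cylM T) (\<lambda>p. f (w p))" by (rule fint[OF w])
  have wl: "(\<lambda>N. \<integral>p. \<bar>conv_x (cos_kernel N) w p - w p\<bar> \<partial>cylM T) \<longlonglongrightarrow> 0"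
    using conv_x_tendsto(1)[OF gauge_abs wm] w by simp
  have "\<exists>r::nat \<Rightarrow> nat. strict_mono r \<and> (AE p in cylM T. (\<lambda>n. conv_x (cos_kernel (r n)) w p - w p) \<longlonglongrightarrow> 0)"
    using tendsto_L1_AE_subseq[of "cylM T" "\<lambda>N p. conv_x (cos_kernel N) w p - w p"] wN w wl by simp
  then obtain r :: "nat \<Rightarrow> nat" where r: "strict_mono r"
      "AE p in cylM T. (\<lambda>n. conv_x (cos_kernel (r n)) w p - w p) \<longlonglongrightarrow> 0" by blast
  have lhs: "(\<lambda>N. \<integral>p. f (conv_x (cos_kernel N) w p) \<partial>cylM T) \<longlonglongrightarrow> (\<integral>p. f (w p) \<partial>cylM T)"
  proof (rule Lim_transform2[OF tendsto_const], rule Lim_null_comparison)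
    show "(\<lambda>N. B * (\<integral>p. \<bar>conv_x (cos_kernel N) w p - w p\<bar> \<partial>cylM T)) \<longlonglongrightarrow> 0" using tendsto_mult_left[OF wl, of B] by simp
    show "\<forall>\<^sub>F N in sequentially. norm ((\<integral>p. f (w p) \<partial>cylM T) - (\<integral>p. f (conv_x (cos_kernel N) w p) \<partial>cylM T))
      \<le> B * (\<integral>p. \<bar>conv_x (cos_kernel N) w p - w p\<bar> \<partial>cylM T)"
    proof (rule always_eventually, rule allI)
      fix N
      have i: "integrable (cylM T) (\<lambda>p. f (w p) - f (conv_x (cos_kernel N) w p))"
        using fint[OF w] fint[OF wN] by (rule Bochner_Integration.integrable_diff)
      have "norm ((\<integral>p. f (w p) \<partial>cylM T) - (\<integral>p. f (conv_x (cos_kernel N) w p) \<partial>cylM T)) = \<bar>\<integral>p. f (w p) - f (conv_x (cos_kernel N) w p) \<partial>cylM T\<bar>"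
        using fint[OF w] fint[OF wN] by simp
      also have "\<dots> \<le> (\<integral>p. \<bar>f (w p) - f (conv_x (cos_kernel N) w p)\<bar> \<partial>cylM T)" by (rule integral_abs_bound)
      also have "\<dots> \<le> (\<integral>p. B * \<bar>conv_x (cos_kernel N) w p - w p\<bar> \<partial>cylM T)"
        by (rule integral_mono) (use i wN w lip in \<open>auto simp: abs_minus_commute\<close>)
      finally show "norm ((\<integral>p. f (w p) \<partial>cylM T) - (\<integral>p. f (conv_x (cos_kernel N) w p) \<partial>cylM T))
        \<le> B * (\<integral>p. \<bar>conv_x (cos_kernel N) w p - w p\<bar> \<partial>cylM T)" by simp
    qed
  qed
  define \<psi> where "\<psi> N p = (\<Sum>i\<in>UNIV. conv_x (cos_kernel N) (g i) p * conv_x (cos_kernel N) (F i) p)" for N p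
  define \<psi>' where "\<psi>' p = (\<Sum>i\<in>UNIV. g i p * F i p)" for p
  have pl: "(\<lambda>N. \<integral>p. \<bar>conv_x (cos_kernel N) (g i) p * conv_x (cos_kernel N) (F i) p - g i p * F i p\<bar> \<partial>cylM T) \<longlonglongrightarrow> 0"
    and pi: "integrable (cylM T) (\<lambda>p. conv_x (cos_kernel N) (g i) p * conv_x (cos_kernel N) (F i) p)" for i N
    using L2_mult_tendsto_L1[of "\<lambda>N. conv_x (cos_kernel N) (g i)" "cylM T" "\<lambda>N. conv_x (cos_kernel N) (F i)" "g i" "F i"]
      conv_x_tendsto[OF gauge_square gm g] conv_x_tendsto[OF gauge_square Fm F] g F
    by (simp_all add: borel_measurable_cylM)
  have pi': "integrable (cylM T) (\<lambda>p. g i p * F i p)" for i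
    by (rule integrable_mult_L2) (use g F in \<open>auto simp: borel_measurable_cylM\<close>)
  have psi: "integrable (cylM T) (\<psi> N)" "integrable (cylM T) \<psi>'" for N
    unfolding \<psi>_def[abs_def] \<psi>'_def[abs_def] using pi pi' by (auto intro: Bochner_Integration.integrable_sum)
  have psil: "(\<lambda>N. \<integral>p. \<bar>\<psi> N p - \<psi>' p\<bar> \<partial>cylM T) \<longlonglongrightarrow> 0"
  proof (rule Lim_null_comparison)
    show "(\<lambda>N. \<Sum>i\<in>UNIV. \<integral>p. \<bar>conv_x (cos_kernel N) (g i) p * conv_x (cos_kernel N) (F i) p - g i p * F i p\<bar> \<partial>cylM T) \<longlonglongrightarrow> 0"
      by (rule tendsto_null_sum) (rule pl)
    show "\<forall>\<^sub>F N in sequentially. norm (\<integral>p. \<bar>\<psi> N p - \<psi>' p\<bar> \<partial>cylM T)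
       \<le> (\<Sum>i\<in>UNIV. \<integral>p. \<bar>conv_x (cos_kernel N) (g i) p * conv_x (cos_kernel N) (F i) p - g i p * F i p\<bar> \<partial>cylM T)"
    proof (rule always_eventually, rule allI)
      fix N
      have i: "integrable (cylM T) (\<lambda>p. \<bar>conv_x (cos_kernel N) (g i) p * conv_x (cos_kernel N) (F i) p - g i p * F i p\<bar>)" for i
        using pi pi' by (intro integrable_abs Bochner_Integration.integrable_diff)
      have "norm (\<integral>p. \<bar>\<psi> N p - \<psi>' p\<bar> \<partial>cylM T) = (\<integral>p. \<bar>\<psi> N p - \<psi>' p\<bar> \<partial>cylM T)" by simp
      also have "\<dots> \<le> (\<integral>p. (\<Sum>i\<in>UNIV. \<bar>conv_x (cos_kernel N) (g i) p * conv_x (cos_kernel N) (F i) p - g i p * F i p\<bar>) \<partial>cylM T)"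
      proof (rule integral_mono)
        show "integrable (cylM T) (\<lambda>p. \<bar>\<psi> N p - \<psi>' p\<bar>)" using psi by (intro integrable_abs Bochner_Integration.integrable_diff)
        show "integrable (cylM T) (\<lambda>p. \<Sum>i\<in>UNIV. \<bar>conv_x (cos_kernel N) (g i) p * conv_x (cos_kernel N) (F i) p - g i p * F i p\<bar>)"
          using i by (intro Bochner_Integration.integrable_sum)
        show "\<bar>\<psi> N p - \<psi>' p\<bar> \<le> (\<Sum>i\<in>UNIV. \<bar>conv_x (cos_kernel N) (g i) p * conv_x (cos_kernel N) (F i) p - g i p * F i p\<bar>)" for p
          unfolding \<psi>_def \<psi>'_def sum_subtractf[symmetric] by (rule sum_abs)
      qed
      also have "\<dots> = (\<Sum>i\<in>UNIV. \<integral>p. \<bar>conv_x (cos_kernel N) (g i) p * conv_x (cos_kernel N) (F i) p - g i p * F i p\<bar> \<partial>cylM T)"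
        by (rule Bochner_Integration.integral_sum) (rule i)
      finally show "norm (\<integral>p. \<bar>\<psi> N p - \<psi>' p\<bar> \<partial>cylM T)
       \<le> (\<Sum>i\<in>UNIV. \<integral>p. \<bar>conv_x (cos_kernel N) (g i) p * conv_x (cos_kernel N) (F i) p - g i p * F i p\<bar> \<partial>cylM T)" .
    qed
  qed
  have B'0: "0 \<le> B'" using fb(2)[of 0] by linarith
  have phib: "AE p in cylM T. \<bar>(T - fst p) * f'' (v p)\<bar> \<le> T * B'" for v :: "real \<times> (real^'d) \<Rightarrow> real"
    using AE_cylM_fst
  proof eventually_elim
    case (elim p)
    then show ?case unfolding abs_mult using fb(2)[of "v p"] T by (intro mult_mono) auto
  qed
  have phim: "(\<lambda>p. (T - fst p) * f'' (v p)) \<in> borel_measurable (cylM T)" if [measurable]: "v \<in> borel_measurable borel" for v :: "real \<times> (real^'d) \<Rightarrow> real"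
    unfolding borel_measurable_cylM by measurable
  have "(\<lambda>n. \<integral>p. (T - fst p) * f'' (conv_x (cos_kernel (r n)) w p) * \<psi> (r n) p \<partial>cylM T)
      \<longlonglongrightarrow> (\<integral>p. (T - fst p) * f'' (w p) * \<psi>' p \<partial>cylM T)"
  proof (rule tendsto_integral_bounded_mult[where B="T * B'"])
    show "AE p in cylM T. (\<lambda>n. (T - fst p) * f'' (conv_x (cos_kernel (r n)) w p)) \<longlonglongrightarrow> (T - fst p) * f'' (w p)"
      using r(2)
    proof eventually_elim
      case (elim p)
      then have "(\<lambda>n. conv_x (cos_kernel (r n)) w p) \<longlonglongrightarrow> w p" by (simp add: LIM_zero_iff)
      then show ?case by (intro tendsto_intros continuous_on_tendsto_compose[OF f'(2)]) auto
    qed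
    show "(\<lambda>n. \<integral>p. \<bar>\<psi> (r n) p - \<psi>' p\<bar> \<partial>cylM T) \<longlonglongrightarrow> 0"
      using LIMSEQ_subseq_LIMSEQ[OF psil r(1)] by (simp add: comp_def)
    show "(\<lambda>p. (T - fst p) * f'' (conv_x (cos_kernel (r n)) w p)) \<in> borel_measurable (cylM T)" for n
      by (rule phim) measurable
  qed (use psi phib phim[OF wm] in auto)
  then have rhs: "(\<lambda>n. - (\<integral>p. (T - fst p) * f'' (conv_x (cos_kernel (r n)) w p) * \<psi> (r n) p \<partial>cylM T))
      \<longlonglongrightarrow> - (\<integral>p. (T - fst p) * f'' (w p) * \<psi>' p \<partial>cylM T)" by (rule tendsto_minus)
  have lhs': "(\<lambda>n. \<integral>p. f (conv_x (cos_kernel (r n)) w p) \<partial>cylM T) \<longlonglongrightarrow> (\<integral>p. f (w p) \<partial>cylM T)"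
    using LIMSEQ_subseq_LIMSEQ[OF lhs r(1)] by (simp add: comp_def)
  have "(\<integral>p. f (w p) \<partial>cylM T) \<le> - (\<integral>p. (T - fst p) * f'' (w p) * \<psi>' p \<partial>cylM T)"
  proof (rule LIMSEQ_le[OF lhs' rhs], rule exI[of _ 0], intro allI impI)
    fix n
    show "(\<integral>p. f (conv_x (cos_kernel (r n)) w p) \<partial>cylM T) \<le> - (\<integral>p. (T - fst p) * f'' (conv_x (cos_kernel (r n)) w p) * \<psi> (r n) p \<partial>cylM T)"
      unfolding \<psi>_def by (rule energy_mollified[OF T w gm g Fm F wg pr f fc f' fb fint[OF wN]])
  qed
  then show "(\<integral>p. f (w p) \<partial>cylM T) \<le> - (\<integral>p. (T - fst p) * f'' (w p) * (\<Sum>i\<in>UNIV. g i p * F i p) \<partial>cylM T)"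
    by (simp only: \<psi>'_def)
  show "integrable (cylM T) (\<lambda>p. (T - fst p) * f'' (w p) * (\<Sum>i\<in>UNIV. g i p * F i p))"
    using integrable_bounded_mult[OF psi(2) phim[OF wm] phib] by (simp add: \<psi>'_def)
qed

section \<open>Weak solutions\<close>

lemma vec_nth_borel: "(\<lambda>x. x $ i) \<in> borel_measurable (borel :: ('a::euclidean_space ^ 'n) measure)"
  by (intro borel_measurable_continuous_onI continuous_intros)

lemma borel_vec_nth [measurable]:
  fixes f :: "'b \<Rightarrow> 'a::euclidean_space ^ 'n"
  assumes "f \<in> borel_measurable M"
  shows "(\<lambda>x. f x $ i) \<in> borel_measurable M"
  by (rule measurable_compose[OF assms vec_nth_borel])

lemma pd_const: "pd (\<lambda>q. c) v p = 0"
  by (simp add: pd_def frechet_derivative_const)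

lemma pd_test_fun_add_const:
  assumes "torus_fun K"
  shows "pd (\<lambda>q. test_fun n K x q + c) v p = pd (test_fun n K x) v p"
proof -
  have "((\<lambda>q. test_fun n K x q + c) has_derivative frechet_derivative (test_fun n K x) (at p)) (at p)"
    using elem_fun_frechet(1)[OF test_fun_elem[OF assms]] by (rule has_derivative_add_const)
  from frechet_derivative_at[OF this] show ?thesis by (simp add: pd_def)
qed

text \<open>The constant field \<open>a e_j\<close> serves to detect whether \<open>g_j\<close> is integrable.\<close>
definition test_vf :: "nat \<Rightarrow> (real^'d \<Rightarrow> real) \<Rightarrow> real^'d \<Rightarrow> 'd \<Rightarrow> 'd \<Rightarrow> real \<Rightarrow> real \<times> (real^'d) \<Rightarrow> real^'d" where
  "test_vf n K x i j a p = test_fun n K x p *\<^sub>R axis i 1 + a *\<^sub>R axis j 1"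

lemma test_vf_nth: "test_vf n K x i j a p $ k = (if k = i then test_fun n K x p else 0) + (if k = j then a else 0)"
  by (simp add: test_vf_def axis_def)

lemma test_vf_smooth:
  assumes "torus_fun K" shows "smooth_vf (test_vf n K x i j a)"
  unfolding smooth_vf_def test_vf_nth
proof
  fix k
  have "elem_fun True (\<lambda>p. (if k = i then test_fun n K x p else 0) + (if k = j then a else 0))"
    by (cases "k = i"; cases "k = j") (auto intro: elem_add elem_const test_fun_elem[OF assms])
  then show "smooth_fun (\<lambda>p. (if k = i then test_fun n K x p else 0) + (if k = j then a else 0))"
    by (rule elem_fun_smooth)
qed

lemma test_vf_periodic:
  assumes "torus_fun K" shows "space_periodic (test_vf n K x i j a)"
  using test_fun_periodic[OF assms, of n x] unfolding space_periodic_def test_vf_def by auto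

lemma test_vf_div:
  assumes "torus_fun K" shows "div_x (test_vf n K x i j a) p = - (fst p ^ n * pdx K i (x - snd p))"
proof -
  have "pd (\<lambda>q. test_vf n K x i j a q $ k) (0, axis k 1) p = (if k = i then - (fst p ^ n * pdx K i (x - snd p)) else 0)" for k
    unfolding test_vf_nth
    by (cases "k = i") (simp_all add: pd_const pd_test_fun_add_const[OF assms] test_fun_derivs(2)[OF assms])
  then show ?thesis by (simp add: div_x_def)
qed

lemma pdx_const: "pdx (\<lambda>_. c) i x = 0"
  by (simp add: pdx_def frechet_derivative_const)

lemma lborel_measurable_eq: "borel_measurable lborel = borel_measurable borel"
  by (rule measurable_cong_sets) auto

lemma test_fun_borel [measurable]: "torus_fun K \<Longrightarrow> test_fun n K x \<in> borel_measurable borel"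
  by (rule elem_fun_borel[OF test_fun_elem])

text \<open>The consequences of \<open>weak_solution\<close> for the fields \<open>test_vf\<close>
  and the functions \<open>test_fun\<close>, with one gradient \<open>g\<close> fixed. As
  \<open>0 ^ n\<close> is 1 only for \<open>n = 0\<close>, the initial term appears in that case
  alone. The flux term stays a set integral over \<open>Omega T\<close>, since
  \<open>integral_cylM\<close> asks for measurability, which here depends on
  \<open>D\<close>.\<close>

definition grad_data :: "(real \<Rightarrow> real^'d^'d) \<Rightarrow> real \<Rightarrow> (real^'d \<Rightarrow> real) \<Rightarrow> (real \<times> (real^'d) \<Rightarrow> real)
    \<Rightarrow> (real \<times> (real^'d) \<Rightarrow> real^'d) \<Rightarrow> bool" where
  "grad_data D T u0 u g \<longleftrightarrow> u \<in> borel_measurable borel \<and> g \<in> borel_measurable borel \<and>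
     (\<forall>p\<in>{0..T} \<times> UNIV. u p \<in> {0..1}) \<and> (\<forall>x. u (0, x) = u0 x) \<and>
     integrable (cylM T) (\<lambda>p. (norm (g p))\<^sup>2 / (u p * (1 - u p))) \<and>
     (\<forall>n K x i j a. torus_fun K \<longrightarrow> (\<integral>p. fst p ^ n * (pdx K i (x - snd p) * u p) \<partial>cylM T)
        = (\<integral>p. g p \<bullet> test_vf n K x i j a p \<partial>cylM T)) \<and>
     (\<forall>n K x. torus_fun K \<longrightarrow> T ^ n * conv K (\<lambda>y. u (T, y)) x - 0 ^ n * conv K u0 x
        = (\<integral>p. real n * fst p ^ (n - 1) * (K (x - snd p) * u p) \<partial>cylM T)
          - (LINT p:Omega T|lborel. grad_x (test_fun n K x) p \<bullet> (D (u p) *v g p)))"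

lemma weak_solution_grad_data:
  assumes "weak_solution D T u0 u" obtains g where "grad_data D T u0 u g"
proof -
  from assms obtain g :: "real \<times> (real^'a) \<Rightarrow> real^'a" where
    um [measurable]: "u \<in> borel_measurable borel" and gm [measurable]: "g \<in> borel_measurable borel"
    and b: "\<forall>p\<in>{0..T} \<times> UNIV. u p \<in> {0..1}" "\<forall>x. u (0, x) = u0 x"
    and i: "set_integrable lborel (Omega T) (\<lambda>p. (norm (g p))\<^sup>2 / (u p * (1 - u p)))"
    and e1: "\<And>\<phi>. smooth_vf \<phi> \<Longrightarrow> space_periodic \<phi> \<Longrightarrow>
       (LINT p:Omega T|lborel. u p * div_x \<phi> p) = - (LINT p:Omega T|lborel. g p \<bullet> \<phi> p)"
    and e2: "\<And>\<phi>. smooth_fun \<phi> \<Longrightarrow> space_periodic \<phi> \<Longrightarrow>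
       (LINT x:cube|lborel. \<phi> (T, x) * u (T, x)) - (LINT x:cube|lborel. \<phi> (0, x) * u (0, x))
           = (LINT p:Omega T|lborel. dt \<phi> p * u p)
             - (LINT p:Omega T|lborel. grad_x \<phi> p \<bullet> (D (u p) *v g p))"
    unfolding weak_solution_def lborel_measurable_eq by auto
  have i': "integrable (cylM T) (\<lambda>p. (norm (g p))\<^sup>2 / (u p * (1 - u p)))"
    using i by (subst integrable_cylM[symmetric]) auto
  have 1: "(\<integral>p. fst p ^ n * (pdx K i (x - snd p) * u p) \<partial>cylM T) = (\<integral>p. g p \<bullet> test_vf n K x i j a p \<partial>cylM T)"
    if K: "torus_fun K" for n K x i j a
  proof -
    have [measurable]: "pdx K i \<in> borel_measurable borel" by (rule torus_fun_borel[OF torus_fun_pdx[OF K]])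
    have [measurable]: "test_vf n K x i j a \<in> borel_measurable borel"
      unfolding test_vf_def[abs_def] using test_fun_borel[OF K] by measurable
    have "(LINT p:Omega T|lborel. u p * - (fst p ^ n * pdx K i (x - snd p))) = - (LINT p:Omega T|lborel. g p \<bullet> test_vf n K x i j a p)"
      using e1[OF test_vf_smooth[OF K] test_vf_periodic[OF K], of n x i j a] by (simp only: test_vf_div[OF K])
    moreover have "(LINT p:Omega T|lborel. u p * - (fst p ^ n * pdx K i (x - snd p))) = (\<integral>p. u p * - (fst p ^ n * pdx K i (x - snd p)) \<partial>cylM T)"
      by (rule integral_cylM) measurable
    moreover have "(LINT p:Omega T|lborel. g p \<bullet> test_vf n K x i j a p) = (\<integral>p. g p \<bullet> test_vf n K x i j a p \<partial>cylM T)"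
      by (rule integral_cylM) measurable
    moreover have "(\<integral>p. u p * - (fst p ^ n * pdx K i (x - snd p)) \<partial>cylM T) = - (\<integral>p. fst p ^ n * (pdx K i (x - snd p) * u p) \<partial>cylM T)"
      by (simp add: mult_ac flip: integral_minus)
    ultimately show ?thesis by simp
  qed
  have 2: "T ^ n * conv K (\<lambda>y. u (T, y)) x - 0 ^ n * conv K u0 x
        = (\<integral>p. real n * fst p ^ (n - 1) * (K (x - snd p) * u p) \<partial>cylM T)
          - (LINT p:Omega T|lborel. grad_x (test_fun n K x) p \<bullet> (D (u p) *v g p))" if K: "torus_fun K" for n K x
  proof -
    have [measurable]: "K \<in> borel_measurable borel" by (rule torus_fun_borel[OF K])
    have s: "(LINT y:cube|lborel. test_fun n K x (t, y) * u (t, y)) = t ^ n * conv K (\<lambda>y. u (t, y)) x" for t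
    proof -
      have "(LINT y:cube|lborel. test_fun n K x (t, y) * u (t, y)) = (\<integral>y. t ^ n * (K (x - y) * u (t, y)) \<partial>cubeM)"
        unfolding test_fun_def fst_conv snd_conv mult.assoc
        by (rule integral_cubeM[symmetric]) measurable
      then show ?thesis by (simp add: conv_def)
    qed
    have "(LINT p:Omega T|lborel. dt (test_fun n K x) p * u p) = (LINT p:Omega T|lborel. real n * fst p ^ (n - 1) * (K (x - snd p) * u p))"
      by (simp add: test_fun_derivs(1)[OF K] mult.assoc)
    also have "\<dots> = (\<integral>p. real n * fst p ^ (n - 1) * (K (x - snd p) * u p) \<partial>cylM T)"
      by (rule integral_cylM) measurable
    finally show ?thesis
      using e2[OF test_fun_smooth[OF K] test_fun_periodic[OF K], of n x] s[of T] s[of 0] by (simp add: b(2))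
  qed
  show ?thesis by (rule that[of g]) (use um gm b i' 1 2 in \<open>auto simp: grad_data_def\<close>)
qed

section \<open>Conservation of mass and the degenerate case\<close>

lemma cylM_bounded:
  assumes [measurable]: "u \<in> borel_measurable borel" and "\<forall>p\<in>{0..T} \<times> UNIV. u p \<in> {0..1::real}"
  shows "AE p in cylM T. u p \<in> {0..1}" "integrable (cylM T) u"
    "t \<in> {0..T} \<Longrightarrow> integrable cubeM (\<lambda>y. u (t, y))"
proof -
  show 1: "AE p in cylM T. u p \<in> {0..1}"
    using AE_cylM_fst by eventually_elim (use assms(2) in \<open>auto simp: mem_Times_iff\<close>)
  show "integrable (cylM T) u"
  proof (rule cylM.integrable_const_bound[where B=1])
    show "AE p in cylM T. norm (u p) \<le> 1" using 1 by eventually_elim auto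
  qed (simp add: borel_measurable_cylM)
  show "integrable cubeM (\<lambda>y. u (t, y))" if "t \<in> {0..T}"
    by (rule cubeM.integrable_const_bound[where B=1]) (use assms(2) that in \<open>auto simp: mem_Times_iff\<close>)
qed

text \<open>The constant kernel has zero gradient, so the flux disappears. The exponent
  \<open>n = 0\<close> equates terminal and initial mass; the others give all time moments of the
  mean, and these are the moments of a constant.\<close>

lemma mean_conserved:
  assumes "grad_data D T u0 u g" "T > 0"
  shows "AE t in timeM T. (\<integral>y. u (t, y) \<partial>cubeM) = (\<integral>y. u0 y \<partial>cubeM)"
proof -
  from assms have um [measurable]: "u \<in> borel_measurable borel" and b: "\<forall>p\<in>{0..T} \<times> UNIV. u p \<in> {0..1}"
    and u0: "\<And>x. u (0, x) = u0 x"
    and e: "\<And>n. T ^ n * conv (\<lambda>_. 1) (\<lambda>y. u (T, y)) 0 - 0 ^ n * conv (\<lambda>_. 1) u0 0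
        = (\<integral>p. real n * fst p ^ (n - 1) * (1 * u p) \<partial>cylM T)
          - (LINT p:Omega T|lborel. grad_x (test_fun n (\<lambda>_. 1) 0) p \<bullet> (D (u p) *v g p))"
    unfolding grad_data_def using torus_fun_const by blast+
  define m where "m = (\<integral>y. u0 y \<partial>cubeM)"
  have z: "grad_x (test_fun n (\<lambda>_. 1) (0::real^'a)) p = 0" for n p
    by (simp add: test_fun_derivs(3)[OF torus_fun_const] pdx_const vec_eq_iff)
  have ui: "integrable (cylM T) u" by (rule cylM_bounded(2)[OF um b])
  have e': "T ^ n * conv (\<lambda>_. 1) (\<lambda>y. u (T, y)) 0 - 0 ^ n * m = real n * (\<integral>p. fst p ^ (n - 1) * u p \<partial>cylM T)" for n
    using e[of n] by (simp add: z conv_def m_def mult.assoc set_lebesgue_integral_def)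
  have aT: "conv (\<lambda>_. 1) (\<lambda>y. u (T, y)) 0 = m" using e'[of 0] by simp
  have "AE t in timeM T. (\<integral>y. u (t, y) \<partial>cubeM) - m = 0"
  proof (rule moments_zero)
    have mi: "integrable (timeM T) (\<lambda>t. \<integral>y. u (t, y) \<partial>cubeM)" by (rule cyl.integrable_fst'[OF ui])
    then show "integrable (timeM T) (\<lambda>t. (\<integral>y. u (t, y) \<partial>cubeM) - m)" by simp
    fix n
    have "T ^ Suc n * m = real (Suc n) * (\<integral>p. fst p ^ n * u p \<partial>cylM T)" using e'[of "Suc n"] by (simp add: aT)
    then have "T ^ Suc n * m = real (Suc n) * (\<integral>t. t ^ n * (\<integral>y. u (t, y) \<partial>cubeM) \<partial>timeM T)"
      by (simp only: slice_moment[OF ui])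
    then have 1: "(\<integral>t. t ^ n * (\<integral>y. u (t, y) \<partial>cubeM) \<partial>timeM T) = T ^ Suc n * m / real (Suc n)"
      by (simp del: of_nat_Suc power_Suc)
    have "(\<integral>t. real (Suc n) * t ^ n * indicator {0..T} t \<partial>lborel) = T ^ Suc n - 0 ^ Suc n"
    proof (rule integral_FTC_Icc_real)
      show "\<And>x. ((\<lambda>t. t ^ Suc n) has_real_derivative real (Suc n) * x ^ n) (at x)"
        using DERIV_pow[of "Suc n"] by simp
    qed (use assms(2) in \<open>auto intro!: continuous_intros\<close>)
    moreover have "(\<integral>t. real (Suc n) * t ^ n \<partial>timeM T) = (\<integral>t. indicator {0..T} t * (real (Suc n) * t ^ n) \<partial>lborel)"
      by (rule integral_timeM) measurable
    ultimately have "real (Suc n) * (\<integral>t. t ^ n \<partial>timeM T) = T ^ Suc n"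
      by (simp add: mult.commute del: of_nat_Suc power_Suc)
    then have 2: "(\<integral>t. t ^ n * m \<partial>timeM T) = T ^ Suc n * m / real (Suc n)"
      by (simp add: field_simps del: of_nat_Suc power_Suc)
    have "integrable (timeM T) (\<lambda>t. t ^ n * (\<integral>y. u (t, y) \<partial>cubeM))" "integrable (timeM T) (\<lambda>t. t ^ n * m)"
      by (intro timeM_integrable_power mi timeM.integrable_const)+
    then show "(\<integral>t. t ^ n * ((\<integral>y. u (t, y) \<partial>cubeM) - m) \<partial>timeM T) = 0"
      by (simp only: right_diff_distrib Bochner_Integration.integral_diff 1 2)
  qed
  then show ?thesis by (auto elim!: eventually_mono simp: m_def)
qed

text \<open>Every mollification is differentiable along the axes with vanishing derivatives, hence
  invariant under all translations. Its constant value is the mean, which mollification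
  preserves.\<close>

lemma zero_gradient_const:
  fixes v :: "real^'d \<Rightarrow> real"
  assumes v: "integrable cubeM v" and z: "\<And>N i x. conv (pdx (cos_kernel N) i) v x = 0"
  shows "AE x in cubeM. v x = (\<integral>y. v y \<partial>cubeM)"
proof (rule conv_eq_0_imp[OF v])
  fix N x
  let ?H = "conv (cos_kernel N) v"
  have ax: "?H (y + s *\<^sub>R axis i 1) = ?H y" for y s i
    using DERIV_isconst_all[of "\<lambda>s. ?H (y + s *\<^sub>R axis i 1)" s 0] conv_DERIV[OF cos_kernel_torus v] by (simp add: z)
  have "?H (y + (\<Sum>i\<in>A. z $ i *\<^sub>R axis i 1)) = ?H y" if "finite A" for A y and z :: "real^'d"
    using that
  proof (induction A arbitrary: y)
    case (insert i A)
    have "?H (y + (\<Sum>i\<in>insert i A. z $ i *\<^sub>R axis i 1)) = ?H ((y + z $ i *\<^sub>R axis i 1) + (\<Sum>i\<in>A. z $ i *\<^sub>R axis i 1))"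
      using insert by (simp add: add.assoc)
    then show ?case using insert.IH ax by simp
  qed simp
  note inv = this
  have c: "?H (y + z) = ?H y" for y z
  proof -
    have "(\<Sum>i\<in>UNIV. z $ i *\<^sub>R axis i 1) = z"
      by (rule basis_expansion[of z, unfolded scalar_mult_eq_scaleR])
    moreover have "?H (y + (\<Sum>i\<in>UNIV. z $ i *\<^sub>R axis i 1)) = ?H y" by (rule inv) simp
    ultimately show ?thesis by (simp only:)
  qed
  have c': "?H y = ?H x" for y using c[of x "y - x"] by simp
  have "(\<integral>y. v y \<partial>cubeM) = (\<integral>y. ?H y \<partial>cubeM)" by (rule conv_integral[OF v, symmetric])
  also have "\<dots> = (\<integral>y. ?H x \<partial>(cubeM :: (real^'d) measure))"
    by (intro Bochner_Integration.integral_cong c') simp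
  finally show "?H x = (\<integral>y. v y \<partial>cubeM)" by simp
qed

text \<open>If \<open>g_j\<close> is not integrable, then for every test field one of \<open>g . \<phi>\<close> and \<open>g . (\<phi> + e_j)\<close> is not
  integrable either, so its integral is 0 by convention.\<close>
lemma grad_data_cases:
  fixes u :: "real \<times> (real^'d) \<Rightarrow> real" and g :: "real \<times> (real^'d) \<Rightarrow> real^'d"
  assumes gd: "grad_data D T u0 u g"
  obtains (good) "\<And>i. integrable (cylM T) (\<lambda>p. g p $ i)" "\<And>i. weak_grad T u i (\<lambda>p. g p $ i)"
  | (bad) i where "\<not> integrable (cylM T) (\<lambda>p. g p $ i)" "\<And>i. weak_grad T u i (\<lambda>p. 0)"
proof -
  from gd have [measurable]: "g \<in> borel_measurable borel"
    and e: "\<And>n K x i j a. torus_fun K \<Longrightarrow> (\<integral>p. fst p ^ n * (pdx K i (x - snd p) * u p) \<partial>cylM T)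
        = (\<integral>p. g p \<bullet> test_vf n K x i j a p \<partial>cylM T)"
    unfolding grad_data_def by blast+
  have inn: "g p \<bullet> test_vf n K x i j a p = fst p ^ n * (K (x - snd p) * g p $ i) + a * g p $ j" for p n K x i j a
    by (simp add: test_vf_def inner_add_right inner_axis test_fun_def mult_ac)
  show ?thesis
  proof (cases "\<forall>i. integrable (cylM T) (\<lambda>p. g p $ i)")
    case True
    show ?thesis
    proof (rule good)
      show "weak_grad T u i (\<lambda>p. g p $ i)" for i
        unfolding weak_grad_def using e[of _ _ i _ i 0] by (simp add: inn)
    qed (use True in auto)
  next
    case False
    then obtain j where j: "\<not> integrable (cylM T) (\<lambda>p. g p $ j)" by blast
    show ?thesis
    proof (rule bad[OF j])
      fix i
      show "weak_grad T u i (\<lambda>p. 0)"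
        unfolding weak_grad_def
      proof (intro allI impI)
        fix K :: "real^'d \<Rightarrow> real" and n x assume K: "torus_fun K"
        let ?h = "\<lambda>p. fst p ^ n * (K (x - snd p) * g p $ i)"
        have "(\<integral>p. fst p ^ n * (pdx K i (x - snd p) * u p) \<partial>cylM T) = 0"
        proof (cases "integrable (cylM T) ?h")
          case True
          have "\<not> integrable (cylM T) (\<lambda>p. ?h p + 1 * g p $ j)"
          proof
            assume "integrable (cylM T) (\<lambda>p. ?h p + 1 * g p $ j)"
            from Bochner_Integration.integrable_diff[OF this True] j show False by simp
          qed
          from not_integrable_integral_eq[OF this] show ?thesis
            using e[OF K, of n i x j 1] by (simp only: inn)
        next
          case False
          from not_integrable_integral_eq[OF this] show ?thesis
            using e[OF K, of n i x j 0] by (simp add: inn)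
        qed
        then show "(\<integral>p. fst p ^ n * (pdx K i (x - snd p) * u p) \<partial>cylM T) = (\<integral>p. fst p ^ n * (K (x - snd p) * 0) \<partial>cylM T)"
          by simp
      qed
    qed
  qed
qed

text \<open>A zero weak gradient makes \<open>u\<close> constant on slices, and the constant is the
  conserved mean. If this were strictly between 0 and 1, the weight in the dissipation integral
  would be a positive constant, and \<open>g\<close> would be square integrable and thus integrable,
  against \<open>bad\<close>.\<close>

lemma bad_case_const:
  fixes u :: "real \<times> (real^'d) \<Rightarrow> real" and g :: "real \<times> (real^'d) \<Rightarrow> real^'d"
  assumes gd: "grad_data D T u0 u g" and T: "T > 0"
    and bad: "\<not> integrable (cylM T) (\<lambda>p. g p $ j)" "\<And>i. weak_grad T u i (\<lambda>p. 0)"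
  shows "(\<integral>y. u0 y \<partial>cubeM) \<in> {0, 1}"
    and "AE p in cylM T. u p = (\<integral>y. u0 y \<partial>cubeM)"
proof -
  from gd have um [measurable]: "u \<in> borel_measurable borel" and gm [measurable]: "g \<in> borel_measurable borel"
    and b: "\<forall>p\<in>{0..T} \<times> UNIV. u p \<in> {0..1}" and u0: "\<And>x. u (0, x) = u0 x"
    and gi: "integrable (cylM T) (\<lambda>p. (norm (g p))\<^sup>2 / (u p * (1 - u p)))"
    unfolding grad_data_def by blast+
  note ub = cylM_bounded[OF um b]
  define m where "m = (\<integral>y. u0 y \<partial>cubeM)"
  have "AE t in timeM T. \<forall>N. \<forall>i\<in>UNIV. \<forall>x. conv (pdx (cos_kernel N) i) (\<lambda>y. u (t, y)) x = conv (cos_kernel N) (\<lambda>y. 0) x"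
    unfolding AE_all_countable
    by (intro allI, subst AE_ball_countable)
      (auto intro: countable_finite weak_grad_slice[OF bad(2) ub(2) _ cos_kernel_torus])
  then have "AE t in timeM T. AE x in cubeM. u (t, x) = m"
    using mean_conserved[OF gd T] cyl.AE_integrable_fst'[OF ub(2)]
  proof eventually_elim
    case (elim t)
    have "AE x in cubeM. u (t, x) = (\<integral>y. u (t, y) \<partial>cubeM)"
      by (rule zero_gradient_const) (use elim in \<open>auto simp: conv_def\<close>)
    then show ?case using elim by (simp add: m_def)
  qed
  then show um': "AE p in cylM T. u p = (\<integral>y. u0 y \<partial>cubeM)"
    unfolding m_def[symmetric] by (rule AE_cylM_I) measurable
  have u01: "u0 y \<in> {0..1}" for y using bspec[OF b, of "(0, y)"] T u0[of y] by simp
  have u0i: "integrable cubeM u0" using ub(3)[of 0] T u0 by simp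
  have "0 \<le> m" unfolding m_def using u01 by (intro Bochner_Integration.integral_nonneg) auto
  moreover have "m \<le> (\<integral>y. 1 \<partial>(cubeM :: (real^'d) measure))" unfolding m_def using u01 u0i by (intro integral_mono) auto
  ultimately have m01: "0 \<le> m" "m \<le> 1" by simp_all
  show "(\<integral>y. u0 y \<partial>cubeM) \<in> {0, 1}"
  proof (rule ccontr)
    assume "(\<integral>y. u0 y \<partial>cubeM) \<notin> {0, 1}"
    then have m: "0 < m" "m < 1" using m01 by (auto simp: m_def[symmetric])
    have "integrable (cylM T) (\<lambda>p. m * (1 - m) * ((norm (g p))\<^sup>2 / (u p * (1 - u p))))"
      using gi by (rule integrable_mult_right)
    moreover have "AE p in cylM T. m * (1 - m) * ((norm (g p))\<^sup>2 / (u p * (1 - u p))) = (norm (g p))\<^sup>2"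
      using um' by eventually_elim (use m in \<open>simp add: m_def[symmetric]\<close>)
    ultimately have "integrable (cylM T) (\<lambda>p. (norm (g p))\<^sup>2)"
      by (subst (asm) integrable_cong_AE) (auto simp: borel_measurable_cylM)
    then have "integrable (cylM T) (\<lambda>p. norm (g p))"
      by (rule L2_integrable_cylM[rotated]) measurable
    then have "integrable (cylM T) (\<lambda>p. g p $ j)"
    proof (rule Bochner_Integration.integrable_bound)
      show "(\<lambda>p. g p $ j) \<in> borel_measurable (cylM T)" unfolding borel_measurable_cylM by measurable
      show "AE p in cylM T. norm (g p $ j) \<le> norm (norm (g p))"
        by (intro AE_I2) (simp add: component_le_norm_cart)
    qed
    with bad(1) show False by simp
  qed
qed

text \<open>A function with values in the unit interval and mean 0 or 1 has to equal its mean. This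
  settles one solution, whatever its gradient, once the other is degenerate.\<close>

lemma extreme_mean_const:
  fixes u :: "real \<times> (real^'d) \<Rightarrow> real" and g :: "real \<times> (real^'d) \<Rightarrow> real^'d"
  assumes gd: "grad_data D T u0 u g" and T: "T > 0" and m: "(\<integral>y. u0 y \<partial>cubeM) \<in> {0, 1}"
  shows "AE p in cylM T. u p = (\<integral>y. u0 y \<partial>cubeM)"
proof -
  from gd have um [measurable]: "u \<in> borel_measurable borel" 
    and b: "\<forall>p\<in>{0..T} \<times> UNIV. u p \<in> {0..1}"
    unfolding grad_data_def by blast+
  define m where "m = (\<integral>y. u0 y \<partial>cubeM)"
  have "AE t in timeM T. AE x in cubeM. u (t, x) = m"
    using mean_conserved[OF gd T] AE_timeM_Icc
  proof eventually_elim
    case (elim t)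
    have ui: "integrable cubeM (\<lambda>x. u (t, x))" by (rule cylM_bounded(3)[OF um b elim(2)])
    have ub: "u (t, x) \<in> {0..1}" for x using b elim(2) by (auto simp: mem_Times_iff)
    have "(\<integral>x. \<bar>u (t, x) - m\<bar> \<partial>cubeM) = 0"
    proof (cases "m = 0")
      case True
      then show ?thesis using elim(1) ub by (simp add: m_def abs_of_nonneg)
    next
      case False
      then have "m = 1" using m by (simp add: m_def)
      then have "\<bar>u (t, x) - m\<bar> = 1 - u (t, x)" for x using ub[of x] by auto
      then have "(\<integral>x. \<bar>u (t, x) - m\<bar> \<partial>cubeM) = (\<integral>x. 1 - u (t, x) \<partial>cubeM)" by simp
      then show ?thesis using elim(1) ui \<open>m = 1\<close> by (simp add: m_def)
    qed
    then have "AE x in cubeM. \<bar>u (t, x) - m\<bar> = 0" using ui by (subst (asm) integral_nonneg_eq_0_iff_AE) auto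
    then show ?case by (auto elim!: eventually_mono)
  qed
  then show ?thesis unfolding m_def[symmetric] by (rule AE_cylM_I) measurable
qed

text \<open>The first claim is \<open>weak_derivative_level_set\<close> at the levels 0 and 1.
  Elsewhere \<open>u p * (1 - u p)\<close> is positive and at most 1, so dividing by it only
  enlarges; hence the dissipation integral dominates the square of \<open>g\<close>.\<close>

lemma good_case:
  fixes u :: "real \<times> (real^'d) \<Rightarrow> real" and g :: "real \<times> (real^'d) \<Rightarrow> real^'d"
  assumes gd: "grad_data D T u0 u g"
    and good: "\<And>i. integrable (cylM T) (\<lambda>p. g p $ i)" "\<And>i. weak_grad T u i (\<lambda>p. g p $ i)"
  shows "AE p in cylM T. u p \<notin> {0<..<1} \<longrightarrow> g p = 0"
    and "integrable (cylM T) (\<lambda>p. (g p $ i)\<^sup>2)"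
proof -
  from gd have um [measurable]: "u \<in> borel_measurable borel" and gm [measurable]: "g \<in> borel_measurable borel"
    and b: "\<forall>p\<in>{0..T} \<times> UNIV. u p \<in> {0..1}"
    and gi: "integrable (cylM T) (\<lambda>p. (norm (g p))\<^sup>2 / (u p * (1 - u p)))"
    unfolding grad_data_def by blast+
  note ub = cylM_bounded[OF um b]
  have lev: "AE p in cylM T. u p = c \<longrightarrow> g p $ i = 0" for c i
  proof (rule AE_cylM_I)
    have "AE t in timeM T. \<forall>N. \<forall>x. conv (pdx (cos_kernel N) i) (\<lambda>y. u (t, y)) x = conv (cos_kernel N) (\<lambda>y. g (t, y) $ i) x"
      unfolding AE_all_countable using weak_grad_slice[OF good(2) ub(2) good(1) cos_kernel_torus] by blast
    then show "AE t in timeM T. AE x in cubeM. u (t, x) = c \<longrightarrow> g (t, x) $ i = 0"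
      using cyl.AE_integrable_fst'[OF ub(2)] cyl.AE_integrable_fst'[OF good(1)[of i]]
    proof eventually_elim
      case (elim t)
      show ?case
        by (rule weak_derivative_level_set[of "\<lambda>x. u (t, x)" "\<lambda>x. g (t, x) $ i" i c]) (use elim in auto)
    qed
  qed measurable
  have "AE p in cylM T. \<forall>c\<in>{0,1}. \<forall>i\<in>UNIV. u p = c \<longrightarrow> g p $ i = 0"
    by (subst AE_ball_countable, simp, intro ballI, subst AE_ball_countable) (auto intro: countable_finite lev)
  then show gz: "AE p in cylM T. u p \<notin> {0<..<1} \<longrightarrow> g p = 0"
    using ub(1) by eventually_elim (auto simp: vec_eq_iff)
  show "integrable (cylM T) (\<lambda>p. (g p $ i)\<^sup>2)"
  proof (rule Bochner_Integration.integrable_bound[OF gi])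
    show "AE p in cylM T. norm ((g p $ i)\<^sup>2) \<le> norm ((norm (g p))\<^sup>2 / (u p * (1 - u p)))"
      using gz
    proof eventually_elim
      case (elim p)
      have n: "(g p $ i)\<^sup>2 \<le> (norm (g p))\<^sup>2"
        using component_le_norm_cart[of "g p" i] by (simp add: abs_le_square_iff[symmetric])
      show ?case
      proof (cases "u p \<in> {0<..<1}")
        case True
        then have "0 < u p * (1 - u p)" "u p * (1 - u p) \<le> 1 * 1" by (simp, intro mult_mono, auto)
        then have "(norm (g p))\<^sup>2 / 1 \<le> (norm (g p))\<^sup>2 / (u p * (1 - u p))" by (intro divide_left_mono) auto
        with n have "norm ((g p $ i)\<^sup>2) \<le> (norm (g p))\<^sup>2 / (u p * (1 - u p))" by simp
        also have "\<dots> \<le> norm ((norm (g p))\<^sup>2 / (u p * (1 - u p)))" unfolding real_norm_def by (rule abs_ge_self)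
        finally show ?thesis .
      next
        case False
        then show ?thesis using elim by simp
      qed
    qed
  qed (simp add: borel_measurable_cylM)
qed

section \<open>Uniqueness\<close>

text \<open>The norm of a vector of vectors is the Frobenius norm, which dominates the operator norm
  by Cauchy-Schwarz applied row by row.\<close>

lemma norm_matrix_vector_le:
  fixes M :: "real^'d^'d" and a :: "real^'d"
  shows "norm (M *v a) \<le> norm M * norm a"
proof (rule power2_le_imp_le)
  have sq: "(norm x)\<^sup>2 = (\<Sum>i\<in>UNIV. (norm (x $ i))\<^sup>2)" for x :: "'b::real_normed_vector ^ 'd"
    by (simp add: norm_vec_def L2_set_def sum_nonneg)
  have "(norm (M *v a))\<^sup>2 = (\<Sum>i\<in>UNIV. (M $ i \<bullet> a)\<^sup>2)"
    by (simp add: sq matrix_vector_mul_component)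
  also have "\<dots> \<le> (\<Sum>i\<in>UNIV. (norm (M $ i))\<^sup>2 * (norm a)\<^sup>2)"
  proof (rule sum_mono)
    fix i
    have "\<bar>M $ i \<bullet> a\<bar> \<le> norm (M $ i) * norm a" by (rule Cauchy_Schwarz_ineq2)
    then have "\<bar>M $ i \<bullet> a\<bar>\<^sup>2 \<le> (norm (M $ i) * norm a)\<^sup>2" by (rule power_mono) simp
    then show "(M $ i \<bullet> a)\<^sup>2 \<le> (norm (M $ i))\<^sup>2 * (norm a)\<^sup>2" by (simp add: power_mult_distrib)
  qed
  also have "\<dots> = (norm M * norm a)\<^sup>2"
    by (simp add: power_mult_distrib sq[of M] sum_distrib_right)
  finally show "(norm (M *v a))\<^sup>2 \<le> (norm M * norm a)\<^sup>2" .
qed simp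

text \<open>Polarization turns the bound on the quadratic form into a bound on the entries.\<close>
lemma entry_bound:
  fixes M :: "real^'d^'d"
  assumes sym: "transpose M = M" and c: "c > 0"
    and q: "\<And>\<xi>. inverse c * norm \<xi> ^ 2 \<le> \<xi> \<bullet> (M *v \<xi>)" "\<And>\<xi>. \<xi> \<bullet> (M *v \<xi>) \<le> c * norm \<xi> ^ 2"
  shows "\<bar>M $ i $ j\<bar> \<le> c"
proof -
  let ?e = "\<lambda>i. axis i 1 :: real^'d"
  have ent: "?e i \<bullet> (M *v ?e j) = M $ i $ j" for i j
    by (simp add: inner_axis' matrix_vector_mul_component inner_axis)
  have s: "M $ j $ i = M $ i $ j" using sym by (metis transpose_def vec_lambda_beta)
  have "4 * M $ i $ j = (?e i + ?e j) \<bullet> (M *v (?e i + ?e j)) - (?e i - ?e j) \<bullet> (M *v (?e i - ?e j))"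
    by (simp add: inner_add_left inner_diff_left inner_add_right inner_diff_right
        matrix_vector_right_distrib matrix_vector_mult_diff_distrib ent s)
  moreover have q0: "0 \<le> \<xi> \<bullet> (M *v \<xi>)" for \<xi>
    using q(1)[of \<xi>] c by (meson order_trans mult_nonneg_nonneg zero_le_power2 inverse_nonnegative_iff_nonnegative less_imp_le)
  \<comment> \<open>The vectors \<open>?e i + ?e j\<close> and \<open>?e i - ?e j\<close> have norm
    at most 2, so both quadratic forms lie between 0 and \<open>4 * c\<close>; their difference is
    four times the entry.\<close>
  moreover have up: "\<xi> \<bullet> (M *v \<xi>) \<le> c * 4" if "norm \<xi> \<le> 2" for \<xi>
  proof -
    have "(norm \<xi>)\<^sup>2 \<le> 2\<^sup>2" using that by (rule power_mono) simp
    then have "c * (norm \<xi>)\<^sup>2 \<le> c * 4" using c by simp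
    then show ?thesis using q(2)[of \<xi>] by linarith
  qed
  moreover have "norm (?e i + ?e j) \<le> 2" "norm (?e i - ?e j) \<le> 2"
    using norm_triangle_ineq[of "?e i" "?e j"] norm_triangle_ineq4[of "?e i" "?e j"] by simp_all
  ultimately show ?thesis
    using q0[of "?e i + ?e j"] q0[of "?e i - ?e j"] up[of "?e i + ?e j"] up[of "?e i - ?e j"] by linarith
qed

text \<open>Decompose \<open>A *v a - B *v b\<close> into \<open>B *v (a - b)\<close> and
  \<open>(A - B) *v a\<close>, so that ellipticity of one matrix suffices and only \<open>a\<close>
  remains on the right. The constant \<open>c / 4\<close> is the one in Young's inequality when the
  whole coercive term, with coefficient \<open>inverse c\<close>, is spent on absorbing
  \<open>a - b\<close>.\<close>

lemma coercive_difference: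
  fixes A B :: "real^'d^'d" and a b :: "real^'d"
  assumes c: "c > 0" and q: "\<And>\<xi>. inverse c * norm \<xi> ^ 2 \<le> \<xi> \<bullet> (B *v \<xi>)"
  shows "- ((a - b) \<bullet> (A *v a - B *v b)) \<le> c / 4 * (norm (A - B) * norm a)\<^sup>2"
proof -
  define n where "n = norm (a - b)"
  define X where "X = norm (A - B) * norm a"
  have eq: "A *v a - B *v b = B *v (a - b) + (A - B) *v a"
    by (simp add: matrix_vector_mult_diff_distrib matrix_vector_mult_diff_rdistrib)
  have "\<bar>(a - b) \<bullet> ((A - B) *v a)\<bar> \<le> n * norm ((A - B) *v a)"
    unfolding n_def by (rule Cauchy_Schwarz_ineq2)
  also have "\<dots> \<le> n * X" unfolding X_def n_def
    by (intro mult_left_mono norm_matrix_vector_le) simp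
  finally have "- ((a - b) \<bullet> ((A - B) *v a)) \<le> n * X" by linarith
  moreover have "inverse c * n\<^sup>2 \<le> (a - b) \<bullet> (B *v (a - b))" unfolding n_def by (rule q)
  moreover have "n * X \<le> inverse c * n\<^sup>2 + c / 4 * X\<^sup>2"
  proof -
    have "0 \<le> inverse c * (n - c / 2 * X)\<^sup>2" using c by simp
    also have "\<dots> = inverse c * n\<^sup>2 - n * X + c / 4 * X\<^sup>2"
      using c by (simp add: power2_eq_square field_simps)
    finally show ?thesis by linarith
  qed
  ultimately show ?thesis unfolding eq inner_add_right X_def[symmetric] by linarith
qed

text \<open>A smooth convex substitute for the absolute value, within \<open>e\<close> of it. The
  second derivative times the modulus of \<open>r\<close> is at most 1 because \<open>s r\<close>
  dominates both \<open>e\<close> and the modulus of \<open>r\<close>.\<close>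

lemma smooth_abs_facts:
  fixes e r a b :: real
  defines "s \<equiv> \<lambda>r. sqrt (r\<^sup>2 + e\<^sup>2)"
  assumes e: "e > 0"
  shows "((\<lambda>r. s r - e) has_real_derivative r / s r) (at r)"
    and "((\<lambda>r. r / s r) has_real_derivative e\<^sup>2 / s r ^ 3) (at r)"
    and "continuous_on UNIV (\<lambda>r. e\<^sup>2 / s r ^ 3)"
    and "(s b - e) - (s a - e) \<le> b / s b * (b - a)"
    and "\<bar>r / s r\<bar> \<le> 1" and "\<bar>e\<^sup>2 / s r ^ 3\<bar> \<le> 1 / e"
    and "e\<^sup>2 / s r ^ 3 * \<bar>r\<bar> \<le> 1" and "0 \<le> e\<^sup>2 / s r ^ 3" and "\<bar>r\<bar> \<le> s r"
proof -
  have pos: "0 < r\<^sup>2 + e\<^sup>2" for r using e by (simp add: add_nonneg_pos)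
  have sp: "0 < s r" for r unfolding s_def using pos by simp
  have s2: "(s r)\<^sup>2 = r\<^sup>2 + e\<^sup>2" for r unfolding s_def using pos[of r] by simp
  have se: "e \<le> s r" for r unfolding s_def using e by (intro real_le_rsqrt) simp
  show sr: "\<bar>r\<bar> \<le> s r" for r unfolding s_def by (intro real_le_rsqrt) simp
  have ds: "(s has_real_derivative r / s r) (at r)" for r
    unfolding s_def[abs_def] using pos[of r]
    by (auto intro!: derivative_eq_intros simp: field_simps)
  show "((\<lambda>r. s r - e) has_real_derivative r / s r) (at r)"
    using DERIV_diff[OF ds DERIV_const[of e]] by simp
  have "((\<lambda>r. r / s r) has_real_derivative (1 * s r - r * (r / s r)) / (s r * s r)) (at r)"
    by (rule DERIV_divide[OF DERIV_ident ds]) (use sp[of r] in simp)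
  moreover have "(1 * s r - r * (r / s r)) / (s r * s r) = e\<^sup>2 / s r ^ 3"
  proof -
    have "1 * s r - r * (r / s r) = ((s r)\<^sup>2 - r\<^sup>2) / s r"
      using sp[of r] by (simp add: field_simps power2_eq_square)
    then show ?thesis using sp[of r] by (simp add: s2 power3_eq_cube)
  qed
  ultimately show "((\<lambda>r. r / s r) has_real_derivative e\<^sup>2 / s r ^ 3) (at r)" by simp
  have "s r \<noteq> 0" for r using sp[of r] by simp
  then show "continuous_on UNIV (\<lambda>r. e\<^sup>2 / s r ^ 3)"
    unfolding s_def by (intro continuous_intros) auto
  \<comment> \<open>Cauchy-Schwarz for the plane vectors \<open>(a, e)\<close> and
    \<open>(b, e)\<close>; divided by \<open>s b\<close>, it becomes the tangent inequality that
    expresses convexity.\<close>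
  have "a * b + e\<^sup>2 \<le> s a * s b"
  proof (rule power2_le_imp_le)
    have "0 \<le> e\<^sup>2 * (a - b)\<^sup>2" by simp
    then show "(a * b + e\<^sup>2)\<^sup>2 \<le> (s a * s b)\<^sup>2"
      unfolding power_mult_distrib s2 by (simp add: power2_eq_square algebra_simps)
    show "0 \<le> s a * s b" using sp[of a] sp[of b] by simp
  qed
  then have "s b * s b - s a * s b \<le> b * (b - a)"
    using s2[of b] by (simp add: power2_eq_square algebra_simps)
  then show "(s b - e) - (s a - e) \<le> b / s b * (b - a)"
    using sp[of b] by (simp add: field_simps)
  show "\<bar>r / s r\<bar> \<le> 1" using sr[of r] sp[of r] by (simp add: abs_divide)
  show f0: "0 \<le> e\<^sup>2 / s r ^ 3" using sp[of r] by simp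
  have "e\<^sup>2 / s r ^ 3 \<le> e\<^sup>2 / e ^ 3"
    using se[of r] e by (intro divide_left_mono power_mono mult_pos_pos zero_less_power sp) auto
  also have "e\<^sup>2 / e ^ 3 = 1 / e" using e by (simp add: power2_eq_square power3_eq_cube)
  finally show "\<bar>e\<^sup>2 / s r ^ 3\<bar> \<le> 1 / e" using f0 by simp
  have "e\<^sup>2 * \<bar>r\<bar> \<le> (s r)\<^sup>2 * s r"
    using sr[of r] s2[of r] by (intro mult_mono) auto
  then show "e\<^sup>2 / s r ^ 3 * \<bar>r\<bar> \<le> 1"
    using sp[of r] by (simp add: field_simps power2_eq_square power3_eq_cube)
qed

lemma smooth_abs_tendsto:
  fixes r :: real and e :: "nat \<Rightarrow> real"
  assumes e: "e \<longlonglongrightarrow> 0"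
  shows "(\<lambda>n. (e n)\<^sup>2 / sqrt (r\<^sup>2 + (e n)\<^sup>2) ^ 3 * \<bar>r\<bar>) \<longlonglongrightarrow> 0"
proof (cases "r = 0")
  case False
  have "(\<lambda>n. (e n)\<^sup>2 / sqrt (r\<^sup>2 + (e n)\<^sup>2) ^ 3 * \<bar>r\<bar>) \<longlonglongrightarrow> 0\<^sup>2 / sqrt (r\<^sup>2 + 0\<^sup>2) ^ 3 * \<bar>r\<bar>"
    using False by (intro tendsto_intros e) auto
  then show ?thesis by simp
qed simp

section \<open>Fluxes and the equation for the difference\<close>

lemma L2_sum:
  fixes a :: "'i \<Rightarrow> 'a \<Rightarrow> real"
  assumes "finite I" "\<And>i. i \<in> I \<Longrightarrow> a i \<in> borel_measurable M" "\<And>i. i \<in> I \<Longrightarrow> integrable M (\<lambda>x. (a i x)\<^sup>2)"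
  shows "integrable M (\<lambda>x. (\<Sum>i\<in>I. a i x)\<^sup>2)"
  using assms
proof induction
  case (insert i I)
  have "integrable M (\<lambda>x. (a i x + (\<Sum>i\<in>I. a i x))\<^sup>2)"
    by (rule L2_add) (use insert in auto)
  then show ?case using insert.hyps by simp
qed simp

lemma flux_L2:
  fixes u :: "real \<times> (real^'d) \<Rightarrow> real" and g :: "real \<times> (real^'d) \<Rightarrow> real^'d"
  assumes gd: "grad_data D T u0 u g" and D [measurable]: "D \<in> borel_measurable borel"
    and Db: "\<And>m i j. m \<in> {0..1} \<Longrightarrow> \<bar>D m $ i $ j\<bar> \<le> c"
    and g2: "\<And>i. integrable (cylM T) (\<lambda>p. (g p $ i)\<^sup>2)"
  shows "(\<lambda>p. (D (u p) *v g p) $ i) \<in> borel_measurable borel"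
    and "integrable (cylM T) (\<lambda>p. ((D (u p) *v g p) $ i)\<^sup>2)"
proof -
  from gd have um [measurable]: "u \<in> borel_measurable borel" and gm [measurable]: "g \<in> borel_measurable borel"
    and b: "\<forall>p\<in>{0..T} \<times> UNIV. u p \<in> {0..1}"
    unfolding grad_data_def by blast+
  have eq: "(D (u p) *v g p) $ i = (\<Sum>j\<in>UNIV. D (u p) $ i $ j * g p $ j)" for p
    by (simp add: matrix_vector_mult_def)
  have [measurable]: "(\<lambda>p. D (u p)) \<in> borel_measurable borel" by measurable
  have em: "(\<lambda>p. D (u p) $ i $ j * g p $ j) \<in> borel_measurable borel" for j by measurable
  show "(\<lambda>p. (D (u p) *v g p) $ i) \<in> borel_measurable borel" unfolding eq using em by measurable
  show "integrable (cylM T) (\<lambda>p. ((D (u p) *v g p) $ i)\<^sup>2)"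
    unfolding eq
  proof (rule L2_sum)
    fix j
    show "(\<lambda>p. D (u p) $ i $ j * g p $ j) \<in> borel_measurable (cylM T)" using em by (simp only: borel_measurable_cylM)
    show "integrable (cylM T) (\<lambda>p. (D (u p) $ i $ j * g p $ j)\<^sup>2)"
    proof (rule L2_bounded_mult[OF g2])
      show "(\<lambda>p. D (u p) $ i $ j) \<in> borel_measurable (cylM T)" unfolding borel_measurable_cylM by measurable
      show "AE p in cylM T. \<bar>D (u p) $ i $ j\<bar> \<le> c"
        using cylM_bounded(1)[OF um b] by eventually_elim (rule Db)
    qed
  qed simp
qed

lemma weak_equation:
  fixes u :: "real \<times> (real^'d) \<Rightarrow> real" and g :: "real \<times> (real^'d) \<Rightarrow> real^'d"
  assumes gd: "grad_data D T u0 u g" and K: "torus_fun K"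
    and F: "\<And>i. (\<lambda>p. (D (u p) *v g p) $ i) \<in> borel_measurable borel"
  shows "T ^ n * conv K (\<lambda>y. u (T, y)) x - 0 ^ n * conv K u0 x
        = (\<integral>p. real n * fst p ^ (n - 1) * (K (x - snd p) * u p) \<partial>cylM T)
          + (\<integral>p. fst p ^ n * (\<Sum>i\<in>UNIV. pdx K i (x - snd p) * (D (u p) *v g p) $ i) \<partial>cylM T)"
proof -
  have [measurable]: "pdx K i \<in> borel_measurable borel" for i by (rule torus_fun_borel[OF torus_fun_pdx[OF K]])
  note F [measurable]
  have inn: "grad_x (test_fun n K x) p \<bullet> v = - (fst p ^ n * (\<Sum>i\<in>UNIV. pdx K i (x - snd p) * v $ i))" for p v
    by (simp add: test_fun_derivs(3)[OF K] inner_vec_def sum_negf sum_distrib_left mult.assoc)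
  have "(LINT p:Omega T|lborel. grad_x (test_fun n K x) p \<bullet> (D (u p) *v g p))
    = (LINT p:Omega T|lborel. - (fst p ^ n * (\<Sum>i\<in>UNIV. pdx K i (x - snd p) * (D (u p) *v g p) $ i)))"
    by (simp only: inn)
  also have "\<dots> = (\<integral>p. - (fst p ^ n * (\<Sum>i\<in>UNIV. pdx K i (x - snd p) * (D (u p) *v g p) $ i)) \<partial>cylM T)"
    by (rule integral_cylM) measurable
  also have "\<dots> = - (\<integral>p. fst p ^ n * (\<Sum>i\<in>UNIV. pdx K i (x - snd p) * (D (u p) *v g p) $ i) \<partial>cylM T)"
    by (rule integral_minus)
  finally show ?thesis using gd K unfolding grad_data_def by simp
qed

lemma grad_data_bounds:
  fixes u :: "real \<times> (real^'d) \<Rightarrow> real"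
  assumes gd: "grad_data D T u0 u g"
  shows "u \<in> borel_measurable borel" "g \<in> borel_measurable borel" "AE p in cylM T. u p \<in> {0..1}"
    "integrable (cylM T) (\<lambda>p. (norm (g p))\<^sup>2 / (u p * (1 - u p)))"
proof -
  from gd have um: "u \<in> borel_measurable borel" and b: "\<forall>p\<in>{0..T} \<times> UNIV. u p \<in> {0..1}"
    unfolding grad_data_def by blast+
  show "u \<in> borel_measurable borel" "AE p in cylM T. u p \<in> {0..1}"
    using um cylM_bounded(1)[OF um b] by auto
qed (use gd in \<open>unfold grad_data_def, blast+\<close>)

lemma grad_data_integrable:
  fixes u :: "real \<times> (real^'d) \<Rightarrow> real"
  assumes gd: "grad_data D T u0 u g"
  shows "integrable (cylM T) u"
proof -
  from gd have um: "u \<in> borel_measurable borel" and b: "\<forall>p\<in>{0..T} \<times> UNIV. u p \<in> {0..1}"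
    unfolding grad_data_def by blast+
  show ?thesis by (rule cylM_bounded(2)[OF um b])
qed

text \<open>Subtracting the two weak equations cancels the initial terms. The exponent 0 then
  identifies the difference \<open>A\<close> of the terminal values with the total integral of
  \<open>S\<close>, which brings the remaining exponents into the form that
  \<open>weak_primitive\<close> expects.\<close>

lemma difference_primitive:
  fixes u1 u2 :: "real \<times> (real^'d) \<Rightarrow> real" and g1 g2 :: "real \<times> (real^'d) \<Rightarrow> real^'d"
  assumes T: "T > 0" and gd: "grad_data D T u0 u1 g1" "grad_data D T u0 u2 g2" and K: "torus_fun K"
    and Fm: "\<And>i. (\<lambda>p. (D (u1 p) *v g1 p) $ i) \<in> borel_measurable borel" "\<And>i. (\<lambda>p. (D (u2 p) *v g2 p) $ i) \<in> borel_measurable borel"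
    and Fi: "\<And>i. integrable (cylM T) (\<lambda>p. (D (u1 p) *v g1 p) $ i)" "\<And>i. integrable (cylM T) (\<lambda>p. (D (u2 p) *v g2 p) $ i)"
  shows "AE t in timeM T. conv_x K (\<lambda>p. u1 p - u2 p) (t, x)
    = primitive T (\<lambda>s. \<Sum>i\<in>UNIV. conv_x (pdx K i) (\<lambda>p. (D (u1 p) *v g1 p) $ i - (D (u2 p) *v g2 p) $ i) (s, x)) t"
proof -
  have ui: "integrable (cylM T) u1" "integrable (cylM T) u2"
    using gd by (auto intro: grad_data_integrable)
  let ?w = "\<lambda>p. u1 p - u2 p" and ?F = "\<lambda>i p. (D (u1 p) *v g1 p) $ i - (D (u2 p) *v g2 p) $ i"
  define S1 where "S1 p = (\<Sum>i\<in>UNIV. pdx K i (x - snd p) * (D (u1 p) *v g1 p) $ i)" for p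
  define S2 where "S2 p = (\<Sum>i\<in>UNIV. pdx K i (x - snd p) * (D (u2 p) *v g2 p) $ i)" for p
  have Si: "integrable (cylM T) S1" "integrable (cylM T) S2"
    unfolding S1_def[abs_def] S2_def[abs_def]
    by (intro Bochner_Integration.integrable_sum kernel_integrable_cylM torus_fun_pdx K Fi)+
  define h where "h p = K (x - snd p) * ?w p" for p
  define S where "S p = S1 p - S2 p" for p
  have Ku: "integrable (cylM T) (\<lambda>p. K (x - snd p) * u1 p)" "integrable (cylM T) (\<lambda>p. K (x - snd p) * u2 p)"
    by (intro kernel_integrable_cylM K ui)+
  have hi: "integrable (cylM T) h" unfolding h_def[abs_def] using Ku by (simp add: right_diff_distrib)
  have Sint: "integrable (cylM T) S" unfolding S_def[abs_def] using Si by simp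
  define A where "A = conv K (\<lambda>y. u1 (T, y)) x - conv K (\<lambda>y. u2 (T, y)) x"
  have eq: "T ^ n * A = (\<integral>p. real n * fst p ^ (n - 1) * h p \<partial>cylM T) + (\<integral>p. fst p ^ n * S p \<partial>cylM T)" for n
  proof -
    have i: "integrable (cylM T) (\<lambda>p. real n * fst p ^ (n - 1) * (K (x - snd p) * u1 p))"
      "integrable (cylM T) (\<lambda>p. real n * fst p ^ (n - 1) * (K (x - snd p) * u2 p))"
      "integrable (cylM T) (\<lambda>p. fst p ^ n * S1 p)" "integrable (cylM T) (\<lambda>p. fst p ^ n * S2 p)"
      unfolding mult.assoc by (intro integrable_mult_right cylM_integrable_power Ku Si)+
    have "(\<integral>p. real n * fst p ^ (n - 1) * h p \<partial>cylM T)
      = (\<integral>p. real n * fst p ^ (n - 1) * (K (x - snd p) * u1 p) \<partial>cylM T) - (\<integral>p. real n * fst p ^ (n - 1) * (K (x - snd p) * u2 p) \<partial>cylM T)"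
      unfolding Bochner_Integration.integral_diff[OF i(1,2), symmetric]
      by (simp add: h_def right_diff_distrib)
    moreover have "(\<integral>p. fst p ^ n * S p \<partial>cylM T) = (\<integral>p. fst p ^ n * S1 p \<partial>cylM T) - (\<integral>p. fst p ^ n * S2 p \<partial>cylM T)"
      unfolding Bochner_Integration.integral_diff[OF i(3,4), symmetric]
      by (simp add: S_def right_diff_distrib)
    ultimately show ?thesis
      using weak_equation[OF gd(1) K Fm(1), of n x, folded S1_def] weak_equation[OF gd(2) K Fm(2), of n x, folded S2_def]
      unfolding A_def right_diff_distrib by linarith
  qed
  have A: "A = (\<integral>p. S p \<partial>cylM T)" using eq[of 0] by simp
  define H where "H t = (\<integral>y. h (t, y) \<partial>cubeM)" for t
  define G where "G t = (\<integral>y. S (t, y) \<partial>cubeM)" for t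
  have HG: "integrable (timeM T) H" "integrable (timeM T) G"
    unfolding H_def[abs_def] G_def[abs_def] using cyl.integrable_fst'[OF hi] cyl.integrable_fst'[OF Sint] by auto
  have "AE t in timeM T. H t = primitive T G t"
  proof (rule weak_primitive[OF HG])
    fix n
    have G0: "(\<integral>p. S p \<partial>cylM T) = (\<integral>t. G t \<partial>timeM T)"
      using cyl.integral_fst'[OF Sint] by (simp add: G_def)
    have "T ^ Suc n * (\<integral>t. G t \<partial>timeM T) = real (Suc n) * (\<integral>t. t ^ n * H t \<partial>timeM T) + (\<integral>t. t ^ Suc n * G t \<partial>timeM T)"
      using eq[of "Suc n"] slice_moment[OF hi, of n] slice_moment[OF Sint, of "Suc n"]
      by (simp add: A G0 G_def H_def mult.assoc del: power_Suc of_nat_Suc)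
    moreover have "(\<integral>t. real (Suc n) * t ^ n * H t \<partial>timeM T) = real (Suc n) * (\<integral>t. t ^ n * H t \<partial>timeM T)"
      unfolding mult.assoc by (rule integral_mult_right_zero)
    moreover have "(\<integral>t. (T ^ Suc n - t ^ Suc n) * G t \<partial>timeM T) = T ^ Suc n * (\<integral>t. G t \<partial>timeM T) - (\<integral>t. t ^ Suc n * G t \<partial>timeM T)"
      unfolding left_diff_distrib
      by (subst Bochner_Integration.integral_diff[OF integrable_mult_right[OF HG(2)] timeM_integrable_power[OF HG(2)]])
        (simp only: integral_mult_right_zero)
    ultimately show "(\<integral>t. real (Suc n) * t ^ n * H t \<partial>timeM T) = (\<integral>t. (T ^ Suc n - t ^ Suc n) * G t \<partial>timeM T)" by linarith
  qed
  moreover have "H t = conv_x K ?w (t, x)" for t by (simp add: H_def h_def conv_x_def conv_def)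
  moreover have GG: "AE s in timeM T. G s = (\<Sum>i\<in>UNIV. conv_x (pdx K i) (?F i) (s, x))"
  proof -
    have "AE s in timeM T. \<forall>i\<in>UNIV. integrable cubeM (\<lambda>y. pdx K i (x - y) * ?F i (s, y))"
    proof (subst AE_ball_countable)
      show "\<forall>i\<in>UNIV. AE s in timeM T. integrable cubeM (\<lambda>y. pdx K i (x - y) * ?F i (s, y))"
      proof
        fix i
        have "integrable (cylM T) (\<lambda>p. pdx K i (x - snd p) * ?F i p)"
          by (intro kernel_integrable_cylM torus_fun_pdx K Bochner_Integration.integrable_diff Fi)
        from cyl.AE_integrable_fst'[OF this] show "AE s in timeM T. integrable cubeM (\<lambda>y. pdx K i (x - y) * ?F i (s, y))" by simp
      qed
    qed (simp add: countable_finite)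
    then show ?thesis
    proof eventually_elim
      case (elim s)
      have "G s = (\<integral>y. (\<Sum>i\<in>UNIV. pdx K i (x - y) * ?F i (s, y)) \<partial>cubeM)"
        by (simp add: G_def S_def S1_def S2_def right_diff_distrib sum_subtractf)
      also have "\<dots> = (\<Sum>i\<in>UNIV. \<integral>y. pdx K i (x - y) * ?F i (s, y) \<partial>cubeM)"
        by (rule Bochner_Integration.integral_sum) (use elim in blast)
      finally show ?case by (simp only: conv_x_def conv_def fst_conv snd_conv)
    qed
  qed
  moreover have "primitive T G t = primitive T (\<lambda>s. \<Sum>i\<in>UNIV. conv_x (pdx K i) (?F i) (s, x)) t" for t
  proof (rule primitive_cong_AE[OF GG])
    show "G \<in> borel_measurable borel" using HG(2) by auto
    have "conv_x (pdx K i) (?F i) \<in> borel_measurable borel" for i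
      by (intro conv_x_borel borel_measurable_diff Fm torus_fun_borel torus_fun_pdx K)
    from measurable_compose[OF _ this, of "\<lambda>s. (s, x)"]
    have "(\<lambda>s. conv_x (pdx K i) (?F i) (s, x)) \<in> borel_measurable borel" for i
      by (simp add: borel_measurable_continuous_onI continuous_intros)
    then show "(\<lambda>s. \<Sum>i\<in>UNIV. conv_x (pdx K i) (?F i) (s, x)) \<in> borel_measurable borel"
      by (rule borel_measurable_sum)
  qed
  ultimately show ?thesis by simp
qed

lemma weak_grad_diff:
  fixes u1 u2 :: "real \<times> (real^'d) \<Rightarrow> real"
  assumes "weak_grad T u1 i g1" "weak_grad T u2 i g2" and i: "integrable (cylM T) u1" "integrable (cylM T) u2"
    "integrable (cylM T) g1" "integrable (cylM T) g2"
  shows "weak_grad T (\<lambda>p. u1 p - u2 p) i (\<lambda>p. g1 p - g2 p)"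
  unfolding weak_grad_def
proof (intro allI impI)
  fix K :: "real^'d \<Rightarrow> real" and n x assume K: "torus_fun K"
  have d: "(\<integral>p. fst p ^ n * (k (x - snd p) * (a p - b p)) \<partial>cylM T)
    = (\<integral>p. fst p ^ n * (k (x - snd p) * a p) \<partial>cylM T) - (\<integral>p. fst p ^ n * (k (x - snd p) * b p) \<partial>cylM T)"
    if "torus_fun k" "integrable (cylM T) a" "integrable (cylM T) b" for k and a b :: "real \<times> (real^'d) \<Rightarrow> real"
    unfolding right_diff_distrib
    by (rule Bochner_Integration.integral_diff) (intro cylM_integrable_power kernel_integrable_cylM that)+
  show "(\<integral>p. fst p ^ n * (pdx K i (x - snd p) * (u1 p - u2 p)) \<partial>cylM T) = (\<integral>p. fst p ^ n * (K (x - snd p) * (g1 p - g2 p)) \<partial>cylM T)"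
    using assms(1,2) K by (simp add: d torus_fun_pdx i weak_grad_def)
qed

lemma uniqueness_regular:
  fixes u1 u2 :: "real \<times> (real^'d) \<Rightarrow> real" and g1 g2 :: "real \<times> (real^'d) \<Rightarrow> real^'d"
  assumes T: "T > 0" and gd1: "grad_data D T u0 u1 g1" and gd2: "grad_data D T u0 u2 g2"
    and D: "D \<in> borel_measurable borel" and c: "c > 0"
    and Db: "\<And>m i j. m \<in> {0..1} \<Longrightarrow> \<bar>D m $ i $ j\<bar> \<le> c"
    and Dc: "\<And>m \<xi>. m \<in> {0..1} \<Longrightarrow> inverse c * norm \<xi> ^ 2 \<le> \<xi> \<bullet> (D m *v \<xi>)"
    and Dh: "\<And>x y. x \<in> {0<..<1} \<Longrightarrow> y \<in> {0..1} \<Longrightarrow> (norm (D x - D y))\<^sup>2 \<le> C / (x * (1 - x)) * \<bar>x - y\<bar>"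
    and good1: "\<And>i. integrable (cylM T) (\<lambda>p. g1 p $ i)" "\<And>i. weak_grad T u1 i (\<lambda>p. g1 p $ i)"
    and good2: "\<And>i. integrable (cylM T) (\<lambda>p. g2 p $ i)" "\<And>i. weak_grad T u2 i (\<lambda>p. g2 p $ i)"
  shows "AE p in cylM T. u1 p = u2 p"
proof -
  note b1 = grad_data_bounds[OF gd1] and b2 = grad_data_bounds[OF gd2]
  have [measurable]: "u1 \<in> borel_measurable borel" "u2 \<in> borel_measurable borel"
    "g1 \<in> borel_measurable borel" "g2 \<in> borel_measurable borel"
    using b1 b2 by auto
  note G1 = good_case[OF gd1 good1] and G2 = good_case[OF gd2 good2]
  note F1 = flux_L2[OF gd1 D Db G1(2)] and F2 = flux_L2[OF gd2 D Db G2(2)]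
  define w where "w p = u1 p - u2 p" for p
  define g where "g i p = g1 p $ i - g2 p $ i" for i p
  define F where "F i p = (D (u1 p) *v g1 p) $ i - (D (u2 p) *v g2 p) $ i" for i p
  have L2_diff: "integrable (cylM T) (\<lambda>p. (a p - b p)\<^sup>2)"
    if "a \<in> borel_measurable borel" "b \<in> borel_measurable borel" "integrable (cylM T) (\<lambda>p. (a p)\<^sup>2)" "integrable (cylM T) (\<lambda>p. (b p)\<^sup>2)"
    for a b :: "real \<times> (real^'d) \<Rightarrow> real"
    using L2_add[of a "cylM T" "\<lambda>p. - b p"] that by (simp add: borel_measurable_cylM)
  have wi: "integrable (cylM T) w" unfolding w_def[abs_def]
    by (intro Bochner_Integration.integrable_diff grad_data_integrable[OF gd1] grad_data_integrable[OF gd2])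
  have wm [measurable]: "w \<in> borel_measurable borel" unfolding w_def[abs_def] by measurable
  have gm: "g i \<in> borel_measurable borel" for i unfolding g_def[abs_def] by measurable
  have g2: "integrable (cylM T) (\<lambda>p. (g i p)\<^sup>2)" for i
    unfolding g_def[abs_def] by (rule L2_diff) (measurable, rule G1(2), rule G2(2))
  have Fm: "F i \<in> borel_measurable borel" for i
    unfolding F_def[abs_def] by (intro borel_measurable_diff F1(1) F2(1))
  have Fi: "integrable (cylM T) (\<lambda>p. (F i p)\<^sup>2)" for i
    unfolding F_def[abs_def] by (rule L2_diff[OF F1(1) F2(1) F1(2) F2(2)])
  have wg: "weak_grad T w i (g i)" for i
    unfolding w_def[abs_def] g_def[abs_def]
    by (rule weak_grad_diff[OF good1(2) good2(2) grad_data_integrable[OF gd1] grad_data_integrable[OF gd2] good1(1) good2(1)])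
  have pr: "AE t in timeM T. conv_x K w (t, x) = primitive T (\<lambda>s. \<Sum>i\<in>UNIV. conv_x (pdx K i) (F i) (s, x)) t" if "torus_fun K" for K x
    unfolding w_def[abs_def] F_def[abs_def]
    by (rule difference_primitive[OF T gd1 gd2 that F1(1) F2(1) L2_integrable_cylM[OF F1] L2_integrable_cylM[OF F2]])
  \<comment> \<open>The dissipation density of \<open>u1\<close>, scaled by
    \<open>\<bar>C\<bar>\<close> so that it is nonnegative whatever the sign of
    \<open>C\<close>.\<close>
  define R where "R p = \<bar>C\<bar> * ((norm (g1 p))\<^sup>2 / (u1 p * (1 - u1 p)))" for p
  have Ri: "integrable (cylM T) R" unfolding R_def[abs_def] by (rule integrable_mult_right[OF b1(4)])
  have key: "AE p in cylM T. - (\<Sum>i\<in>UNIV. g i p * F i p) \<le> c / 4 * (\<bar>w p\<bar> * R p) \<and> 0 \<le> R p"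
    using b1(3) b2(3) G1(1)
  proof eventually_elim
    case (elim p)
    have R0: "0 \<le> R p" unfolding R_def using elim(1) by (intro mult_nonneg_nonneg divide_nonneg_nonneg) auto
    have "(\<Sum>i\<in>UNIV. g i p * F i p) = (g1 p - g2 p) \<bullet> (D (u1 p) *v g1 p - D (u2 p) *v g2 p)"
      by (simp add: g_def F_def inner_vec_def)
    then have "- (\<Sum>i\<in>UNIV. g i p * F i p) \<le> c / 4 * (norm (D (u1 p) - D (u2 p)) * norm (g1 p))\<^sup>2"
      using coercive_difference[OF c, of "D (u2 p)" "g1 p" "g2 p" "D (u1 p)"] Dc[OF elim(2)] by simp
    also have "\<dots> \<le> c / 4 * (\<bar>w p\<bar> * R p)"
    proof (rule mult_left_mono)
      show "(norm (D (u1 p) - D (u2 p)) * norm (g1 p))\<^sup>2 \<le> \<bar>w p\<bar> * R p"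
      proof (cases "u1 p \<in> {0<..<1}")
        case True
        have "(norm (D (u1 p) - D (u2 p)))\<^sup>2 \<le> C / (u1 p * (1 - u1 p)) * \<bar>w p\<bar>"
          using Dh[OF True elim(2)] by (simp add: w_def)
        also have "\<dots> \<le> \<bar>C\<bar> / (u1 p * (1 - u1 p)) * \<bar>w p\<bar>"
          using True by (intro mult_right_mono divide_right_mono) auto
        finally have "(norm (D (u1 p) - D (u2 p)))\<^sup>2 * (norm (g1 p))\<^sup>2
           \<le> \<bar>C\<bar> / (u1 p * (1 - u1 p)) * \<bar>w p\<bar> * (norm (g1 p))\<^sup>2"
          by (rule mult_right_mono) simp
        then show ?thesis by (simp add: power_mult_distrib R_def mult_ac)
      next
        case False
        \<comment> \<open>Here \<open>u1\<close> is 0 or 1, so \<open>g1\<close> vanishes by the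
          level set theorem and the left side is 0.\<close>
        then show ?thesis using elim(3) R0 by simp
      qed
    qed (use c in simp)
    finally show ?case using R0 by blast
  qed
  define \<mu> where "\<mu> = measure (cylM T :: (real \<times> (real^'d)) measure) UNIV"
  \<comment> \<open>The factor \<open>\<bar>w p\<bar>\<close> that the hypothesis on
    \<open>D\<close> supplies compensates the second derivative, whose own bound
    \<open>1 / e\<close> blows up.\<close>
  define \<phi> where "\<phi> e p = e\<^sup>2 / sqrt ((w p)\<^sup>2 + e\<^sup>2) ^ 3 * \<bar>w p\<bar>" for e p
  have \<phi>1: "0 \<le> \<phi> e p" "\<phi> e p \<le> 1" if "e > 0" for e p
    using smooth_abs_facts(7,8)[OF that, of "w p"] by (auto simp: \<phi>_def)
  have \<phi>m: "\<phi> e \<in> borel_measurable (cylM T)" for e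
    unfolding \<phi>_def[abs_def] borel_measurable_cylM by measurable
  have \<phi>R: "integrable (cylM T) (\<lambda>p. \<phi> e p * R p)" if "e > 0" for e
    by (rule integrable_bounded_mult[OF Ri \<phi>m, where B=1]) (use \<phi>1[OF that] in auto)
  \<comment> \<open>The term \<open>e * \<mu>\<close> is the cost of returning from the smoothed
    absolute value to \<open>\<bar>w p\<bar>\<close>, from which it differs by at most
    \<open>e\<close>.\<close>
  have est: "(\<integral>p. \<bar>w p\<bar> \<partial>cylM T) \<le> e * \<mu> + T * (c / 4) * (\<integral>p. \<phi> e p * R p \<partial>cylM T)" if e: "e > 0" for e
  proof -
    note hf = smooth_abs_facts[OF e]
    let ?f = "\<lambda>r. sqrt (r\<^sup>2 + e\<^sup>2) - e" and ?f'' = "\<lambda>r. e\<^sup>2 / sqrt (r\<^sup>2 + e\<^sup>2) ^ 3"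
    have en: "(\<integral>p. ?f (w p) \<partial>cylM T) \<le> - (\<integral>p. (T - fst p) * ?f'' (w p) * (\<Sum>i\<in>UNIV. g i p * F i p) \<partial>cylM T)"
      and fi: "integrable (cylM T) (\<lambda>p. ?f (w p))"
      and ei: "integrable (cylM T) (\<lambda>p. (T - fst p) * ?f'' (w p) * (\<Sum>i\<in>UNIV. g i p * F i p))"
      using energy_inequality[OF less_imp_le[OF T] wi gm g2 Fm Fi wg pr hf(4) _ hf(1,2,3,5,6)] e by simp_all
    have "(\<integral>p. \<bar>w p\<bar> \<partial>cylM T) - e * \<mu> = (\<integral>p. \<bar>w p\<bar> - e \<partial>cylM T)"
      using wi by (simp add: \<mu>_def)
    also have "\<dots> \<le> (\<integral>p. ?f (w p) \<partial>cylM T)"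
      by (rule integral_mono) (use wi fi hf(9) in auto)
    also have "\<dots> \<le> (\<integral>p. - ((T - fst p) * ?f'' (w p) * (\<Sum>i\<in>UNIV. g i p * F i p)) \<partial>cylM T)"
      using en by (simp only: integral_minus)
    also have "\<dots> \<le> (\<integral>p. T * (c / 4) * (\<phi> e p * R p) \<partial>cylM T)"
    proof (rule integral_mono_AE)
      show "AE p in cylM T. - ((T - fst p) * ?f'' (w p) * (\<Sum>i\<in>UNIV. g i p * F i p)) \<le> T * (c / 4) * (\<phi> e p * R p)"
        using key AE_cylM_fst
      proof eventually_elim
        case (elim p)
        have t: "0 \<le> T - fst p" "T - fst p \<le> T" using elim(2) by auto
        have "- ((T - fst p) * ?f'' (w p) * (\<Sum>i\<in>UNIV. g i p * F i p)) = (T - fst p) * ?f'' (w p) * - (\<Sum>i\<in>UNIV. g i p * F i p)"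
          by simp
        also have "\<dots> \<le> (T - fst p) * ?f'' (w p) * (c / 4 * (\<bar>w p\<bar> * R p))"
          using elim(1) t hf(8)[of "w p"] by (intro mult_left_mono mult_nonneg_nonneg) auto
        also have "\<dots> = (T - fst p) * (c / 4 * (\<phi> e p * R p))" by (simp add: \<phi>_def mult_ac)
        also have "\<dots> \<le> T * (c / 4 * (\<phi> e p * R p))"
          using t c elim(1) \<phi>1[OF e, of p] by (intro mult_right_mono mult_nonneg_nonneg) auto
        finally show ?case by (simp only: mult.assoc)
      qed
      show "integrable (cylM T) (\<lambda>p. T * (c / 4) * (\<phi> e p * R p))" by (rule integrable_mult_right[OF \<phi>R[OF e]])
    qed (rule Bochner_Integration.integrable_minus[OF ei])
    also have "\<dots> = T * (c / 4) * (\<integral>p. \<phi> e p * R p \<partial>cylM T)" by (rule integral_mult_right_zero)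
    finally show ?thesis by linarith
  qed
  define \<epsilon> where "\<epsilon> n = inverse (real (Suc n))" for n
  have \<epsilon>: "\<epsilon> \<longlonglongrightarrow> 0" "\<And>n. \<epsilon> n > 0" unfolding \<epsilon>_def[abs_def] using LIMSEQ_inverse_real_of_nat by auto
  \<comment> \<open>The integrable bound \<open>\<bar>R p\<bar>\<close> does not depend on
    \<open>n\<close>, so pointwise convergence is enough and no rate enters.\<close>
  have "(\<lambda>n. \<integral>p. \<phi> (\<epsilon> n) p * R p \<partial>cylM T) \<longlonglongrightarrow> (\<integral>p. 0 \<partial>(cylM T :: (real \<times> (real^'d)) measure))"
  proof (rule integral_dominated_convergence[where w="\<lambda>p. \<bar>R p\<bar>"])
    show "AE p in cylM T. (\<lambda>n. \<phi> (\<epsilon> n) p * R p) \<longlonglongrightarrow> 0"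
    proof (rule AE_I2)
      fix p
      have "(\<lambda>n. \<phi> (\<epsilon> n) p) \<longlonglongrightarrow> 0" unfolding \<phi>_def by (rule smooth_abs_tendsto[OF \<epsilon>(1)])
      from tendsto_mult_right[OF this, of "R p"] show "(\<lambda>n. \<phi> (\<epsilon> n) p * R p) \<longlonglongrightarrow> 0" by simp
    qed
    show "AE p in cylM T. norm (\<phi> (\<epsilon> n) p * R p) \<le> \<bar>R p\<bar>" for n
    proof (rule AE_I2)
      fix p
      have "\<bar>\<phi> (\<epsilon> n) p\<bar> * \<bar>R p\<bar> \<le> 1 * \<bar>R p\<bar>" using \<phi>1[OF \<epsilon>(2), of n p] by (intro mult_right_mono) auto
      then show "norm (\<phi> (\<epsilon> n) p * R p) \<le> \<bar>R p\<bar>" by (simp add: abs_mult)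
    qed
  qed (use Ri \<phi>R[OF \<epsilon>(2)] in auto)
  then have l: "(\<lambda>n. \<integral>p. \<phi> (\<epsilon> n) p * R p \<partial>cylM T) \<longlonglongrightarrow> 0" by simp
  have "(\<lambda>n. \<epsilon> n * \<mu> + T * (c / 4) * (\<integral>p. \<phi> (\<epsilon> n) p * R p \<partial>cylM T)) \<longlonglongrightarrow> 0 * \<mu> + T * (c / 4) * 0"
    by (intro tendsto_intros \<epsilon>(1) l)
  then have "(\<integral>p. \<bar>w p\<bar> \<partial>cylM T) \<le> 0 * \<mu> + T * (c / 4) * 0"
    by (rule LIMSEQ_le_const) (use est[OF \<epsilon>(2)] in blast)
  moreover have "0 \<le> (\<integral>p. \<bar>w p\<bar> \<partial>cylM T)" by simp
  ultimately have "(\<integral>p. \<bar>w p\<bar> \<partial>cylM T) = 0" by simp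
  then have "AE p in cylM T. \<bar>w p\<bar> = 0"
    using wi by (subst (asm) integral_nonneg_eq_0_iff_AE) auto
  then show ?thesis by (auto elim!: eventually_mono simp: w_def)
qed

theorem theorem6:
  fixes D :: "real \<Rightarrow> real^'d^'d" and T :: real and u0 :: "real^'d \<Rightarrow> real"
    and u1 u2 :: "real \<times> (real^'d) \<Rightarrow> real"
  assumes "admissible_D D"
    and "T > 0"
    and "weak_solution D T u0 u1"
    and "weak_solution D T u0 u2"
    and "\<exists>C::real. \<forall>x\<in>{0<..<1}. \<forall>y\<in>{0..1}.
           (norm (D x - D y))\<^sup>2 \<le> C / (x * (1 - x)) * \<bar>x - y\<bar>"
  shows "AE p in lborel. p \<in> Omega T \<longrightarrow> u1 p = u2 p"
  unfolding AE_cylM[symmetric]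
proof -
  note T = \<open>T > 0\<close>
  obtain g1 where gd1: "grad_data D T u0 u1 g1" using weak_solution_grad_data[OF assms(3)] .
  obtain g2 where gd2: "grad_data D T u0 u2 g2" using weak_solution_grad_data[OF assms(4)] .
  have const: "AE p in cylM T. u1 p = u2 p"
    if "AE p in cylM T. u1 p = (\<integral>y. u0 y \<partial>cubeM)" "AE p in cylM T. u2 p = (\<integral>y. u0 y \<partial>cubeM)"
    using that by eventually_elim simp
  from gd1 show "AE p in cylM T. u1 p = u2 p"
  proof (cases rule: grad_data_cases)
    case (bad i)
    \<comment> \<open>The degenerate \<open>u1\<close> forces the initial mean to be 0 or 1, and by
      conservation of mass this determines \<open>u2\<close> as well.\<close>
    show ?thesis
      by (rule const[OF bad_case_const(2)[OF gd1 T bad] extreme_mean_const[OF gd2 T bad_case_const(1)[OF gd1 T bad]]])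
  next
    case good1: good
    from gd2 show ?thesis
    proof (cases rule: grad_data_cases)
      case (bad i)
      show ?thesis
        by (rule const[OF extreme_mean_const[OF gd1 T bad_case_const(1)[OF gd2 T bad]] bad_case_const(2)[OF gd2 T bad]])
    next
      case good2: good
      obtain C where C: "\<forall>x\<in>{0<..<1}. \<forall>y\<in>{0..1}. (norm (D x - D y))\<^sup>2 \<le> C / (x * (1 - x)) * \<bar>x - y\<bar>"
        using assms(5) by blast
      obtain c where D: "D \<in> borel_measurable borel" "\<forall>m. transpose (D m) = D m" and c: "c > 0"
        and q: "\<forall>m\<in>{0..1}. \<forall>\<xi>::real^'d. inverse c * norm \<xi> ^ 2 \<le> \<xi> \<bullet> (D m *v \<xi>) \<and> \<xi> \<bullet> (D m *v \<xi>) \<le> c * norm \<xi> ^ 2"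
        using assms(1) unfolding admissible_D_def by blast
      show ?thesis
      proof (rule uniqueness_regular[OF T gd1 gd2 D(1) c _ _ _ good1 good2])
        show "\<bar>D m $ i $ j\<bar> \<le> c" if "m \<in> {0..1}" for m i j
          by (rule entry_bound[OF _ c]) (use D(2) q that in auto)
        show "inverse c * norm \<xi> ^ 2 \<le> \<xi> \<bullet> (D m *v \<xi>)" if "m \<in> {0..1}" for m and \<xi> :: "real^'d"
          using q that by blast
        show "(norm (D x - D y))\<^sup>2 \<le> C / (x * (1 - x)) * \<bar>x - y\<bar>" if "x \<in> {0<..<1}" "y \<in> {0..1}" for x y
          using C that by blast
      qed
    qed
  qed
qed

end
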